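(* Suppose that $\mathbb{P}$ is a forcing poset which is strongly proper on a stationary set and $\mathbb{Q}$ is an $\omega_1$-closed forcing poset. Then $\mathbb{P}$ forces that $\mathbb{Q}$ is $\omega_1$-distributive.
   Context: A forcing poset is $\omega_1$-closed if every countable descending sequence of conditions has a lower bound; it is $\omega_1$-distributive if it adds no new countable sets of ordinals. For a forcing poset $\mathbb{P}$ and a set $N$ with $N \cap \mathbb{P} \neq \emptyset$, a condition $q$ is strongly $(N,\mathbb{P})$-generic if every dense subset of the forcing poset $N \cap \mathbb{P}$ is predense below $q$ (in $\mathbb{P}$). $\mathbb{P}$ is strongly proper for $N$ if every $p \in N \cap \mathbb{P}$ has an extension $q \le p$ which is strongly $(N,\mathbb{P})$-generic. $\mathbb{P}$ is strongly proper on a stationary set if for all sufficiently large cardinals $\chi \ge \omega_1$ with $\mathbb{P} \in H(\chi)$, there are stationarily many $N \in P_{\omega_1}(H(\chi))$ with $N \cap \omega_1 \in \omega_1$ such that $\mathbb{P}$ is strongly proper for $N$. *)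

theory Defs
  imports "HOL-Library.Countable_Set" "HOL-Library.Equipollence"
begin

text \<open>
  The universe of sets is a type of class \<open>zfc\<close>; \<open>elts x\<close> is the extension of the set \<open>x\<close>.
  Replacement and separation are stated for arbitrary HOL functions and predicates. The axiom of
  choice is inherited from HOL's choice operator. A consequence is that every HOL function
  between sets, and every HOL subset of a set, is represented by an element of the universe, so
  that countability, cardinality and families of subsets can be expressed by the HOL notions.
\<close>

class zfc =
  fixes elts :: "'a \<Rightarrow> 'a set"
  assumes extensionality: "elts x = elts y \<Longrightarrow> x = y"
    and foundation: "wf {(x, y). x \<in> elts y}"
    and pairing: "\<exists>z. elts z = {x, y}"
    and union: "\<exists>u. elts u = \<Union> (elts ` elts x)"
    and powerset: "\<exists>u. elts u = {y. elts y \<subseteq> elts x}"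
    and separation: "\<exists>u. elts u = {y \<in> elts x. R y}"
    and replacement: "\<exists>u. elts u = f ` elts x"
    and infinity: "\<exists>w. (\<exists>z\<in>elts w. elts z = {}) \<and>
                      (\<forall>x\<in>elts w. \<exists>y\<in>elts w. elts y = insert x (elts x))"

text \<open>Meaningful only for those \<open>A\<close> that are the extension of a set.\<close>

definition vset :: "'v::zfc set \<Rightarrow> 'v" where
  "vset A = (THE x. elts x = A)"

definition vpair :: "'v::zfc \<Rightarrow> 'v \<Rightarrow> 'v" where
  "vpair x y = vset {vset {x}, vset {x, y}}"


section \<open>Ordinals, cardinals, \<open>H(\<chi>)\<close>, stationary sets\<close>

definition transitive :: "'v::zfc \<Rightarrow> bool" where
  "transitive x \<longleftrightarrow> (\<forall>y\<in>elts x. elts y \<subseteq> elts x)"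

definition ordinal :: "'v::zfc \<Rightarrow> bool" where
  "ordinal x \<longleftrightarrow> transitive x \<and> (\<forall>y\<in>elts x. transitive y)"

definition cardinal :: "'v::zfc \<Rightarrow> bool" where
  "cardinal \<kappa> \<longleftrightarrow> ordinal \<kappa> \<and> (\<forall>\<alpha>\<in>elts \<kappa>. elts \<alpha> \<prec> elts \<kappa>)"

text \<open>The extension of the ordinal \<open>\<omega>\<^sub>1\<close>.\<close>

definition omega1 :: "'v::zfc set" where
  "omega1 = {\<alpha>. ordinal \<alpha> \<and> countable (elts \<alpha>)}"

definition trcl :: "'v::zfc \<Rightarrow> 'v set" where
  "trcl x = {y. (y, x) \<in> {(a, b). a \<in> elts b}\<^sup>+}"

definition H :: "'v::zfc \<Rightarrow> 'v set" where
  "H \<chi> = {x. trcl x \<prec> elts \<chi>}"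

definition countable_subsets :: "'a set \<Rightarrow> 'a set set" where
  "countable_subsets X = {N. N \<subseteq> X \<and> countable N}"

definition club :: "'a set \<Rightarrow> 'a set set \<Rightarrow> bool" where
  "club X C \<longleftrightarrow> C \<subseteq> countable_subsets X \<and>
     (\<forall>M\<in>countable_subsets X. \<exists>N\<in>C. M \<subseteq> N) \<and>
     (\<forall>N :: nat \<Rightarrow> 'a set. range N \<subseteq> C \<and> mono N \<longrightarrow> (\<Union>n. N n) \<in> C)"

definition stationary :: "'a set \<Rightarrow> 'a set set \<Rightarrow> bool" where
  "stationary X S \<longleftrightarrow> S \<subseteq> countable_subsets X \<and> (\<forall>C. club X C \<longrightarrow> S \<inter> C \<noteq> {})"


section \<open>Forcing posets\<close>

text \<open>
  A forcing poset is given by its underlying set \<open>P\<close> and the set \<open>le\<close> of pairs representing its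
  ordering. As usual in forcing, antisymmetry is not required.
\<close>

definition leq :: "'v::zfc \<Rightarrow> 'v \<Rightarrow> 'v \<Rightarrow> bool" where
  "leq le p q \<longleftrightarrow> vpair p q \<in> elts le"

definition forcing_poset :: "'v::zfc \<Rightarrow> 'v \<Rightarrow> bool" where
  "forcing_poset P le \<longleftrightarrow> elts P \<noteq> {} \<and>
     elts le \<subseteq> {vpair p q |p q. p \<in> elts P \<and> q \<in> elts P} \<and>
     (\<forall>p\<in>elts P. leq le p p) \<and>
     (\<forall>p\<in>elts P. \<forall>q\<in>elts P. \<forall>r\<in>elts P. leq le p q \<and> leq le q r \<longrightarrow> leq le p r)"

definition omega1_closed :: "'v::zfc \<Rightarrow> 'v \<Rightarrow> bool" where
  "omega1_closed P le \<longleftrightarrow>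
     (\<forall>p :: nat \<Rightarrow> 'v. range p \<subseteq> elts P \<and> (\<forall>n. leq le (p (Suc n)) (p n)) \<longrightarrow>
        (\<exists>q\<in>elts P. \<forall>n. leq le q (p n)))"

definition dense_in :: "'v::zfc \<Rightarrow> 'v set \<Rightarrow> 'v set \<Rightarrow> bool" where
  "dense_in le A D \<longleftrightarrow> D \<subseteq> A \<and> (\<forall>p\<in>A. \<exists>d\<in>D. leq le d p)"

definition compatible :: "'v::zfc \<Rightarrow> 'v \<Rightarrow> 'v \<Rightarrow> 'v \<Rightarrow> bool" where
  "compatible P le p q \<longleftrightarrow> (\<exists>r\<in>elts P. leq le r p \<and> leq le r q)"

definition predense_below :: "'v::zfc \<Rightarrow> 'v \<Rightarrow> 'v set \<Rightarrow> 'v \<Rightarrow> bool" where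
  "predense_below P le D q \<longleftrightarrow>
     (\<forall>r\<in>elts P. leq le r q \<longrightarrow> (\<exists>d\<in>D. compatible P le d r))"

definition strongly_generic :: "'v::zfc \<Rightarrow> 'v \<Rightarrow> 'v set \<Rightarrow> 'v \<Rightarrow> bool" where
  "strongly_generic P le N q \<longleftrightarrow> q \<in> elts P \<and>
     (\<forall>D. dense_in le (N \<inter> elts P) D \<longrightarrow> predense_below P le D q)"

definition strongly_proper_for :: "'v::zfc \<Rightarrow> 'v \<Rightarrow> 'v set \<Rightarrow> bool" where
  "strongly_proper_for P le N \<longleftrightarrow> N \<inter> elts P \<noteq> {} \<and>
     (\<forall>p\<in>N \<inter> elts P. \<exists>q\<in>elts P. leq le q p \<and> strongly_generic P le N q)"

definition strongly_proper_on_stationary :: "'v::zfc \<Rightarrow> 'v \<Rightarrow> bool" where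
  "strongly_proper_on_stationary P le \<longleftrightarrow>
     (\<exists>\<mu>. cardinal \<mu> \<and>
       (\<forall>\<chi>. cardinal \<chi> \<and> elts \<mu> \<subseteq> elts \<chi> \<and> omega1 \<subseteq> elts \<chi> \<and> vpair P le \<in> H \<chi> \<longrightarrow>
          stationary (H \<chi>)
            {N \<in> countable_subsets (H \<chi>).
               (\<exists>\<alpha>\<in>omega1. N \<inter> omega1 = elts \<alpha>) \<and> strongly_proper_for P le N}))"


section \<open>The language of set theory\<close>

text \<open>
  Formulas with parameters from the universe; bound variables are represented by HOL functions.
  A formula that is to be forced takes names as parameters.
\<close>

datatype 'v fm =
    Mem 'v 'v
  | Eq 'v 'v
  | Neg "'v fm"
  | Conj "'v fm" "'v fm"
  | Forall "'v \<Rightarrow> 'v fm"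

primrec sat :: "'v::zfc fm \<Rightarrow> bool" where
  "sat (Mem x y) \<longleftrightarrow> x \<in> elts y"
| "sat (Eq x y) \<longleftrightarrow> x = y"
| "sat (Neg \<phi>) \<longleftrightarrow> \<not> sat \<phi>"
| "sat (Conj \<phi> \<psi>) \<longleftrightarrow> sat \<phi> \<and> sat \<psi>"
| "sat (Forall F) \<longleftrightarrow> (\<forall>x. sat (F x))"

definition Disj :: "'v fm \<Rightarrow> 'v fm \<Rightarrow> 'v fm" where
  "Disj \<phi> \<psi> = Neg (Conj (Neg \<phi>) (Neg \<psi>))"

definition Imp :: "'v fm \<Rightarrow> 'v fm \<Rightarrow> 'v fm" where
  "Imp \<phi> \<psi> = Neg (Conj \<phi> (Neg \<psi>))"

definition Iff :: "'v fm \<Rightarrow> 'v fm \<Rightarrow> 'v fm" where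
  "Iff \<phi> \<psi> = Conj (Imp \<phi> \<psi>) (Imp \<psi> \<phi>)"

definition Exists :: "('v \<Rightarrow> 'v fm) \<Rightarrow> 'v fm" where
  "Exists F = Neg (Forall (\<lambda>x. Neg (F x)))"

definition BForall :: "'v \<Rightarrow> ('v \<Rightarrow> 'v fm) \<Rightarrow> 'v fm" where
  "BForall a F = Forall (\<lambda>x. Imp (Mem x a) (F x))"

definition BExists :: "'v \<Rightarrow> ('v \<Rightarrow> 'v fm) \<Rightarrow> 'v fm" where
  "BExists a F = Exists (\<lambda>x. Conj (Mem x a) (F x))"

text \<open>\<open>z = {x, y}\<close>; \<open>z = (x, y)\<close>; \<open>(x, y) \<in> r\<close>; \<open>(x, (y, z)) \<in> r\<close>\<close>

definition IsUpair :: "'v \<Rightarrow> 'v \<Rightarrow> 'v \<Rightarrow> 'v fm" where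
  "IsUpair x y z = Forall (\<lambda>w. Iff (Mem w z) (Disj (Eq w x) (Eq w y)))"

definition IsPair :: "'v \<Rightarrow> 'v \<Rightarrow> 'v \<Rightarrow> 'v fm" where
  "IsPair x y z = Exists (\<lambda>a. Exists (\<lambda>b.
     Conj (IsUpair x x a) (Conj (IsUpair x y b) (IsUpair a b z))))"

definition PairIn :: "'v \<Rightarrow> 'v \<Rightarrow> 'v \<Rightarrow> 'v fm" where
  "PairIn x y r = Exists (\<lambda>z. Conj (IsPair x y z) (Mem z r))"

definition TripleIn :: "'v \<Rightarrow> 'v \<Rightarrow> 'v \<Rightarrow> 'v \<Rightarrow> 'v fm" where
  "TripleIn x y z r = Exists (\<lambda>u. Conj (IsPair y z u) (PairIn x u r))"

definition Trans :: "'v \<Rightarrow> 'v fm" where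
  "Trans x = BForall x (\<lambda>y. BForall y (\<lambda>z. Mem z x))"

definition Ord :: "'v \<Rightarrow> 'v fm" where
  "Ord x = Conj (Trans x) (BForall x Trans)"

definition LimitOrd :: "'v \<Rightarrow> 'v fm" where
  "LimitOrd x = Conj (Ord x) (Conj (Exists (\<lambda>y. Mem y x))
     (BForall x (\<lambda>y. BExists x (\<lambda>z. Mem y z))))"

definition IsOmega :: "'v \<Rightarrow> 'v fm" where
  "IsOmega x = Conj (LimitOrd x) (BForall x (\<lambda>y. Neg (LimitOrd y)))"

text \<open>Some \<open>f\<close> restricts to an injective function from \<open>x\<close> into \<open>\<omega>\<close>.\<close>

definition Countable :: "'v \<Rightarrow> 'v fm" where
  "Countable x = Exists (\<lambda>w. Conj (IsOmega w) (Exists (\<lambda>f.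
     Conj (BForall x (\<lambda>y. BExists w (\<lambda>n. PairIn y n f)))
    (Conj (BForall x (\<lambda>y. BForall w (\<lambda>m. BForall w (\<lambda>n.
             Imp (Conj (PairIn y m f) (PairIn y n f)) (Eq m n)))))
          (BForall x (\<lambda>y. BForall x (\<lambda>z. BForall w (\<lambda>n.
             Imp (Conj (PairIn y n f) (PairIn z n f)) (Eq y z)))))))))"

definition CountableSetOfOrdinals :: "'v \<Rightarrow> 'v fm" where
  "CountableSetOfOrdinals x = Conj (BForall x Ord) (Countable x)"


section \<open>The forcing relation\<close>

text \<open>
  The formulas in this section express the forcing relation of \<open>(P, le)\<close> in the language of set
  theory. They can therefore be evaluated in the universe by \<^const>\<open>sat\<close>, but they can also
  themselves be forced by another poset. The clauses for atomic formulas are those of Kunen's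
  1980 textbook.
\<close>

definition NameClosed :: "'v \<Rightarrow> 'v \<Rightarrow> 'v fm" where
  "NameClosed P D = BForall D (\<lambda>x. BForall x (\<lambda>z.
     BExists D (\<lambda>\<sigma>. BExists P (\<lambda>p. IsPair \<sigma> p z))))"

text \<open>\<open>\<tau>\<close> is a \<open>P\<close>-name: a set of pairs \<open>(\<sigma>, p)\<close> with \<open>p \<in> P\<close> and, hereditarily, \<open>\<sigma>\<close> a
  \<open>P\<close>-name.\<close>

definition IsName :: "'v \<Rightarrow> 'v \<Rightarrow> 'v fm" where
  "IsName P \<tau> = Exists (\<lambda>D. Conj (NameClosed P D) (Mem \<tau> D))"

definition BelowForall :: "'v \<Rightarrow> 'v \<Rightarrow> 'v \<Rightarrow> ('v \<Rightarrow> 'v fm) \<Rightarrow> 'v fm" where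
  "BelowForall P le p F = BForall P (\<lambda>q. Imp (PairIn q p le) (F q))"

definition BelowExists :: "'v \<Rightarrow> 'v \<Rightarrow> 'v \<Rightarrow> ('v \<Rightarrow> 'v fm) \<Rightarrow> 'v fm" where
  "BelowExists P le p F = BExists P (\<lambda>q. Conj (PairIn q p le) (F q))"

definition DenseBelow :: "'v \<Rightarrow> 'v \<Rightarrow> 'v \<Rightarrow> ('v \<Rightarrow> 'v fm) \<Rightarrow> 'v fm" where
  "DenseBelow P le p F = BelowForall P le p (\<lambda>q. BelowExists P le q F)"

text \<open>One of the two inclusions in the recursive clause for \<open>p \<tturnstile> \<tau> = \<sigma>\<close>, where \<open>R r \<pi> \<pi>'\<close>
  stands for \<open>r \<tturnstile> \<pi> = \<pi>'\<close>: for every \<open>(\<pi>, s) \<in> \<tau>\<close>, densely many \<open>r\<close> below \<open>p\<close> satisfy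
  \<open>r \<le> s \<longrightarrow> (\<exists>(\<pi>', s') \<in> \<sigma>. r \<le> s' \<and> r \<tturnstile> \<pi> = \<pi>')\<close>.\<close>

definition ForcesSubClause ::
  "'v \<Rightarrow> 'v \<Rightarrow> ('v \<Rightarrow> 'v \<Rightarrow> 'v \<Rightarrow> 'v fm) \<Rightarrow> 'v \<Rightarrow> 'v \<Rightarrow> 'v \<Rightarrow> 'v fm" where
  "ForcesSubClause P le R p \<tau> \<sigma> =
     Forall (\<lambda>\<pi>. Forall (\<lambda>s. Imp (PairIn \<pi> s \<tau>)
       (DenseBelow P le p (\<lambda>r. Imp (PairIn r s le)
          (Exists (\<lambda>\<pi>'. Exists (\<lambda>s'. Conj (PairIn \<pi>' s' \<sigma>)
             (Conj (PairIn r s' le) (R r \<pi> \<pi>')))))))))"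

definition ForcesEqClause :: "'v \<Rightarrow> 'v \<Rightarrow> 'v \<Rightarrow> 'v \<Rightarrow> 'v \<Rightarrow> 'v \<Rightarrow> 'v fm" where
  "ForcesEqClause P le E p \<tau> \<sigma> =
     Conj (ForcesSubClause P le (\<lambda>r \<pi> \<pi>'. TripleIn r \<pi> \<pi>' E) p \<tau> \<sigma>)
          (ForcesSubClause P le (\<lambda>r \<pi>' \<pi>. TripleIn r \<pi> \<pi>' E) p \<sigma> \<tau>)"

text \<open>The recursion is expressed by the existence of a set \<open>E\<close> of triples that satisfies the
  recursive clause on a set \<open>D\<close> of names closed under subnames.\<close>

definition ForcesEq :: "'v \<Rightarrow> 'v \<Rightarrow> 'v \<Rightarrow> 'v \<Rightarrow> 'v \<Rightarrow> 'v fm" where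
  "ForcesEq P le p \<tau> \<sigma> = Exists (\<lambda>D. Exists (\<lambda>E.
     Conj (NameClosed P D) (Conj (Mem \<tau> D) (Conj (Mem \<sigma> D)
    (Conj (BForall P (\<lambda>q. BForall D (\<lambda>x. BForall D (\<lambda>y.
             Iff (TripleIn q x y E) (ForcesEqClause P le E q x y)))))
          (TripleIn p \<tau> \<sigma> E))))))"

definition ForcesMem :: "'v \<Rightarrow> 'v \<Rightarrow> 'v \<Rightarrow> 'v \<Rightarrow> 'v \<Rightarrow> 'v fm" where
  "ForcesMem P le p \<tau> \<sigma> = DenseBelow P le p (\<lambda>q.
     Exists (\<lambda>\<pi>. Exists (\<lambda>s. Conj (PairIn \<pi> s \<sigma>)
       (Conj (PairIn q s le) (ForcesEq P le q \<pi> \<tau>)))))"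

text \<open>\<open>Forces P le \<phi> p\<close> is the formula \<open>p \<tturnstile> \<phi>\<close>.\<close>

primrec Forces :: "'v \<Rightarrow> 'v \<Rightarrow> 'v fm \<Rightarrow> 'v \<Rightarrow> 'v fm" where
  "Forces P le (Mem \<tau> \<sigma>) = (\<lambda>p. ForcesMem P le p \<tau> \<sigma>)"
| "Forces P le (Eq \<tau> \<sigma>) = (\<lambda>p. ForcesEq P le p \<tau> \<sigma>)"
| "Forces P le (Neg \<phi>) = (\<lambda>p. BelowForall P le p (\<lambda>q. Neg (Forces P le \<phi> q)))"
| "Forces P le (Conj \<phi> \<psi>) = (\<lambda>p. Conj (Forces P le \<phi> p) (Forces P le \<psi> p))"
| "Forces P le (Forall F) =
     (\<lambda>p. Forall (\<lambda>\<tau>. Imp (IsName P \<tau>) (Forces P le (F \<tau>) p)))"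

definition forced :: "'v::zfc \<Rightarrow> 'v \<Rightarrow> 'v fm \<Rightarrow> bool" where
  "forced P le \<phi> \<longleftrightarrow> (\<forall>p\<in>elts P. sat (Forces P le \<phi> p))"

text \<open>The canonical \<open>P\<close>-name \<open>{(check y, p) | y \<in> x, p \<in> P}\<close> of a set \<open>x\<close>; a greatest
  condition is not assumed to exist.\<close>

definition check :: "'v::zfc \<Rightarrow> 'v \<Rightarrow> 'v" where
  "check P = wfrec {(y, x). y \<in> elts x}
     (\<lambda>f x. vset {vpair (f y) p |y p. y \<in> elts x \<and> p \<in> elts P})"

text \<open>The formula \<open>c = check P x\<close>: some \<open>f\<close> is a function on a transitive set \<open>D\<close> containing \<open>x\<close>
  that satisfies the recursive clause on \<open>D\<close> and maps \<open>x\<close> to \<open>c\<close>.\<close>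

definition IsCheck :: "'v \<Rightarrow> 'v \<Rightarrow> 'v \<Rightarrow> 'v fm" where
  "IsCheck P x c = Exists (\<lambda>D. Exists (\<lambda>f.
     Conj (Trans D) (Conj (Mem x D)
    (Conj (BForall D (\<lambda>y. Exists (\<lambda>u. Forall (\<lambda>v. Iff (PairIn y v f) (Eq v u)))))
    (Conj (BForall D (\<lambda>y. Forall (\<lambda>u. Imp (PairIn y u f)
             (Forall (\<lambda>e. Iff (Mem e u)
                (BExists y (\<lambda>z. BExists P (\<lambda>p. Exists (\<lambda>v.
                   Conj (PairIn z v f) (IsPair v p e))))))))))
          (PairIn x c f))))))"

text \<open>Every \<open>q \<in> P\<close> that forces a name \<open>\<tau>\<close> to be a countable set of ordinals also forces \<open>\<tau>\<close> to
  belong to the ground model, that is, densely many conditions below \<open>q\<close> force \<open>\<tau>\<close> to be equal to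
  the canonical name of some set.\<close>

definition Omega1Distributive :: "'v \<Rightarrow> 'v \<Rightarrow> 'v fm" where
  "Omega1Distributive P le = BForall P (\<lambda>q. Forall (\<lambda>\<tau>.
     Imp (Conj (IsName P \<tau>) (Forces P le (CountableSetOfOrdinals \<tau>) q))
         (DenseBelow P le q (\<lambda>r. Exists (\<lambda>x. Exists (\<lambda>c.
            Conj (IsCheck P x c) (Forces P le (Eq \<tau> c) r)))))))"

end

theory Submission
  imports Defs
begin

text \<open>
  A \<open>P\<close>-name for a \<open>Q\<close>-name is the same thing as a \<open>P \<times> Q\<close>-name, and \<open>p\<close> forces that \<open>q\<close> forces \<open>\<phi>\<close>
  iff \<open>(p, q)\<close> forces \<open>\<phi>\<close> for the product. It is therefore enough to find, for a \<open>P \<times> Q\<close>-name \<open>t\<close> of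
  a countable set of ordinals, densely many \<open>(p, q)\<close> such that \<open>p\<close> forces that \<open>q\<close> decides every
  element of \<open>t\<close>. Take a countable \<open>N\<close> for which \<open>P\<close> is strongly proper and which is closed under a
  function that extends a given \<open>(p, q)\<close> to a pair deciding the \<open>k\<close>-th element of \<open>t\<close>. Since \<open>N \<inter> P\<close>
  is countable, one descending sequence \<open>q\<^sub>0 \<ge> q\<^sub>1 \<ge> \<dots>\<close> in \<open>N \<inter> Q\<close> can be arranged such that for
  every \<open>k\<close> the set of those \<open>p \<in> N \<inter> P\<close> for which some \<open>(p, q\<^sub>j)\<close> decides the \<open>k\<close>-th element is
  dense in \<open>N \<inter> P\<close>. These sets are predense below a strongly \<open>N\<close>-generic condition, which thus
  forces that a lower bound of the \<open>q\<^sub>j\<close> decides all of \<open>t\<close>.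
\<close>


notation vpair ("\<langle>_,/ _\<rangle>")

section \<open>Sets of the universe\<close>

definition small :: "'v::zfc set \<Rightarrow> bool" where
  "small A \<longleftrightarrow> (\<exists>x. elts x = A)"

lemma elts_vset [simp]: "small A \<Longrightarrow> elts (vset A) = A"
  unfolding small_def vset_def by (metis (mono_tags, lifting) extensionality theI')

lemma elts_inject: "elts x = elts y \<longleftrightarrow> x = y"
  using extensionality by blast

lemma vset_elts [simp]: "vset (elts x) = x"
  by (simp add: vset_def elts_inject)

lemma vset_eq_iff: "small A \<Longrightarrow> small B \<Longrightarrow> vset A = vset B \<longleftrightarrow> A = B"
  by (metis elts_vset)

lemma small_elts [simp, intro]: "small (elts x)"
  by (auto simp: small_def)

lemma small_subset:
  assumes "small B" "A \<subseteq> B"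
  shows "small A"
proof -
  obtain x where x: "elts x = B" using assms(1) by (auto simp: small_def)
  obtain u where "elts u = {y \<in> elts x. y \<in> A}" using separation[of x "\<lambda>y. y \<in> A"] by blast
  with x assms(2) have "elts u = A" by auto
  then show ?thesis by (auto simp: small_def)
qed

lemma small_image [intro]: "small A \<Longrightarrow> small (f ` A)" for f :: "'v::zfc \<Rightarrow> 'v"
  unfolding small_def using replacement by blast

lemma small_doubleton [simp]: "small {x, y}"
  unfolding small_def by (rule pairing)

lemma small_singleton [simp]: "small {x}"
  using small_doubleton[of x x] by simp

lemma small_empty [simp]: "small {}"
  using small_subset[OF small_singleton] by blast

lemma small_UN:
  fixes A :: "'v::zfc set" and B :: "'v \<Rightarrow> 'v set"
  assumes "small A" "\<And>x. x \<in> A \<Longrightarrow> small (B x)"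
  shows "small (\<Union>x\<in>A. B x)"
proof -
  obtain u where u: "elts u = (\<lambda>x. vset (B x)) ` A"
    using small_image[OF assms(1)] unfolding small_def by blast
  obtain v where "elts v = \<Union> (elts ` elts u)" using union by blast
  then have "elts v = (\<Union>x\<in>A. B x)" using assms(2) by (auto simp: u)
  then show ?thesis by (auto simp: small_def)
qed

lemma small_Un [intro]:
  assumes "small A" "small B"
  shows "small (A \<union> B)"
proof -
  have "small (\<Union>x\<in>{vset A, vset B}. elts x)" by (intro small_UN) auto
  then show ?thesis using assms by simp
qed

lemma small_insert [simp]: "small A \<Longrightarrow> small (insert x A)"
  using small_Un[of "{x}" A] by simp

lemma small_image2:
  fixes f :: "'v::zfc \<Rightarrow> 'v \<Rightarrow> 'v"
  assumes "small A" "small B"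
  shows "small {f x y |x y. x \<in> A \<and> y \<in> B}"
proof -
  have "small (\<Union>x\<in>A. f x ` B)" using assms by (intro small_UN small_image)
  moreover have "(\<Union>x\<in>A. f x ` B) = {f x y |x y. x \<in> A \<and> y \<in> B}" by auto
  ultimately show ?thesis by simp
qed

lemma small_image3:
  fixes f :: "'v::zfc \<Rightarrow> 'v \<Rightarrow> 'v \<Rightarrow> 'v"
  assumes "small A" "small B" "small C"
  shows "small {f x y z |x y z. x \<in> A \<and> y \<in> B \<and> z \<in> C}"
proof -
  have "small (\<Union>x\<in>A. {f x y z |y z. y \<in> B \<and> z \<in> C})"
    using assms by (intro small_UN small_image2)
  moreover have "(\<Union>x\<in>A. {f x y z |y z. y \<in> B \<and> z \<in> C}) = {f x y z |x y z. x \<in> A \<and> y \<in> B \<and> z \<in> C}"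
    by auto
  ultimately show ?thesis by simp
qed

lemma small_subsets: "small A \<Longrightarrow> small {x. elts x \<subseteq> A}"
  unfolding small_def using powerset by blast

lemma vpair_inject [simp]: "\<langle>x, y\<rangle> = \<langle>x', y'\<rangle> \<longleftrightarrow> x = x' \<and> y = y'"
  unfolding vpair_def by (simp add: vset_eq_iff doubleton_eq_iff singleton_insert_inj_eq) metis

lemma small_vpair_image: "small A \<Longrightarrow> small B \<Longrightarrow> small {\<langle>x, y\<rangle> |x y. x \<in> A \<and> y \<in> B}"
  by (rule small_image2)


subsection \<open>Induction and recursion on membership\<close>

lemma elts_induct [case_names step]:
  "(\<And>x. (\<And>y. y \<in> elts x \<Longrightarrow> \<Phi> y) \<Longrightarrow> \<Phi> x) \<Longrightarrow> \<Phi> (x::'v::zfc)"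
  using wf_induct_rule[OF foundation, of \<Phi> x] by blast

lemma mem_irrefl: "x \<notin> elts (x::'v::zfc)"
  using wf_not_refl[OF foundation] by blast

lemma ex_elts_minimal:
  fixes x :: "'v::zfc"
  assumes "\<Phi> x"
  shows "\<exists>m. \<Phi> m \<and> (\<forall>y\<in>elts m. \<not> \<Phi> y)"
  using foundation[unfolded wf_eq_minimal, rule_format, of x "Collect \<Phi>"] assms by auto

lemma trcl_induct [case_names step]:
  "(\<And>x. (\<And>y. y \<in> trcl x \<Longrightarrow> \<Phi> y) \<Longrightarrow> \<Phi> x) \<Longrightarrow> \<Phi> (x::'v::zfc)"
  using wf_induct_rule[OF wf_trancl[OF foundation], of \<Phi> x] by (auto simp: trcl_def)

lemma trcl_elts: "y \<in> elts x \<Longrightarrow> y \<in> trcl x"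
  by (auto simp: trcl_def)

lemma trcl_trans: "z \<in> trcl y \<Longrightarrow> y \<in> trcl x \<Longrightarrow> z \<in> trcl x"
  by (auto simp: trcl_def)

lemma trcl_unfold: "trcl x = elts x \<union> (\<Union>y\<in>elts x. trcl y)"
proof -
  have "z \<in> elts x \<or> (\<exists>y\<in>elts x. z \<in> trcl y)" if "z \<in> trcl x" for z
    using that unfolding trcl_def by (auto dest: tranclD2 elim: tranclE)
  then show ?thesis by (auto intro: trcl_elts trcl_trans)
qed

lemma small_trcl: "small (trcl x)"
  by (induction x rule: elts_induct) (subst trcl_unfold, auto intro: small_UN)

lemma vpair_components_trcl: "a \<in> trcl \<langle>a, b\<rangle>" "b \<in> trcl \<langle>a, b\<rangle>"
proof -
  have "vset {a, b} \<in> elts \<langle>a, b\<rangle>" "a \<in> elts (vset {a, b})" "b \<in> elts (vset {a, b})"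
    by (auto simp: vpair_def)
  then show "a \<in> trcl \<langle>a, b\<rangle>" "b \<in> trcl \<langle>a, b\<rangle>" by (meson trcl_elts trcl_trans)+
qed

lemma vpair_mem_trcl:
  assumes "\<langle>a, b\<rangle> \<in> elts x"
  shows "a \<in> trcl x" "b \<in> trcl x"
  using trcl_trans[OF vpair_components_trcl(1) trcl_elts[OF assms]]
    trcl_trans[OF vpair_components_trcl(2) trcl_elts[OF assms]] .

definition pair_rec :: "('v::zfc \<Rightarrow> 'v \<Rightarrow> 'v set) \<Rightarrow> 'v \<Rightarrow> 'v" where
  "pair_rec h = wfrec ({(y, x). y \<in> elts x}\<^sup>+) (\<lambda>f a. vset (\<Union> {h (f b) c |b c. \<langle>b, c\<rangle> \<in> elts a}))"

lemma elts_pair_rec: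
  assumes "\<And>x c. small (h x c)"
  shows "elts (pair_rec h a) = \<Union> {h (pair_rec h b) c |b c. \<langle>b, c\<rangle> \<in> elts a}"
proof -
  let ?R = "{(y, x). y \<in> elts x}\<^sup>+ :: ('a \<times> 'a) set"
  have "pair_rec h a = vset (\<Union> {h (cut (pair_rec h) ?R a b) c |b c. \<langle>b, c\<rangle> \<in> elts a})"
    unfolding pair_rec_def by (subst wfrec[OF wf_trancl[OF foundation]]) simp
  also have "{h (cut (pair_rec h) ?R a b) c |b c. \<langle>b, c\<rangle> \<in> elts a} =
      {h (pair_rec h b) c |b c. \<langle>b, c\<rangle> \<in> elts a}"
  proof -
    have "cut (pair_rec h) ?R a b = pair_rec h b" if "\<langle>b, c\<rangle> \<in> elts a" for b c
      using vpair_mem_trcl(1)[OF that] by (simp add: cut_def trcl_def)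
    then show ?thesis by (intro Collect_cong ex_cong1) auto
  qed
  finally have "pair_rec h a = vset (\<Union> {h (pair_rec h b) c |b c. \<langle>b, c\<rangle> \<in> elts a})" .
  moreover have "small (\<Union>b\<in>trcl a. \<Union>c\<in>trcl a. h (pair_rec h b) c)"
    using assms by (intro small_UN small_trcl)
  then have "small (\<Union> {h (pair_rec h b) c |b c. \<langle>b, c\<rangle> \<in> elts a})"
    by (rule small_subset) (auto dest: vpair_mem_trcl)
  ultimately show ?thesis by simp
qed

lemma elts_check: "elts (check P x) = {\<langle>check P y, p\<rangle> |y p. y \<in> elts x \<and> p \<in> elts P}"
proof -
  let ?R = "{(y, x). y \<in> elts x} :: ('a \<times> 'a) set"
  have "check P x = vset {\<langle>cut (check P) ?R x y, p\<rangle> |y p. y \<in> elts x \<and> p \<in> elts P}"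
    unfolding check_def by (subst wfrec[OF foundation]) simp
  also have "{\<langle>cut (check P) ?R x y, p\<rangle> |y p. y \<in> elts x \<and> p \<in> elts P} =
      {\<langle>check P y, p\<rangle> |y p. y \<in> elts x \<and> p \<in> elts P}"
    by (auto simp: cut_def; metis)
  finally show ?thesis
    using small_image2[of "elts x" "elts P" "\<lambda>y p. \<langle>check P y, p\<rangle>"] by simp
qed


section \<open>Ordinals and cardinals\<close>

lemma ordinal_elt: "ordinal \<alpha> \<Longrightarrow> \<beta> \<in> elts \<alpha> \<Longrightarrow> ordinal \<beta>"
  unfolding ordinal_def transitive_def by blast

lemma ordinal_trans: "ordinal \<alpha> \<Longrightarrow> \<beta> \<in> elts \<alpha> \<Longrightarrow> \<gamma> \<in> elts \<beta> \<Longrightarrow> \<gamma> \<in> elts \<alpha>"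
  by (auto simp: ordinal_def transitive_def)

lemma ordinal_linear: "ordinal \<alpha> \<Longrightarrow> ordinal \<beta> \<Longrightarrow> \<alpha> \<in> elts \<beta> \<or> \<alpha> = \<beta> \<or> \<beta> \<in> elts \<alpha>"
proof (induction \<alpha> arbitrary: \<beta> rule: elts_induct)
  case (step \<alpha>)
  note below_\<alpha> = step.IH and \<alpha> = step.prems(1)
  show ?case using step.prems(2)
  proof (induction \<beta> rule: elts_induct)
    case (step \<beta>)
    show ?case
    proof (rule ccontr)
      assume incomparable: "\<not> ?case"
      have "\<gamma> \<in> elts \<beta>" if "\<gamma> \<in> elts \<alpha>" for \<gamma>
        using that below_\<alpha>[of \<gamma> \<beta>] \<alpha> step.prems incomparable by (metis ordinal_elt ordinal_trans)
      moreover have "\<gamma> \<in> elts \<alpha>" if "\<gamma> \<in> elts \<beta>" for \<gamma>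
        using that step.IH[of \<gamma>] \<alpha> step.prems incomparable by (metis ordinal_elt ordinal_trans)
      ultimately have "elts \<alpha> = elts \<beta>" by blast
      with incomparable show False by (simp add: elts_inject)
    qed
  qed
qed

lemma ex_ordinal_notin:
  fixes B :: "'v::zfc set"
  assumes "small B"
  shows "\<exists>\<gamma>. ordinal \<gamma> \<and> \<gamma> \<notin> B"
proof (rule ccontr)
  assume no_other: "\<not> ?thesis"
  define U :: "'v set" where "U = {\<alpha>. ordinal \<alpha>}"
  have "small U" by (rule small_subset[OF assms]) (use no_other in \<open>auto simp: U_def\<close>)
  then have U: "elts (vset U) = U" by simp
  have "transitive (vset U)" unfolding transitive_def U by (auto simp: U_def intro: ordinal_elt)
  moreover have "\<forall>\<alpha>\<in>elts (vset U). transitive \<alpha>" unfolding U by (auto simp: U_def ordinal_def)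
  ultimately have "ordinal (vset U)" by (simp add: ordinal_def)
  then have "vset U \<in> elts (vset U)" unfolding U by (simp add: U_def)
  then show False using mem_irrefl by blast
qed

lemma ex_ordinal_eqpoll:
  fixes A :: "'v::zfc set"
  assumes "small A"
  shows "\<exists>\<alpha>::'v. ordinal \<alpha> \<and> elts \<alpha> \<approx> A"
proof -
  obtain r where r: "well_order_on A r" using well_order_on by blast
  define s where "s = r - Id"
  have wf_s: "wf s" using r by (simp add: well_order_on_def s_def)
  have trans_s: "trans s"
    using r by (auto simp: s_def well_order_on_def linear_order_on_def partial_order_on_def
        preorder_on_def intro: trans_diff_Id)
  have total_s: "(x, y) \<in> s \<or> (y, x) \<in> s" if "x \<in> A" "y \<in> A" "x \<noteq> y" for x y
    using r that by (auto simp: s_def well_order_on_def linear_order_on_def total_on_def)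
  have s_in_A: "x \<in> A" "y \<in> A" if "(x, y) \<in> s" for x y
    using r that by (auto simp: s_def well_order_on_def linear_order_on_def partial_order_on_def
        preorder_on_def refl_on_def)
  define f :: "'v \<Rightarrow> 'v" where "f = wfrec s (\<lambda>f x. vset (f ` {y. (y, x) \<in> s}))"
  have elts_f: "elts (f x) = f ` {y. (y, x) \<in> s}" for x
  proof -
    have "f x = vset (cut f s x ` {y. (y, x) \<in> s})" unfolding f_def by (subst wfrec[OF wf_s]) simp
    also have "cut f s x ` {y. (y, x) \<in> s} = f ` {y. (y, x) \<in> s}" by (auto simp: cut_def)
    finally have "f x = vset (f ` {y. (y, x) \<in> s})" .
    moreover have "small (f ` {y. (y, x) \<in> s})"
      by (intro small_image small_subset[OF assms]) (auto dest: s_in_A)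
    ultimately show ?thesis by simp
  qed
  have small_f: "small (f ` A)" using assms by auto
  have "transitive (f x)" for x
    unfolding transitive_def using transD[OF trans_s] by (auto simp: elts_f)
  then have "ordinal (vset (f ` A))"
    using s_in_A by (auto simp: ordinal_def small_f transitive_def elts_f)
  moreover have "inj_on f A"
  proof
    fix x y assume "x \<in> A" "y \<in> A" "f x = f y"
    then show "x = y"
      using total_s[of x y] elts_f[of x] elts_f[of y] mem_irrefl[of "f x"]
      by (metis (mono_tags, lifting) image_eqI mem_Collect_eq)
  qed
  then have "f ` A \<approx> A" by (simp add: inj_on_image_eqpoll_self)
  ultimately show ?thesis using small_f by (intro exI[of _ "vset (f ` A)"]) simp
qed

lemma ex_cardinal_eqpoll:
  fixes A :: "'v::zfc set"
  assumes "small A"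
  shows "\<exists>\<kappa>::'v. cardinal \<kappa> \<and> elts \<kappa> \<approx> A"
proof -
  obtain \<alpha> :: 'v where "ordinal \<alpha> \<and> elts \<alpha> \<approx> A" using ex_ordinal_eqpoll[OF assms] by blast
  from ex_elts_minimal[of "\<lambda>\<alpha>. ordinal \<alpha> \<and> elts \<alpha> \<approx> A", OF this]
  obtain \<kappa> :: 'v where \<kappa>: "ordinal \<kappa> \<and> elts \<kappa> \<approx> A"
    and minimal: "\<forall>\<beta>\<in>elts \<kappa>. \<not> (ordinal \<beta> \<and> elts \<beta> \<approx> A)"
    by blast
  have "elts \<beta> \<prec> elts \<kappa>" if "\<beta> \<in> elts \<kappa>" for \<beta>
  proof -
    have "elts \<beta> \<lesssim> elts \<kappa>"
      using \<kappa> that by (auto simp: ordinal_def transitive_def intro: subset_imp_lepoll)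
    moreover have "\<not> elts \<beta> \<approx> elts \<kappa>"
      using bspec[OF minimal that] \<kappa> that by (meson eqpoll_trans ordinal_elt)
    ultimately show ?thesis by (simp add: lesspoll_def)
  qed
  with \<kappa> show ?thesis by (auto simp: cardinal_def)
qed

lemma subsets_eqpoll_Pow:
  assumes "small A"
  shows "{x. elts x \<subseteq> A} \<approx> Pow A"
proof -
  have "B \<in> elts ` {x. elts x \<subseteq> A}" if "B \<subseteq> A" for B
    by (rule image_eqI[of _ _ "vset B"]) (use small_subset[OF assms that] that in auto)
  then have "elts ` {x. elts x \<subseteq> A} = Pow A" by blast
  moreover have "inj_on elts {x. elts x \<subseteq> A}" by (auto simp: inj_on_def elts_inject)
  ultimately show ?thesis by (metis eqpoll_sym inj_on_image_eqpoll_self)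
qed

lemma ex_cardinal_gt:
  fixes A :: "'v::zfc set"
  assumes "small A"
  shows "\<exists>\<kappa>::'v. cardinal \<kappa> \<and> A \<prec> elts \<kappa>"
proof -
  obtain \<kappa> :: 'v where "cardinal \<kappa>" "elts \<kappa> \<approx> {x. elts x \<subseteq> A}"
    using ex_cardinal_eqpoll[OF small_subsets[OF assms]] by blast
  moreover from this have "Pow A \<approx> elts \<kappa>"
    using subsets_eqpoll_Pow[OF assms] by (meson eqpoll_sym eqpoll_trans)
  then have "A \<prec> elts \<kappa>" using lesspoll_Pow_self lesspoll_trans2 by (metis eqpoll_imp_lepoll)
  ultimately show ?thesis by blast
qed


subsection \<open>Natural numbers\<close>

primrec num :: "nat \<Rightarrow> 'v::zfc" where
  "num 0 = vset {}"
| "num (Suc n) = vset (insert (num n) (elts (num n)))"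

lemma small_range_num: "small (range (num :: nat \<Rightarrow> 'v::zfc))"
proof -
  obtain w :: 'v where w: "\<exists>z\<in>elts w. elts z = {}"
    "\<forall>x\<in>elts w. \<exists>y\<in>elts w. elts y = insert x (elts x)"
    using infinity by blast
  have "num n \<in> elts w" for n
    by (induction n) (use w in \<open>metis num.simps vset_elts\<close>)+
  then show ?thesis by (intro small_subset[OF small_elts[of w]]) auto
qed

definition omega :: "'v::zfc" where
  "omega = vset (range num)"

lemma elts_omega: "elts omega = range num"
  by (simp add: omega_def small_range_num)

lemma elts_num_subset: "elts (num n) \<subseteq> range num"
  by (induction n) auto

lemma transitive_num: "transitive (num n)"
  by (induction n) (auto simp: transitive_def)

lemma ordinal_omega: "ordinal omega"
  using elts_num_subset transitive_num by (fastforce simp: ordinal_def transitive_def elts_omega)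

lemma ordinal_subset_omega:
  assumes "ordinal \<alpha>" "omega \<notin> elts \<alpha>"
  shows "elts \<alpha> \<subseteq> range num"
  using ordinal_linear[OF assms(1) ordinal_omega] assms elts_num_subset by (auto simp: elts_omega)

lemma num_mem: "m < n \<Longrightarrow> num m \<in> elts (num n)"
  by (induction n) (auto simp: less_Suc_eq)

lemma inj_num: "inj (num :: nat \<Rightarrow> 'v::zfc)"
proof
  fix m n :: nat assume "num m = (num n :: 'v)"
  then show "m = n"
    using num_mem[of m n] num_mem[of n m] mem_irrefl by (metis linorder_neqE_nat)
qed


subsection \<open>Large cardinals\<close>

lemma omega1_subset:
  fixes \<chi> :: "'v::zfc"
  assumes "ordinal \<chi>" "(range num :: 'v set) \<prec> elts \<chi>"
  shows "omega1 \<subseteq> elts \<chi>"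
proof
  fix \<alpha> :: 'v assume "\<alpha> \<in> omega1"
  then have \<alpha>: "ordinal \<alpha>" "countable (elts \<alpha>)" by (auto simp: omega1_def)
  have "\<not> countable (elts \<chi>)"
  proof
    assume "countable (elts \<chi>)"
    then have "elts \<chi> \<lesssim> (UNIV :: nat set)" by (auto simp: countable_def lepoll_def)
    also have "(UNIV :: nat set) \<lesssim> range (num :: nat \<Rightarrow> 'v)"
      using inj_num by (auto simp: lepoll_def)
    finally show False using assms(2) lepoll_antisym unfolding lesspoll_def by blast
  qed
  moreover have "elts \<chi> \<subseteq> elts \<alpha>" if "\<chi> \<in> elts \<alpha>"
    using that \<alpha> by (auto simp: ordinal_def transitive_def)
  ultimately show "\<alpha> \<in> elts \<chi>"
    using ordinal_linear[OF \<alpha>(1) assms(1)] \<alpha>(2) countable_subset by blast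
qed

lemma H_trcl: "x \<in> H \<chi> \<Longrightarrow> y \<in> trcl x \<Longrightarrow> y \<in> H \<chi>"
  using lesspoll_trans1[OF subset_imp_lepoll[of "trcl y" "trcl x"]] trcl_trans
  unfolding H_def by blast

lemma ex_large_cardinal:
  fixes \<mu> x :: "'v::zfc"
  assumes "cardinal \<mu>"
  shows "\<exists>\<chi>. cardinal \<chi> \<and> elts \<mu> \<subseteq> elts \<chi> \<and> omega1 \<subseteq> elts \<chi> \<and> x \<in> H \<chi>"
proof -
  define B where "B = elts \<mu> \<union> range num \<union> trcl x"
  have "small B" unfolding B_def by (intro small_Un small_elts small_range_num small_trcl)
  then obtain \<chi> :: 'v where \<chi>: "cardinal \<chi>" "B \<prec> elts \<chi>" using ex_cardinal_gt by blast
  have smaller: "A \<prec> elts \<chi>" if "A \<subseteq> B" for A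
    using lesspoll_trans1[OF subset_imp_lepoll[OF that] \<chi>(2)] .
  have ord: "ordinal \<chi>" "ordinal \<mu>" using \<chi> assms by (auto simp: cardinal_def)
  have "\<not> elts \<chi> \<subseteq> elts \<mu>" using smaller[of "elts \<chi>"] by (auto simp: B_def)
  then have "elts \<mu> \<subseteq> elts \<chi>"
    using ordinal_linear[OF ord] ord by (auto simp: ordinal_def transitive_def)
  moreover have "omega1 \<subseteq> elts \<chi>" by (rule omega1_subset[OF ord(1) smaller]) (auto simp: B_def)
  moreover have "x \<in> H \<chi>" unfolding H_def by (auto intro!: smaller simp: B_def)
  ultimately show ?thesis using \<chi> by blast
qed


section \<open>Clubs of closed sets\<close>

lemma ex_lists_mono_UN:
  fixes N :: "nat \<Rightarrow> 'a set"
  assumes "mono N" "xs \<in> lists (\<Union>n. N n)"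
  shows "\<exists>n. xs \<in> lists (N n)"
  using assms(2)
proof (induction xs)
  case (Cons x xs)
  then obtain m n where "x \<in> N m" "xs \<in> lists (N n)" by auto
  moreover have "N m \<subseteq> N (max m n)" "N n \<subseteq> N (max m n)"
    by (rule monoD[OF assms(1)], simp)+
  ultimately have "x \<in> N (max m n)" "xs \<in> lists (N (max m n))" by auto
  then have "x # xs \<in> lists (N (max m n))" by simp
  then show ?case by blast
qed simp

lemma ex_countable_closed_superset:
  fixes F :: "'a list \<Rightarrow> 'a set"
  assumes F: "\<And>xs. F xs \<subseteq> X" "\<And>xs. countable (F xs)" and M: "M \<in> countable_subsets X"
  shows "\<exists>N\<in>countable_subsets X. M \<subseteq> N \<and> (\<forall>xs\<in>lists N. F xs \<subseteq> N)"
proof -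
  define N where "N = rec_nat M (\<lambda>_ N. N \<union> \<Union> (F ` lists N))"
  have N_0: "N 0 = M" and N_Suc: "N (Suc n) = N n \<union> \<Union> (F ` lists (N n))" for n
    by (simp_all add: N_def)
  have "N n \<subseteq> X \<and> countable (N n)" for n
  proof (induction n)
    case 0
    then show ?case using M by (simp add: N_0 countable_subsets_def)
  next
    case (Suc n)
    then have "countable (\<Union>xs\<in>lists (N n). F xs)"
      using F(2) by (intro countable_UN countable_lists) auto
    moreover have "(\<Union>xs\<in>lists (N n). F xs) \<subseteq> X" using F(1) by (rule UN_least)
    ultimately show ?case using Suc by (simp add: N_Suc)
  qed
  then have "(\<Union>n. N n) \<in> countable_subsets X" by (simp add: countable_subsets_def UN_least)
  moreover have "\<forall>xs\<in>lists (\<Union>n. N n). F xs \<subseteq> (\<Union>n. N n)"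
  proof
    fix xs assume "xs \<in> lists (\<Union>n. N n)"
    moreover have "mono N" unfolding mono_iff_le_Suc by (simp add: N_Suc)
    ultimately obtain n where "xs \<in> lists (N n)" using ex_lists_mono_UN by blast
    then have "F xs \<subseteq> N (Suc n)" unfolding N_Suc by blast
    then show "F xs \<subseteq> (\<Union>n. N n)" by blast
  qed
  moreover have "M \<subseteq> (\<Union>n. N n)" using N_0 by blast
  ultimately show ?thesis by (intro bexI[of _ "\<Union>n. N n"] conjI)
qed

lemma club_closed_under:
  fixes F :: "'a list \<Rightarrow> 'a set"
  assumes F: "\<And>xs. F xs \<subseteq> X" "\<And>xs. countable (F xs)"
  shows "club X {N \<in> countable_subsets X. \<forall>xs\<in>lists N. F xs \<subseteq> N}"
  unfolding club_def
proof (intro conjI ballI allI impI)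
  fix M assume "M \<in> countable_subsets X"
  from ex_countable_closed_superset[of F, OF F this]
  show "\<exists>N\<in>{N \<in> countable_subsets X. \<forall>xs\<in>lists N. F xs \<subseteq> N}. M \<subseteq> N" by blast
next
  fix N :: "nat \<Rightarrow> 'a set"
  assume "range N \<subseteq> {N \<in> countable_subsets X. \<forall>xs\<in>lists N. F xs \<subseteq> N} \<and> mono N"
  then have "mono N" and N: "N n \<in> countable_subsets X" "\<forall>xs\<in>lists (N n). F xs \<subseteq> N n" for n
    by (simp_all add: image_subset_iff)
  have "\<forall>xs\<in>lists (\<Union>n. N n). F xs \<subseteq> (\<Union>n. N n)"
  proof
    fix xs assume "xs \<in> lists (\<Union>n. N n)"
    from ex_lists_mono_UN[OF \<open>mono N\<close> this] obtain n where "xs \<in> lists (N n)" by (rule exE)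
    then show "F xs \<subseteq> (\<Union>n. N n)" using N(2)[of n] by blast
  qed
  moreover have "(\<Union>n. N n) \<in> countable_subsets X"
    using N(1) by (simp add: countable_subsets_def UN_least)
  ultimately show "(\<Union>n. N n) \<in> {N \<in> countable_subsets X. \<forall>xs\<in>lists N. F xs \<subseteq> N}"
    by (intro CollectI conjI)
qed blast

lemma strongly_proper_for_closed_set:
  fixes P le :: "'v::zfc" and F :: "'v list \<Rightarrow> 'v set"
  assumes sp: "strongly_proper_on_stationary P le" and A: "small A"
    and F: "\<And>xs. F xs \<subseteq> A" "\<And>xs. countable (F xs)"
  obtains N where "countable N" "strongly_proper_for P le N" "\<forall>xs\<in>lists N. F xs \<subseteq> N"
proof -
  define S where "S = (\<lambda>\<chi>. {N \<in> countable_subsets (H \<chi>).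
    (\<exists>\<alpha>\<in>omega1. N \<inter> omega1 = elts \<alpha>) \<and> strongly_proper_for P le N})"
  obtain \<mu> :: 'v where \<mu>: "cardinal \<mu>"
    and stat: "\<And>\<chi>. cardinal \<chi> \<and> elts \<mu> \<subseteq> elts \<chi> \<and> omega1 \<subseteq> elts \<chi> \<and> \<langle>P, le\<rangle> \<in> H \<chi> \<Longrightarrow>
      stationary (H \<chi>) (S \<chi>)"
    using sp unfolding strongly_proper_on_stationary_def S_def by blast
  obtain \<chi> :: 'v where \<chi>: "cardinal \<chi>" "elts \<mu> \<subseteq> elts \<chi>" "omega1 \<subseteq> elts \<chi>" "\<langle>\<langle>P, le\<rangle>, vset A\<rangle> \<in> H \<chi>"
    using ex_large_cardinal[OF \<mu>, of "\<langle>\<langle>P, le\<rangle>, vset A\<rangle>"] by blast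
  note components =
    H_trcl[OF \<chi>(4) vpair_components_trcl(1)] H_trcl[OF \<chi>(4) vpair_components_trcl(2)]
  have "stationary (H \<chi>) (S \<chi>)" using stat \<chi>(1-3) components(1) by blast
  moreover have "y \<in> H \<chi>" if "y \<in> A" for y
    using H_trcl[OF components(2) trcl_elts] that A by simp
  then have "club (H \<chi>) {N \<in> countable_subsets (H \<chi>). \<forall>xs\<in>lists N. F xs \<subseteq> N}"
    using F by (intro club_closed_under subsetI) blast+
  ultimately have "S \<chi> \<inter> {N \<in> countable_subsets (H \<chi>). \<forall>xs\<in>lists N. F xs \<subseteq> N} \<noteq> {}"
    by (simp add: stationary_def)
  then obtain N where "N \<in> S \<chi>" "\<forall>xs\<in>lists N. F xs \<subseteq> N" by blast
  then show thesis
    using that[of N] unfolding S_def countable_subsets_def by blast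
qed


section \<open>Truth in the universe\<close>

lemma sat_Disj [simp]: "sat (Disj \<phi> \<psi>) \<longleftrightarrow> sat \<phi> \<or> sat \<psi>"
  by (simp add: Disj_def)

lemma sat_Imp [simp]: "sat (Imp \<phi> \<psi>) \<longleftrightarrow> (sat \<phi> \<longrightarrow> sat \<psi>)"
  by (simp add: Imp_def)

lemma sat_Iff [simp]: "sat (Iff \<phi> \<psi>) \<longleftrightarrow> (sat \<phi> \<longleftrightarrow> sat \<psi>)"
  by (auto simp: Iff_def)

lemma sat_Exists [simp]: "sat (Exists F) \<longleftrightarrow> (\<exists>x. sat (F x))"
  by (simp add: Exists_def)

lemma sat_BForall [simp]: "sat (BForall a F) \<longleftrightarrow> (\<forall>x\<in>elts a. sat (F x))"
  by (auto simp: BForall_def)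

lemma sat_BExists [simp]: "sat (BExists a F) \<longleftrightarrow> (\<exists>x\<in>elts a. sat (F x))"
  by (auto simp: BExists_def)

lemma sat_IsUpair [simp]: "sat (IsUpair x y z) \<longleftrightarrow> z = vset {x, y}"
proof -
  have "sat (IsUpair x y z) \<longleftrightarrow> elts z = elts (vset {x, y})" by (auto simp: IsUpair_def)
  then show ?thesis by (simp only: elts_inject)
qed

lemma sat_IsPair [simp]: "sat (IsPair x y z) \<longleftrightarrow> z = \<langle>x, y\<rangle>"
  by (simp add: IsPair_def vpair_def)

lemma sat_PairIn [simp]: "sat (PairIn x y r) \<longleftrightarrow> \<langle>x, y\<rangle> \<in> elts r"
  by (simp add: PairIn_def)

lemma sat_TripleIn [simp]: "sat (TripleIn x y z r) \<longleftrightarrow> \<langle>x, \<langle>y, z\<rangle>\<rangle> \<in> elts r"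
  by (simp add: TripleIn_def)

lemma sat_BelowForall [simp]:
  "sat (BelowForall P le p F) \<longleftrightarrow> (\<forall>q\<in>elts P. leq le q p \<longrightarrow> sat (F q))"
  by (simp add: BelowForall_def leq_def)

lemma sat_BelowExists [simp]:
  "sat (BelowExists P le p F) \<longleftrightarrow> (\<exists>q\<in>elts P. leq le q p \<and> sat (F q))"
  by (simp add: BelowExists_def leq_def)


section \<open>The forcing relation\<close>

definition EqRecursion :: "'v \<Rightarrow> 'v \<Rightarrow> 'v \<Rightarrow> 'v \<Rightarrow> 'v fm" where
  "EqRecursion P le D E = BForall P (\<lambda>q. BForall D (\<lambda>x. BForall D (\<lambda>y.
     Iff (TripleIn q x y E) (ForcesEqClause P le E q x y))))"

lemma ForcesEq_unfold: "ForcesEq P le p \<tau> \<sigma> = Exists (\<lambda>D. Exists (\<lambda>E.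
    Conj (NameClosed P D) (Conj (Mem \<tau> D) (Conj (Mem \<sigma> D)
      (Conj (EqRecursion P le D E) (TripleIn p \<tau> \<sigma> E))))))"
  by (simp add: ForcesEq_def EqRecursion_def)

locale forcing =
  fixes P R :: "'v::zfc"
  assumes poset: "forcing_poset P R"
begin

abbreviation below :: "'v \<Rightarrow> 'v \<Rightarrow> bool" (infix "\<preceq>" 50) where
  "p \<preceq> q \<equiv> leq R p q"

lemma below_cond: "p \<preceq> q \<Longrightarrow> p \<in> elts P" "p \<preceq> q \<Longrightarrow> q \<in> elts P"
proof -
  have "elts R \<subseteq> {\<langle>p, q\<rangle> |p q. p \<in> elts P \<and> q \<in> elts P}"
    using poset by (simp add: forcing_poset_def)
  then show "p \<preceq> q \<Longrightarrow> p \<in> elts P" "p \<preceq> q \<Longrightarrow> q \<in> elts P"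
    unfolding leq_def by force+
qed

lemma below_refl [simp]: "p \<in> elts P \<Longrightarrow> p \<preceq> p"
  using poset unfolding forcing_poset_def by blast

lemma below_trans: "p \<preceq> q \<Longrightarrow> q \<preceq> r \<Longrightarrow> p \<preceq> r"
  using poset below_cond unfolding forcing_poset_def by blast

definition densely :: "'v \<Rightarrow> ('v \<Rightarrow> bool) \<Rightarrow> bool" where
  "densely p \<Phi> \<longleftrightarrow> (\<forall>q. q \<preceq> p \<longrightarrow> (\<exists>r. r \<preceq> q \<and> \<Phi> r))"

lemma denselyI: "(\<And>q. q \<preceq> p \<Longrightarrow> \<exists>r. r \<preceq> q \<and> \<Phi> r) \<Longrightarrow> densely p \<Phi>"
  by (simp add: densely_def)

lemma denselyE:
  assumes "densely p \<Phi>" "q \<preceq> p"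
  obtains r where "r \<preceq> q" "r \<preceq> p" "\<Phi> r"
  using assms below_trans unfolding densely_def by blast

lemma densely_ex: "densely p \<Phi> \<Longrightarrow> p \<in> elts P \<Longrightarrow> \<exists>r. r \<preceq> p \<and> \<Phi> r"
  by (simp add: densely_def)

lemma densely_below: "densely p \<Phi> \<Longrightarrow> q \<preceq> p \<Longrightarrow> densely q \<Phi>"
  unfolding densely_def using below_trans by blast

lemma densely_below_iff: "(\<forall>q. q \<preceq> p \<longrightarrow> densely q \<Phi>) \<longleftrightarrow> densely p \<Phi>"
  unfolding densely_def using below_trans below_refl below_cond by meson

lemma densely_mono: "densely p \<Phi> \<Longrightarrow> (\<And>r. r \<preceq> p \<Longrightarrow> \<Phi> r \<Longrightarrow> \<Psi> r) \<Longrightarrow> densely p \<Psi>"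
  unfolding densely_def using below_trans by meson

lemma mono_densely [mono]: "(\<And>r. \<Phi> r \<longrightarrow> \<Psi> r) \<Longrightarrow> densely p \<Phi> \<longrightarrow> densely p \<Psi>"
  using densely_mono by blast

lemma densely_cong: "(\<And>r. r \<preceq> p \<Longrightarrow> \<Phi> r \<longleftrightarrow> \<Psi> r) \<Longrightarrow> densely p \<Phi> \<longleftrightarrow> densely p \<Psi>"
  using densely_mono[of p \<Phi> \<Psi>] densely_mono[of p \<Psi> \<Phi>] by blast

lemma densely_densely: "densely p (\<lambda>r. densely r \<Phi>) \<Longrightarrow> densely p \<Phi>"
  unfolding densely_def using below_trans below_refl below_cond by meson

lemma densely_bind: "densely p \<Phi> \<Longrightarrow> (\<And>r. r \<preceq> p \<Longrightarrow> \<Phi> r \<Longrightarrow> densely r \<Psi>) \<Longrightarrow> densely p \<Psi>"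
  by (rule densely_densely, erule densely_mono)

lemma densely_all: "(\<And>r. r \<preceq> p \<Longrightarrow> \<Phi> r) \<Longrightarrow> densely p \<Phi>"
  unfolding densely_def using below_trans below_refl below_cond by meson

lemma densely_Ex_densely:
  assumes "\<And>i q r. A i q \<Longrightarrow> r \<preceq> q \<Longrightarrow> A i r" "\<And>i q r. \<Phi> i q \<Longrightarrow> r \<preceq> q \<Longrightarrow> \<Phi> i r"
  shows "densely p (\<lambda>r. \<exists>i. A i r \<and> densely r (\<Phi> i)) \<longleftrightarrow> densely p (\<lambda>r. \<exists>i. A i r \<and> \<Phi> i r)"
proof
  assume "densely p (\<lambda>r. \<exists>i. A i r \<and> densely r (\<Phi> i))"
  then show "densely p (\<lambda>r. \<exists>i. A i r \<and> \<Phi> i r)"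
  proof (rule densely_bind, elim exE conjE)
    fix r i assume "A i r" "densely r (\<Phi> i)"
    from this(2) show "densely r (\<lambda>r. \<exists>i. A i r \<and> \<Phi> i r)"
      by (rule densely_mono) (use assms(1) \<open>A i r\<close> in blast)
  qed
next
  assume "densely p (\<lambda>r. \<exists>i. A i r \<and> \<Phi> i r)"
  then show "densely p (\<lambda>r. \<exists>i. A i r \<and> densely r (\<Phi> i))"
  proof (elim densely_mono exE conjE)
    fix r i assume "A i r" "\<Phi> i r"
    moreover from this(2) have "densely r (\<Phi> i)" using assms(2) by (intro densely_all)
    ultimately show "\<exists>i. A i r \<and> densely r (\<Phi> i)" by blast
  qed
qed

lemma densely_imp_below:
  "densely p (\<lambda>r. r \<preceq> s \<longrightarrow> \<Phi> r) \<longleftrightarrow> (\<forall>q. q \<preceq> p \<longrightarrow> q \<preceq> s \<longrightarrow> densely q \<Phi>)"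
proof
  assume "densely p (\<lambda>r. r \<preceq> s \<longrightarrow> \<Phi> r)"
  then show "\<forall>q. q \<preceq> p \<longrightarrow> q \<preceq> s \<longrightarrow> densely q \<Phi>"
    unfolding densely_def using below_trans by meson
next
  assume below_s: "\<forall>q. q \<preceq> p \<longrightarrow> q \<preceq> s \<longrightarrow> densely q \<Phi>"
  show "densely p (\<lambda>r. r \<preceq> s \<longrightarrow> \<Phi> r)"
  proof (rule denselyI)
    fix q assume "q \<preceq> p"
    moreover from this have "q \<preceq> q" using below_cond below_refl by blast
    ultimately show "\<exists>r. r \<preceq> q \<and> (r \<preceq> s \<longrightarrow> \<Phi> r)"
      using below_s unfolding densely_def by (cases "q \<preceq> s") blast+
  qed
qed

lemma sat_DenseBelow [simp]: "sat (DenseBelow P R p F) \<longleftrightarrow> densely p (\<lambda>r. sat (F r))"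
  unfolding DenseBelow_def densely_def using below_cond by simp blast


subsection \<open>Names\<close>

inductive is_name :: "'v \<Rightarrow> bool" where
  is_nameI: "(\<And>z. z \<in> elts x \<Longrightarrow> \<exists>\<sigma> p. z = \<langle>\<sigma>, p\<rangle> \<and> p \<in> elts P \<and> is_name \<sigma>) \<Longrightarrow> is_name x"

lemma is_nameD: "is_name x \<Longrightarrow> z \<in> elts x \<Longrightarrow> \<exists>\<sigma> p. z = \<langle>\<sigma>, p\<rangle> \<and> p \<in> elts P \<and> is_name \<sigma>"
  by (erule is_name.cases) blast

lemma is_name_pairD:
  assumes "is_name x" "\<langle>\<sigma>, p\<rangle> \<in> elts x"
  shows "is_name \<sigma>" "p \<in> elts P"
  using is_nameD[OF assms] by simp_all

definition subnames :: "'v \<Rightarrow> 'v set" where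
  "subnames \<tau> = {x. is_name x \<and> (x = \<tau> \<or> x \<in> trcl \<tau>)}"

lemma small_subnames: "small (subnames \<tau>)"
  by (rule small_subset[of "insert \<tau> (trcl \<tau>)"]) (auto simp: subnames_def small_trcl)

lemma subnames_self: "is_name \<tau> \<Longrightarrow> \<tau> \<in> subnames \<tau>"
  by (simp add: subnames_def)

lemma subnames_is_name: "x \<in> subnames \<tau> \<Longrightarrow> is_name x"
  by (simp add: subnames_def)

lemma subnames_step: "x \<in> subnames \<tau> \<Longrightarrow> \<langle>y, p\<rangle> \<in> elts x \<Longrightarrow> y \<in> subnames \<tau>"
  unfolding subnames_def using is_name_pairD vpair_mem_trcl trcl_trans by blast

lemma sat_NameClosed: "sat (NameClosed P D) \<longleftrightarrow>
    (\<forall>x\<in>elts D. \<forall>z\<in>elts x. \<exists>\<sigma>\<in>elts D. \<exists>p\<in>elts P. z = \<langle>\<sigma>, p\<rangle>)"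
  by (simp add: NameClosed_def)

lemma NameClosed_is_name: "sat (NameClosed P D) \<Longrightarrow> x \<in> elts D \<Longrightarrow> is_name x"
proof (induction x rule: trcl_induct)
  case (step x)
  show ?case
  proof (rule is_nameI)
    fix z assume z: "z \<in> elts x"
    with step.prems obtain \<sigma> p where \<sigma>: "\<sigma> \<in> elts D" "p \<in> elts P" "z = \<langle>\<sigma>, p\<rangle>"
      unfolding sat_NameClosed by blast
    with z have "\<sigma> \<in> trcl x" by (auto intro: vpair_mem_trcl)
    with \<sigma> step show "\<exists>\<sigma> p. z = \<langle>\<sigma>, p\<rangle> \<and> p \<in> elts P \<and> is_name \<sigma>" by blast
  qed
qed

lemma NameClosed_subnames: "sat (NameClosed P (vset (subnames \<tau> \<union> subnames \<sigma>)))"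
proof -
  have "small (subnames \<tau> \<union> subnames \<sigma>)" by (intro small_Un small_subnames)
  then show ?thesis
    unfolding sat_NameClosed using is_nameD subnames_is_name subnames_step by (simp; metis Un_iff)
qed

lemma sat_IsName [simp]: "sat (IsName P \<tau>) \<longleftrightarrow> is_name \<tau>"
proof
  show "sat (IsName P \<tau>) \<Longrightarrow> is_name \<tau>" by (auto simp: IsName_def NameClosed_is_name)
  assume "is_name \<tau>"
  moreover have "small (subnames \<tau> \<union> subnames \<tau>)" by (intro small_Un small_subnames)
  ultimately show "sat (IsName P \<tau>)"
    unfolding IsName_def using NameClosed_subnames[of \<tau> \<tau>] subnames_self by auto
qed


subsection \<open>Forced equality and membership\<close>

text \<open>The recursion that defines forced equality is well-founded, so it has exactly one solution;
  as the greatest one it comes with a bisimulation principle.\<close>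

coinductive forces_eq :: "'v \<Rightarrow> 'v \<Rightarrow> 'v \<Rightarrow> bool" where
  forces_eqI:
    "(\<And>\<pi> s q. \<langle>\<pi>, s\<rangle> \<in> elts \<tau> \<Longrightarrow> q \<preceq> p \<Longrightarrow> q \<preceq> s \<Longrightarrow>
        densely q (\<lambda>r. \<exists>\<pi>' s'. \<langle>\<pi>', s'\<rangle> \<in> elts \<sigma> \<and> r \<preceq> s' \<and> forces_eq r \<pi>' \<pi>)) \<Longrightarrow>
     (\<And>\<pi> s q. \<langle>\<pi>, s\<rangle> \<in> elts \<sigma> \<Longrightarrow> q \<preceq> p \<Longrightarrow> q \<preceq> s \<Longrightarrow>
        densely q (\<lambda>r. \<exists>\<pi>' s'. \<langle>\<pi>', s'\<rangle> \<in> elts \<tau> \<and> r \<preceq> s' \<and> forces_eq r \<pi>' \<pi>)) \<Longrightarrow>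
     forces_eq p \<tau> \<sigma>"

definition forces_mem :: "'v \<Rightarrow> 'v \<Rightarrow> 'v \<Rightarrow> bool" where
  "forces_mem p \<tau> \<sigma> \<longleftrightarrow> densely p (\<lambda>r. \<exists>\<pi> s. \<langle>\<pi>, s\<rangle> \<in> elts \<sigma> \<and> r \<preceq> s \<and> forces_eq r \<pi> \<tau>)"

lemma forces_eq_iff: "forces_eq p \<tau> \<sigma> \<longleftrightarrow>
    (\<forall>\<pi> s q. \<langle>\<pi>, s\<rangle> \<in> elts \<tau> \<longrightarrow> q \<preceq> p \<longrightarrow> q \<preceq> s \<longrightarrow> forces_mem q \<pi> \<sigma>) \<and>
    (\<forall>\<pi> s q. \<langle>\<pi>, s\<rangle> \<in> elts \<sigma> \<longrightarrow> q \<preceq> p \<longrightarrow> q \<preceq> s \<longrightarrow> forces_mem q \<pi> \<tau>)"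
  unfolding forces_mem_def by (subst forces_eq.simps) auto

lemma forces_eqD1: "forces_eq p \<tau> \<sigma> \<Longrightarrow> \<langle>\<pi>, s\<rangle> \<in> elts \<tau> \<Longrightarrow> q \<preceq> p \<Longrightarrow> q \<preceq> s \<Longrightarrow> forces_mem q \<pi> \<sigma>"
  and forces_eqD2: "forces_eq p \<tau> \<sigma> \<Longrightarrow> \<langle>\<pi>, s\<rangle> \<in> elts \<sigma> \<Longrightarrow> q \<preceq> p \<Longrightarrow> q \<preceq> s \<Longrightarrow> forces_mem q \<pi> \<tau>"
  using forces_eq_iff by blast+

lemma forces_eq_bisimulation:
  assumes "B p \<tau> \<sigma>"
    and sym: "\<And>p \<tau> \<sigma>. B p \<tau> \<sigma> \<Longrightarrow> B p \<sigma> \<tau>"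
    and step: "\<And>p \<tau> \<sigma> \<pi> s q. B p \<tau> \<sigma> \<Longrightarrow> \<langle>\<pi>, s\<rangle> \<in> elts \<tau> \<Longrightarrow> q \<preceq> p \<Longrightarrow> q \<preceq> s \<Longrightarrow>
      densely q (\<lambda>r. \<exists>\<pi>' s'. \<langle>\<pi>', s'\<rangle> \<in> elts \<sigma> \<and> r \<preceq> s' \<and> B r \<pi>' \<pi>)"
  shows "forces_eq p \<tau> \<sigma>"
  using assms(1)
proof (coinduction arbitrary: p \<tau> \<sigma>)
  case forces_eq
  have "densely q (\<lambda>r. \<exists>\<pi>' s'. \<langle>\<pi>', s'\<rangle> \<in> elts \<sigma> \<and> r \<preceq> s' \<and> (B r \<pi>' \<pi> \<or> forces_eq r \<pi>' \<pi>))"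
    if "B p \<tau> \<sigma>" "\<langle>\<pi>, s\<rangle> \<in> elts \<tau>" "q \<preceq> p" "q \<preceq> s" for \<tau> \<sigma> \<pi> s q
    by (rule densely_mono[OF step[OF that]]) blast
  then show ?case using forces_eq sym[OF forces_eq] by auto
qed

lemma forces_eq_mono: "forces_eq p \<tau> \<sigma> \<Longrightarrow> q \<preceq> p \<Longrightarrow> forces_eq q \<tau> \<sigma>"
  unfolding forces_eq_iff[of _ \<tau> \<sigma>] using below_trans by blast

lemma forces_mem_mono: "forces_mem p \<tau> \<sigma> \<Longrightarrow> q \<preceq> p \<Longrightarrow> forces_mem q \<tau> \<sigma>"
  unfolding forces_mem_def by (rule densely_below)

lemma forces_eq_refl [simp]: "forces_eq p \<tau> \<tau>"
proof (rule forces_eq_bisimulation[of "\<lambda>p \<tau> \<sigma>. \<tau> = \<sigma>"])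
  fix p \<tau> \<sigma> \<pi> s q assume "\<tau> = \<sigma>" "\<langle>\<pi>, s\<rangle> \<in> elts \<tau>" "q \<preceq> p" "q \<preceq> s"
  then show "densely q (\<lambda>r. \<exists>\<pi>' s'. \<langle>\<pi>', s'\<rangle> \<in> elts \<sigma> \<and> r \<preceq> s' \<and> \<pi>' = \<pi>)"
    using below_trans by (intro densely_all) blast
qed simp_all

lemma forces_eq_sym: "forces_eq p \<tau> \<sigma> \<Longrightarrow> forces_eq p \<sigma> \<tau>"
proof (rule forces_eq_bisimulation[of "\<lambda>p \<tau> \<sigma>. forces_eq p \<tau> \<sigma> \<or> forces_eq p \<sigma> \<tau>"])
  fix p \<tau> \<sigma> \<pi> s q
  assume "forces_eq p \<tau> \<sigma> \<or> forces_eq p \<sigma> \<tau>" "\<langle>\<pi>, s\<rangle> \<in> elts \<tau>" "q \<preceq> p" "q \<preceq> s"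
  then have "forces_mem q \<pi> \<sigma>" using forces_eqD1 forces_eqD2 by blast
  then show "densely q (\<lambda>r. \<exists>\<pi>' s'. \<langle>\<pi>', s'\<rangle> \<in> elts \<sigma> \<and> r \<preceq> s' \<and>
      (forces_eq r \<pi>' \<pi> \<or> forces_eq r \<pi> \<pi>'))"
    unfolding forces_mem_def by (rule densely_mono) blast
qed blast+

lemma forces_eq_commute: "forces_eq p \<tau> \<sigma> \<longleftrightarrow> forces_eq p \<sigma> \<tau>"
  using forces_eq_sym by blast

lemma forces_eq_trans:
  assumes "forces_eq p \<tau> \<sigma>" "forces_eq p \<sigma> \<rho>"
  shows "forces_eq p \<tau> \<rho>"
proof (rule forces_eq_bisimulation[of "\<lambda>p \<tau> \<rho>. \<exists>\<sigma>. forces_eq p \<tau> \<sigma> \<and> forces_eq p \<sigma> \<rho>"])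
  fix p \<tau> \<rho> \<pi> s q
  assume "\<exists>\<sigma>. forces_eq p \<tau> \<sigma> \<and> forces_eq p \<sigma> \<rho>" and \<pi>: "\<langle>\<pi>, s\<rangle> \<in> elts \<tau>" "q \<preceq> p" "q \<preceq> s"
  then obtain \<sigma> where \<sigma>: "forces_eq p \<tau> \<sigma>" "forces_eq p \<sigma> \<rho>" by blast
  show "densely q (\<lambda>r. \<exists>\<pi>'' s''. \<langle>\<pi>'', s''\<rangle> \<in> elts \<rho> \<and> r \<preceq> s'' \<and>
      (\<exists>\<pi>'. forces_eq r \<pi>'' \<pi>' \<and> forces_eq r \<pi>' \<pi>))"
    using forces_eqD1[OF \<sigma>(1) \<pi>] unfolding forces_mem_def
  proof (rule densely_bind, elim exE conjE)
    fix r \<pi>' s' assume r: "r \<preceq> q" "\<langle>\<pi>', s'\<rangle> \<in> elts \<sigma>" "r \<preceq> s'" "forces_eq r \<pi>' \<pi>"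
    then have "forces_mem r \<pi>' \<rho>" using forces_eqD1[OF \<sigma>(2)] \<pi>(2) below_trans by blast
    then show "densely r (\<lambda>r. \<exists>\<pi>'' s''. \<langle>\<pi>'', s''\<rangle> \<in> elts \<rho> \<and> r \<preceq> s'' \<and>
        (\<exists>\<pi>'. forces_eq r \<pi>'' \<pi>' \<and> forces_eq r \<pi>' \<pi>))"
      unfolding forces_mem_def by (rule densely_mono) (meson r(4) forces_eq_mono)
  qed
next
  show "\<exists>\<sigma>. forces_eq p \<tau> \<sigma> \<and> forces_eq p \<sigma> \<rho>" using assms by blast
  show "\<exists>\<sigma>. forces_eq p \<rho> \<sigma> \<and> forces_eq p \<sigma> \<tau>" if "\<exists>\<sigma>. forces_eq p \<tau> \<sigma> \<and> forces_eq p \<sigma> \<rho>" for p \<tau> \<rho>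
    using that forces_eq_sym by blast
qed

lemma forces_mem_elt: "\<langle>\<pi>, s\<rangle> \<in> elts \<tau> \<Longrightarrow> q \<preceq> s \<Longrightarrow> forces_mem q \<pi> \<tau>"
  using forces_eqD1[of q \<tau> \<tau> \<pi> s q] below_cond by simp

lemma forces_mem_cong_left: "forces_eq p \<tau> \<tau>' \<Longrightarrow> forces_mem p \<tau> \<sigma> \<Longrightarrow> forces_mem p \<tau>' \<sigma>"
  unfolding forces_mem_def by (elim densely_mono) (meson forces_eq_mono forces_eq_trans)

lemma forces_mem_cong_right:
  assumes "forces_eq p \<sigma> \<sigma>'" "forces_mem p \<tau> \<sigma>"
  shows "forces_mem p \<tau> \<sigma>'"
  unfolding forces_mem_def[of p \<tau> \<sigma>']
  using assms(2)[unfolded forces_mem_def]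
proof (rule densely_bind, elim exE conjE)
  fix r \<pi> s assume r: "r \<preceq> p" "\<langle>\<pi>, s\<rangle> \<in> elts \<sigma>" "r \<preceq> s" "forces_eq r \<pi> \<tau>"
  have "forces_mem r \<tau> \<sigma>'"
    using forces_mem_cong_left[OF r(4) forces_eqD1[OF assms(1) r(2,1,3)]] .
  then show "densely r (\<lambda>r. \<exists>\<pi> s. \<langle>\<pi>, s\<rangle> \<in> elts \<sigma>' \<and> r \<preceq> s \<and> forces_eq r \<pi> \<tau>)"
    unfolding forces_mem_def .
qed

lemma forces_mem_cong:
  "forces_eq p \<tau> \<tau>' \<Longrightarrow> forces_eq p \<sigma> \<sigma>' \<Longrightarrow> forces_mem p \<tau> \<sigma> \<longleftrightarrow> forces_mem p \<tau>' \<sigma>'"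
  by (meson forces_eq_sym forces_mem_cong_left forces_mem_cong_right)

lemma forces_eq_cong:
  "forces_eq p \<tau> \<tau>' \<Longrightarrow> forces_eq p \<sigma> \<sigma>' \<Longrightarrow> forces_eq p \<tau> \<sigma> \<longleftrightarrow> forces_eq p \<tau>' \<sigma>'"
  by (meson forces_eq_sym forces_eq_trans)

lemma densely_forces_mem [simp]: "densely p (\<lambda>r. forces_mem r \<tau> \<sigma>) \<longleftrightarrow> forces_mem p \<tau> \<sigma>"
proof
  show "densely p (\<lambda>r. forces_mem r \<tau> \<sigma>) \<Longrightarrow> forces_mem p \<tau> \<sigma>"
    unfolding forces_mem_def by (rule densely_densely)
qed (rule densely_all, rule forces_mem_mono)

lemma densely_forces_eq [simp]: "densely p (\<lambda>r. forces_eq r \<tau> \<sigma>) \<longleftrightarrow> forces_eq p \<tau> \<sigma>"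
proof
  assume dense: "densely p (\<lambda>r. forces_eq r \<tau> \<sigma>)"
  have "forces_mem q \<pi> \<sigma>'"
    if "densely p (\<lambda>r. forces_eq r \<tau>' \<sigma>')" "\<langle>\<pi>, s\<rangle> \<in> elts \<tau>'" "q \<preceq> p" "q \<preceq> s" for \<tau>' \<sigma>' \<pi> s q
  proof -
    have "densely q (\<lambda>r. forces_eq r \<tau>' \<sigma>')" using densely_below that by blast
    then have "densely q (\<lambda>r. forces_mem r \<pi> \<sigma>')"
      by (rule densely_mono) (meson that below_trans below_refl below_cond forces_eqD1)
    then show ?thesis by simp
  qed
  moreover have "densely p (\<lambda>r. forces_eq r \<sigma> \<tau>)"
    using dense by (rule densely_mono) (rule forces_eq_sym)
  ultimately show "forces_eq p \<tau> \<sigma>" unfolding forces_eq_iff[of p] using dense by blast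
qed (rule densely_all, rule forces_eq_mono)

lemma forces_eq_extensional:
  assumes "is_name \<tau>" "is_name \<sigma>"
    and "\<And>\<pi> q. is_name \<pi> \<Longrightarrow> q \<preceq> p \<Longrightarrow> forces_mem q \<pi> \<tau> \<longleftrightarrow> forces_mem q \<pi> \<sigma>"
  shows "forces_eq p \<tau> \<sigma>"
  unfolding forces_eq_iff using assms forces_mem_elt is_name_pairD by blast

lemma sat_ForcesSubClause:
  "sat (ForcesSubClause P R K p \<tau> \<sigma>) \<longleftrightarrow> (\<forall>\<pi> s. \<langle>\<pi>, s\<rangle> \<in> elts \<tau> \<longrightarrow>
     densely p (\<lambda>r. r \<preceq> s \<longrightarrow> (\<exists>\<pi>' s'. \<langle>\<pi>', s'\<rangle> \<in> elts \<sigma> \<and> r \<preceq> s' \<and> sat (K r \<pi> \<pi>'))))"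
  by (simp add: ForcesSubClause_def leq_def)

lemma sat_ForcesEqClause_iff:
  assumes "\<And>r \<pi> s \<pi>' s'. r \<preceq> p \<Longrightarrow> \<langle>\<pi>, s\<rangle> \<in> elts \<tau> \<Longrightarrow> \<langle>\<pi>', s'\<rangle> \<in> elts \<sigma> \<Longrightarrow>
    \<langle>r, \<langle>\<pi>, \<pi>'\<rangle>\<rangle> \<in> elts E \<longleftrightarrow> forces_eq r \<pi> \<pi>'"
  shows "sat (ForcesEqClause P R E p \<tau> \<sigma>) \<longleftrightarrow> forces_eq p \<tau> \<sigma>"
proof -
  have "densely q (\<lambda>r. \<exists>\<pi>' s'. \<langle>\<pi>', s'\<rangle> \<in> elts \<sigma> \<and> r \<preceq> s' \<and> \<langle>r, \<langle>\<pi>, \<pi>'\<rangle>\<rangle> \<in> elts E) \<longleftrightarrow>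
      forces_mem q \<pi> \<sigma>"
    if "\<langle>\<pi>, s\<rangle> \<in> elts \<tau>" "q \<preceq> p" for \<pi> s q
    unfolding forces_mem_def
  proof (rule densely_cong)
    fix r assume "r \<preceq> q"
    then have "r \<preceq> p" using that(2) below_trans by blast
    then show "(\<exists>\<pi>' s'. \<langle>\<pi>', s'\<rangle> \<in> elts \<sigma> \<and> r \<preceq> s' \<and> \<langle>r, \<langle>\<pi>, \<pi>'\<rangle>\<rangle> \<in> elts E) \<longleftrightarrow>
        (\<exists>\<pi>' s'. \<langle>\<pi>', s'\<rangle> \<in> elts \<sigma> \<and> r \<preceq> s' \<and> forces_eq r \<pi>' \<pi>)"
      using assms[OF _ that(1)] forces_eq_commute by blast
  qed
  moreover have "densely q (\<lambda>r. \<exists>\<pi> s. \<langle>\<pi>, s\<rangle> \<in> elts \<tau> \<and> r \<preceq> s \<and> \<langle>r, \<langle>\<pi>, \<pi>'\<rangle>\<rangle> \<in> elts E) \<longleftrightarrow>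
      forces_mem q \<pi>' \<tau>"
    if "\<langle>\<pi>', s'\<rangle> \<in> elts \<sigma>" "q \<preceq> p" for \<pi>' s' q
    unfolding forces_mem_def
  proof (rule densely_cong)
    fix r assume "r \<preceq> q"
    then have "r \<preceq> p" using that(2) below_trans by blast
    then show "(\<exists>\<pi> s. \<langle>\<pi>, s\<rangle> \<in> elts \<tau> \<and> r \<preceq> s \<and> \<langle>r, \<langle>\<pi>, \<pi>'\<rangle>\<rangle> \<in> elts E) \<longleftrightarrow>
        (\<exists>\<pi> s. \<langle>\<pi>, s\<rangle> \<in> elts \<tau> \<and> r \<preceq> s \<and> forces_eq r \<pi> \<pi>')"
      using assms[OF _ _ that(1)] by blast
  qed
  ultimately show ?thesis
    unfolding ForcesEqClause_def sat.simps sat_ForcesSubClause sat_TripleIn densely_imp_below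
      forces_eq_iff[of p]
    by blast
qed

lemma sat_EqRecursion_unique:
  assumes closed: "sat (NameClosed P D)" and rec: "sat (EqRecursion P R D E)"
  shows "q \<in> elts P \<Longrightarrow> x \<in> elts D \<Longrightarrow> y \<in> elts D \<Longrightarrow> \<langle>q, \<langle>x, y\<rangle>\<rangle> \<in> elts E \<longleftrightarrow> forces_eq q x y"
proof (induction x arbitrary: q y rule: trcl_induct)
  case (step x)
  have subname: "\<pi> \<in> elts D" if "x \<in> elts D" "\<langle>\<pi>, s\<rangle> \<in> elts x" for x \<pi> s
    using closed that by (force simp: sat_NameClosed)
  have "sat (ForcesEqClause P R E q x y) \<longleftrightarrow> forces_eq q x y"
    by (rule sat_ForcesEqClause_iff) (meson step subname below_cond vpair_mem_trcl)
  then show ?case using rec step.prems by (simp add: EqRecursion_def)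
qed

lemma ex_EqRecursion:
  assumes closed: "sat (NameClosed P D)"
  shows "\<exists>E. sat (EqRecursion P R D E) \<and> (\<forall>q\<in>elts P. \<forall>x\<in>elts D. \<forall>y\<in>elts D.
    \<langle>q, \<langle>x, y\<rangle>\<rangle> \<in> elts E \<longleftrightarrow> forces_eq q x y)"
proof -
  define T where "T = {\<langle>q, \<langle>x, y\<rangle>\<rangle> |q x y. q \<in> elts P \<and> x \<in> elts D \<and> y \<in> elts D \<and> forces_eq q x y}"
  have "small {\<langle>q, \<langle>x, y\<rangle>\<rangle> |q x y. q \<in> elts P \<and> x \<in> elts D \<and> y \<in> elts D}"
    by (intro small_image3 small_elts)
  then have "small T" by (rule small_subset) (auto simp: T_def)
  then have E: "\<langle>q, \<langle>x, y\<rangle>\<rangle> \<in> elts (vset T) \<longleftrightarrow>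
      q \<in> elts P \<and> x \<in> elts D \<and> y \<in> elts D \<and> forces_eq q x y" for q x y
    by (auto simp: T_def)
  have subname: "\<pi> \<in> elts D" if "x \<in> elts D" "\<langle>\<pi>, s\<rangle> \<in> elts x" for x \<pi> s
    using closed that by (force simp: sat_NameClosed)
  have "sat (ForcesEqClause P R (vset T) q x y) \<longleftrightarrow> forces_eq q x y"
    if "q \<in> elts P" "x \<in> elts D" "y \<in> elts D" for q x y
    by (rule sat_ForcesEqClause_iff) (use that subname below_cond in \<open>auto simp: E\<close>)
  then show ?thesis by (intro exI[of _ "vset T"]) (simp add: EqRecursion_def E)
qed

lemma sat_ForcesEq:
  assumes "p \<in> elts P"
  shows "sat (ForcesEq P R p \<tau> \<sigma>) \<longleftrightarrow> is_name \<tau> \<and> is_name \<sigma> \<and> forces_eq p \<tau> \<sigma>"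
proof
  assume "sat (ForcesEq P R p \<tau> \<sigma>)"
  then obtain D E where "sat (NameClosed P D)" "\<tau> \<in> elts D" "\<sigma> \<in> elts D"
    "sat (EqRecursion P R D E)" "\<langle>p, \<langle>\<tau>, \<sigma>\<rangle>\<rangle> \<in> elts E"
    unfolding ForcesEq_unfold by auto
  then show "is_name \<tau> \<and> is_name \<sigma> \<and> forces_eq p \<tau> \<sigma>"
    using sat_EqRecursion_unique assms NameClosed_is_name by blast
next
  assume names: "is_name \<tau> \<and> is_name \<sigma> \<and> forces_eq p \<tau> \<sigma>"
  define D where "D = vset (subnames \<tau> \<union> subnames \<sigma>)"
  have "elts D = subnames \<tau> \<union> subnames \<sigma>"
    unfolding D_def by (intro elts_vset small_Un small_subnames)
  then have D: "sat (NameClosed P D)" "\<tau> \<in> elts D" "\<sigma> \<in> elts D"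
    using NameClosed_subnames names subnames_self by (auto simp: D_def)
  obtain E where "sat (EqRecursion P R D E)" "\<langle>p, \<langle>\<tau>, \<sigma>\<rangle>\<rangle> \<in> elts E"
    using ex_EqRecursion[OF D(1)] names assms D(2,3) by blast
  then show "sat (ForcesEq P R p \<tau> \<sigma>)"
    unfolding ForcesEq_unfold sat_Exists
    by (intro exI[where x = D] exI[where x = E]) (use D in simp)
qed


subsection \<open>Forcing formulas\<close>

text \<open>Quantifying over the conditions below \<^term>\<open>p\<close> makes the clauses of the recursion hold for
  every \<^term>\<open>p\<close>, also outside \<^term>\<open>P\<close>.\<close>

definition forces :: "'v \<Rightarrow> 'v fm \<Rightarrow> bool" (infix "\<tturnstile>" 50) where
  "p \<tturnstile> \<phi> \<longleftrightarrow> (\<forall>q. q \<preceq> p \<longrightarrow> sat (Forces P R \<phi> q))"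

lemma forces_mono: "p \<tturnstile> \<phi> \<Longrightarrow> q \<preceq> p \<Longrightarrow> q \<tturnstile> \<phi>"
  unfolding forces_def using below_trans by blast

lemma sat_Forces_mono: "sat (Forces P R \<phi> p) \<Longrightarrow> q \<preceq> p \<Longrightarrow> sat (Forces P R \<phi> q)"
proof (induction \<phi> arbitrary: p q)
  case (Mem \<tau> \<sigma>)
  then show ?case by (auto simp: ForcesMem_def intro: densely_below)
next
  case (Eq \<tau> \<sigma>)
  then show ?case using sat_ForcesEq below_cond forces_eq_mono by (metis Forces.simps(2))
next
  case (Neg \<phi>)
  then show ?case using below_trans[OF _ Neg.prems(2)] by auto
qed auto

lemma sat_Forces_iff: "p \<in> elts P \<Longrightarrow> sat (Forces P R \<phi> p) \<longleftrightarrow> p \<tturnstile> \<phi>"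
  unfolding forces_def using sat_Forces_mono below_refl by blast

lemma forces_outside: "p \<notin> elts P \<Longrightarrow> p \<tturnstile> \<phi>"
  unfolding forces_def using below_cond by blast

lemma forced_iff: "forced P R \<phi> \<longleftrightarrow> (\<forall>p\<in>elts P. p \<tturnstile> \<phi>)"
  by (simp add: forced_def sat_Forces_iff)

lemma forces_below_iff: "(\<forall>q. q \<preceq> p \<longrightarrow> q \<tturnstile> \<phi>) \<longleftrightarrow> p \<tturnstile> \<phi>"
  unfolding forces_def using below_trans below_refl below_cond by blast

lemma forces_Eq:
  assumes "is_name \<tau>" "is_name \<sigma>"
  shows "p \<tturnstile> Eq \<tau> \<sigma> \<longleftrightarrow> forces_eq p \<tau> \<sigma>"
proof -
  have "p \<tturnstile> Eq \<tau> \<sigma> \<longleftrightarrow> (\<forall>q. q \<preceq> p \<longrightarrow> forces_eq q \<tau> \<sigma>)"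
    unfolding forces_def Forces.simps using assms sat_ForcesEq below_cond by blast
  also have "\<dots> \<longleftrightarrow> forces_eq p \<tau> \<sigma>"
    using densely_all[of p "\<lambda>q. forces_eq q \<tau> \<sigma>"] forces_eq_mono by auto
  finally show ?thesis .
qed

lemma forces_Eq_names:
  assumes "p \<tturnstile> Eq \<tau> \<sigma>" "p \<in> elts P"
  shows "is_name \<tau>" "is_name \<sigma>" "forces_eq p \<tau> \<sigma>"
  using assms sat_ForcesEq sat_Forces_iff[of p "Eq \<tau> \<sigma>"] by simp_all

lemma forces_Mem:
  assumes "is_name \<tau>" "is_name \<sigma>"
  shows "p \<tturnstile> Mem \<tau> \<sigma> \<longleftrightarrow> forces_mem p \<tau> \<sigma>"
proof -
  have "sat (Forces P R (Mem \<tau> \<sigma>) q) \<longleftrightarrow> forces_mem q \<tau> \<sigma>" for q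
    unfolding Forces.simps ForcesMem_def forces_mem_def sat_DenseBelow
  proof (rule densely_cong)
    fix r assume "r \<preceq> q"
    then have "r \<in> elts P" using below_cond by blast
    then show "sat (Exists (\<lambda>\<pi>. Exists (\<lambda>s. Conj (PairIn \<pi> s \<sigma>) (Conj (PairIn r s R)
        (ForcesEq P R r \<pi> \<tau>))))) \<longleftrightarrow> (\<exists>\<pi> s. \<langle>\<pi>, s\<rangle> \<in> elts \<sigma> \<and> r \<preceq> s \<and> forces_eq r \<pi> \<tau>)"
      using assms is_name_pairD by (simp add: sat_ForcesEq leq_def) blast
  qed
  then have "p \<tturnstile> Mem \<tau> \<sigma> \<longleftrightarrow> (\<forall>q. q \<preceq> p \<longrightarrow> forces_mem q \<tau> \<sigma>)"
    unfolding forces_def by blast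
  also have "\<dots> \<longleftrightarrow> forces_mem p \<tau> \<sigma>"
    using densely_all[of p "\<lambda>q. forces_mem q \<tau> \<sigma>"] forces_mem_mono by auto
  finally show ?thesis .
qed

lemma forces_Conj: "p \<tturnstile> Conj \<phi> \<psi> \<longleftrightarrow> p \<tturnstile> \<phi> \<and> p \<tturnstile> \<psi>"
  by (auto simp: forces_def)

lemma forces_Neg: "p \<tturnstile> Neg \<phi> \<longleftrightarrow> (\<forall>q. q \<preceq> p \<longrightarrow> \<not> q \<tturnstile> \<phi>)"
proof -
  have "p \<tturnstile> Neg \<phi> \<longleftrightarrow> (\<forall>q. q \<preceq> p \<longrightarrow> (\<forall>r. r \<preceq> q \<longrightarrow> \<not> r \<tturnstile> \<phi>))"
    unfolding forces_def[of p] Forces.simps using below_cond by (auto simp: sat_Forces_iff)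
  then show ?thesis using below_trans below_refl below_cond by blast
qed

lemma forces_Forall: "p \<tturnstile> Forall F \<longleftrightarrow> (\<forall>\<tau>. is_name \<tau> \<longrightarrow> p \<tturnstile> F \<tau>)"
  by (auto simp: forces_def)

lemma forces_Eq_densely:
  assumes dense: "densely p (\<lambda>r. r \<tturnstile> Eq \<tau> \<sigma>)"
  shows "p \<tturnstile> Eq \<tau> \<sigma>"
  unfolding forces_below_iff[of p, symmetric]
proof (intro allI impI)
  fix q assume q: "q \<preceq> p"
  then obtain r where "r \<preceq> q" "r \<tturnstile> Eq \<tau> \<sigma>" using denselyE[OF dense] by blast
  then have "is_name \<tau>" "is_name \<sigma>" using forces_Eq_names below_cond by blast+
  then show "q \<tturnstile> Eq \<tau> \<sigma>" using densely_below[OF dense q] by (simp add: forces_Eq)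
qed

lemma forces_Mem_densely:
  assumes dense: "densely p (\<lambda>r. r \<tturnstile> Mem \<tau> \<sigma>)"
  shows "p \<tturnstile> Mem \<tau> \<sigma>"
proof -
  obtain \<Phi> where \<Phi>: "\<And>q. sat (Forces P R (Mem \<tau> \<sigma>) q) \<longleftrightarrow> densely q \<Phi>"
    by (rule that, unfold Forces.simps ForcesMem_def sat_DenseBelow) (rule refl)
  have "densely q \<Phi>" if "q \<preceq> p" for q
  proof (rule densely_densely, rule densely_mono[OF densely_below[OF dense that]])
    fix r assume "r \<preceq> q" "r \<tturnstile> Mem \<tau> \<sigma>"
    then show "densely r \<Phi>" using \<Phi> sat_Forces_iff below_cond by metis
  qed
  then show ?thesis unfolding forces_def \<Phi> by blast
qed

lemma forces_densely: "densely p (\<lambda>r. r \<tturnstile> \<phi>) \<Longrightarrow> p \<tturnstile> \<phi>"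
proof (induction \<phi> arbitrary: p)
  case (Neg \<phi>)
  show ?case
    unfolding forces_Neg
  proof (intro allI impI notI)
    fix q assume q: "q \<preceq> p" "q \<tturnstile> \<phi>"
    then obtain r where "r \<preceq> q" "r \<tturnstile> Neg \<phi>" using Neg.prems denselyE by blast
    then show False using q forces_mono below_refl below_cond unfolding forces_Neg by blast
  qed
next
  case (Conj \<phi> \<psi>)
  have "densely p (\<lambda>r. r \<tturnstile> \<phi>)" "densely p (\<lambda>r. r \<tturnstile> \<psi>)"
    using Conj.prems by (auto simp: forces_Conj elim: densely_mono)
  with Conj.IH show ?case by (simp add: forces_Conj)
next
  case (Forall F)
  show ?case
    unfolding forces_Forall
  proof (intro allI impI)
    fix \<tau> assume "is_name \<tau>"
    then have "densely p (\<lambda>r. r \<tturnstile> F \<tau>)"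
      using Forall.prems by (auto simp: forces_Forall elim: densely_mono)
    then show "p \<tturnstile> F \<tau>" by (rule Forall.IH[OF rangeI])
  qed
qed (rule forces_Mem_densely forces_Eq_densely, assumption)+

lemma forces_Imp: "p \<tturnstile> Imp \<phi> \<psi> \<longleftrightarrow> (\<forall>q. q \<preceq> p \<longrightarrow> q \<tturnstile> \<phi> \<longrightarrow> q \<tturnstile> \<psi>)"
proof
  assume imp: "p \<tturnstile> Imp \<phi> \<psi>"
  show "\<forall>q. q \<preceq> p \<longrightarrow> q \<tturnstile> \<phi> \<longrightarrow> q \<tturnstile> \<psi>"
  proof (intro allI impI forces_densely denselyI)
    fix q r assume "q \<preceq> p" "q \<tturnstile> \<phi>" "r \<preceq> q"
    then show "\<exists>s. s \<preceq> r \<and> s \<tturnstile> \<psi>"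
      using imp forces_mono below_trans unfolding Imp_def forces_Neg forces_Conj by blast
  qed
next
  assume "\<forall>q. q \<preceq> p \<longrightarrow> q \<tturnstile> \<phi> \<longrightarrow> q \<tturnstile> \<psi>"
  then show "p \<tturnstile> Imp \<phi> \<psi>"
    unfolding Imp_def forces_Neg forces_Conj using below_refl below_cond by blast
qed

lemma forces_Imp_decided:
  assumes "\<And>q. q \<preceq> p \<Longrightarrow> q \<tturnstile> \<phi> \<longleftrightarrow> A"
  shows "p \<tturnstile> Imp \<phi> \<psi> \<longleftrightarrow> (A \<longrightarrow> p \<tturnstile> \<psi>)"
  unfolding forces_Imp using assms forces_below_iff[of p \<psi>] by blast

lemma forces_Disj: "p \<tturnstile> Disj \<phi> \<psi> \<longleftrightarrow> densely p (\<lambda>r. r \<tturnstile> \<phi> \<or> r \<tturnstile> \<psi>)"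
  unfolding Disj_def forces_Neg forces_Conj densely_def by blast

lemma forces_Iff: "p \<tturnstile> Iff \<phi> \<psi> \<longleftrightarrow> (\<forall>q. q \<preceq> p \<longrightarrow> q \<tturnstile> \<phi> \<longleftrightarrow> q \<tturnstile> \<psi>)"
  unfolding Iff_def forces_Conj forces_Imp by blast

lemma forces_Exists: "p \<tturnstile> Exists F \<longleftrightarrow> densely p (\<lambda>r. \<exists>\<tau>. is_name \<tau> \<and> r \<tturnstile> F \<tau>)"
  unfolding Exists_def forces_Neg forces_Forall densely_def by blast

lemma forces_ExistsI: "is_name \<tau> \<Longrightarrow> p \<tturnstile> F \<tau> \<Longrightarrow> p \<tturnstile> Exists F"
  unfolding forces_Exists using forces_mono by (intro densely_all) blast

lemma forces_ExistsE:
  assumes "p \<tturnstile> Exists F" "p \<in> elts P"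
  obtains r \<tau> where "r \<preceq> p" "is_name \<tau>" "r \<tturnstile> F \<tau>"
  using densely_ex[OF assms(1)[unfolded forces_Exists] assms(2)] by blast

lemma forces_BForall: "is_name a \<Longrightarrow>
    p \<tturnstile> BForall a F \<longleftrightarrow> (\<forall>\<tau> q. is_name \<tau> \<longrightarrow> q \<preceq> p \<longrightarrow> forces_mem q \<tau> a \<longrightarrow> q \<tturnstile> F \<tau>)"
  unfolding BForall_def forces_Forall by (auto simp: forces_Imp forces_Mem)

lemma forces_BForallD:
  "p \<tturnstile> BForall a F \<Longrightarrow> is_name a \<Longrightarrow> is_name \<tau> \<Longrightarrow> q \<preceq> p \<Longrightarrow> forces_mem q \<tau> a \<Longrightarrow> q \<tturnstile> F \<tau>"
  by (simp add: forces_BForall)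

lemma forces_BExists: "is_name a \<Longrightarrow>
    p \<tturnstile> BExists a F \<longleftrightarrow> densely p (\<lambda>r. \<exists>\<tau>. is_name \<tau> \<and> forces_mem r \<tau> a \<and> r \<tturnstile> F \<tau>)"
  unfolding BExists_def forces_Exists forces_Conj using forces_Mem by (simp cong: conj_cong)

lemma forces_BExistsI:
  "is_name a \<Longrightarrow> is_name \<tau> \<Longrightarrow> forces_mem p \<tau> a \<Longrightarrow> p \<tturnstile> F \<tau> \<Longrightarrow> p \<tturnstile> BExists a F"
  unfolding forces_BExists using forces_mono forces_mem_mono by (intro densely_all) blast

end


section \<open>Uniform formulas\<close>

text \<open>Bound variables are HOL functions, so an arbitrary formula need not respect forced equality.
  The relation below holds between two instances of one formula whose parameters are
  paired by \<^term>\<open>E\<close>.\<close>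

inductive fm_rel :: "('v \<times> 'w) set \<Rightarrow> 'v fm \<Rightarrow> 'w fm \<Rightarrow> bool" where
  fm_rel_Mem: "(a, a') \<in> E \<Longrightarrow> (b, b') \<in> E \<Longrightarrow> fm_rel E (Mem a b) (Mem a' b')"
| fm_rel_Eq: "(a, a') \<in> E \<Longrightarrow> (b, b') \<in> E \<Longrightarrow> fm_rel E (Eq a b) (Eq a' b')"
| fm_rel_Neg: "fm_rel E \<phi> \<phi>' \<Longrightarrow> fm_rel E (Neg \<phi>) (Neg \<phi>')"
| fm_rel_Conj: "fm_rel E \<phi> \<phi>' \<Longrightarrow> fm_rel E \<psi> \<psi>' \<Longrightarrow> fm_rel E (Conj \<phi> \<psi>) (Conj \<phi>' \<psi>')"
| fm_rel_Forall: "(\<And>a a'. fm_rel (insert (a, a') E) (F a) (F' a')) \<Longrightarrow>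
    fm_rel E (Forall F) (Forall F')"

lemma fm_rel_mono: "fm_rel E \<phi> \<phi>' \<Longrightarrow> E \<subseteq> E' \<Longrightarrow> fm_rel E' \<phi> \<phi>'"
proof (induction arbitrary: E' rule: fm_rel.induct)
  case (fm_rel_Forall E F F')
  show ?case
  proof (rule fm_rel.fm_rel_Forall)
    fix a a'
    show "fm_rel (insert (a, a') E') (F a) (F' a')"
      by (rule fm_rel_Forall.IH) (use fm_rel_Forall.prems in blast)
  qed
qed (auto intro: fm_rel.intros)

named_theorems fm_rel_intros
declare fm_rel.intros [fm_rel_intros]

lemma fm_rel_Imp [fm_rel_intros]:
  "fm_rel E \<phi> \<phi>' \<Longrightarrow> fm_rel E \<psi> \<psi>' \<Longrightarrow> fm_rel E (Imp \<phi> \<psi>) (Imp \<phi>' \<psi>')"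
  unfolding Imp_def by (intro fm_rel_intros)

lemma fm_rel_Disj [fm_rel_intros]:
  "fm_rel E \<phi> \<phi>' \<Longrightarrow> fm_rel E \<psi> \<psi>' \<Longrightarrow> fm_rel E (Disj \<phi> \<psi>) (Disj \<phi>' \<psi>')"
  unfolding Disj_def by (intro fm_rel_intros)

lemma fm_rel_Iff [fm_rel_intros]:
  "fm_rel E \<phi> \<phi>' \<Longrightarrow> fm_rel E \<psi> \<psi>' \<Longrightarrow> fm_rel E (Iff \<phi> \<psi>) (Iff \<phi>' \<psi>')"
  unfolding Iff_def by (intro fm_rel_intros)

lemma fm_rel_Exists [fm_rel_intros]:
  "(\<And>a a'. fm_rel (insert (a, a') E) (F a) (F' a')) \<Longrightarrow> fm_rel E (Exists F) (Exists F')"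
  unfolding Exists_def by (intro fm_rel_intros)

lemma fm_rel_BForall [fm_rel_intros]:
  "(b, b') \<in> E \<Longrightarrow> (\<And>a a'. fm_rel (insert (a, a') E) (F a) (F' a')) \<Longrightarrow>
    fm_rel E (BForall b F) (BForall b' F')"
  unfolding BForall_def by (intro fm_rel_intros) auto

lemma fm_rel_BExists [fm_rel_intros]:
  "(b, b') \<in> E \<Longrightarrow> (\<And>a a'. fm_rel (insert (a, a') E) (F a) (F' a')) \<Longrightarrow>
    fm_rel E (BExists b F) (BExists b' F')"
  unfolding BExists_def by (intro fm_rel_intros) auto

lemma fm_rel_IsUpair [fm_rel_intros]:
  "(x, x') \<in> E \<Longrightarrow> (y, y') \<in> E \<Longrightarrow> (z, z') \<in> E \<Longrightarrow> fm_rel E (IsUpair x y z) (IsUpair x' y' z')"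
  unfolding IsUpair_def by (intro fm_rel_intros) auto

lemma fm_rel_IsPair [fm_rel_intros]:
  "(x, x') \<in> E \<Longrightarrow> (y, y') \<in> E \<Longrightarrow> (z, z') \<in> E \<Longrightarrow> fm_rel E (IsPair x y z) (IsPair x' y' z')"
  unfolding IsPair_def by (intro fm_rel_intros) auto

lemma fm_rel_PairIn [fm_rel_intros]:
  "(x, x') \<in> E \<Longrightarrow> (y, y') \<in> E \<Longrightarrow> (z, z') \<in> E \<Longrightarrow> fm_rel E (PairIn x y z) (PairIn x' y' z')"
  unfolding PairIn_def by (intro fm_rel_intros) auto

lemma fm_rel_TripleIn [fm_rel_intros]:
  "(x, x') \<in> E \<Longrightarrow> (y, y') \<in> E \<Longrightarrow> (z, z') \<in> E \<Longrightarrow> (w, w') \<in> E \<Longrightarrow>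
    fm_rel E (TripleIn x y z w) (TripleIn x' y' z' w')"
  unfolding TripleIn_def by (intro fm_rel_intros) auto

lemma fm_rel_Trans [fm_rel_intros]: "(x, x') \<in> E \<Longrightarrow> fm_rel E (Trans x) (Trans x')"
  unfolding Trans_def by (intro fm_rel_intros) auto

lemma fm_rel_Ord [fm_rel_intros]: "(x, x') \<in> E \<Longrightarrow> fm_rel E (Ord x) (Ord x')"
  unfolding Ord_def by (intro fm_rel_intros) auto

lemma fm_rel_LimitOrd [fm_rel_intros]: "(x, x') \<in> E \<Longrightarrow> fm_rel E (LimitOrd x) (LimitOrd x')"
  unfolding LimitOrd_def by (intro fm_rel_intros) auto

lemma fm_rel_IsOmega [fm_rel_intros]: "(x, x') \<in> E \<Longrightarrow> fm_rel E (IsOmega x) (IsOmega x')"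
  unfolding IsOmega_def by (intro fm_rel_intros) auto

lemma fm_rel_CountableSetOfOrdinals:
  "(x, x') \<in> E \<Longrightarrow> fm_rel E (CountableSetOfOrdinals x) (CountableSetOfOrdinals x')"
  unfolding CountableSetOfOrdinals_def Countable_def by (intro fm_rel_intros) auto

lemma fm_rel_BelowForall [fm_rel_intros]:
  "(P, P') \<in> E \<Longrightarrow> (le, le') \<in> E \<Longrightarrow> (p, p') \<in> E \<Longrightarrow>
    (\<And>a a'. fm_rel (insert (a, a') E) (F a) (F' a')) \<Longrightarrow>
    fm_rel E (BelowForall P le p F) (BelowForall P' le' p' F')"
  unfolding BelowForall_def by (intro fm_rel_intros) auto

lemma fm_rel_BelowExists [fm_rel_intros]:
  "(P, P') \<in> E \<Longrightarrow> (le, le') \<in> E \<Longrightarrow> (p, p') \<in> E \<Longrightarrow>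
    (\<And>a a'. fm_rel (insert (a, a') E) (F a) (F' a')) \<Longrightarrow>
    fm_rel E (BelowExists P le p F) (BelowExists P' le' p' F')"
  unfolding BelowExists_def by (intro fm_rel_intros) auto

lemma fm_rel_DenseBelow [fm_rel_intros]:
  "(P, P') \<in> E \<Longrightarrow> (le, le') \<in> E \<Longrightarrow> (p, p') \<in> E \<Longrightarrow>
    (\<And>b b' a a'. fm_rel (insert (a, a') (insert (b, b') E)) (F a) (F' a')) \<Longrightarrow>
    fm_rel E (DenseBelow P le p F) (DenseBelow P' le' p' F')"
  unfolding DenseBelow_def by (intro fm_rel_intros) auto

lemma fm_rel_NameClosed [fm_rel_intros]:
  "(P, P') \<in> E \<Longrightarrow> (D, D') \<in> E \<Longrightarrow> fm_rel E (NameClosed P D) (NameClosed P' D')"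
  unfolding NameClosed_def by (intro fm_rel_intros) auto

lemma fm_rel_ForcesEqClause [fm_rel_intros]:
  "(P, P') \<in> E \<Longrightarrow> (le, le') \<in> E \<Longrightarrow> (K, K') \<in> E \<Longrightarrow> (p, p') \<in> E \<Longrightarrow> (x, x') \<in> E \<Longrightarrow> (y, y') \<in> E \<Longrightarrow>
    fm_rel E (ForcesEqClause P le K p x y) (ForcesEqClause P' le' K' p' x' y')"
  unfolding ForcesEqClause_def ForcesSubClause_def by (intro fm_rel_intros) auto

lemma fm_rel_ForcesEq [fm_rel_intros]:
  "(P, P') \<in> E \<Longrightarrow> (le, le') \<in> E \<Longrightarrow> (p, p') \<in> E \<Longrightarrow> (x, x') \<in> E \<Longrightarrow> (y, y') \<in> E \<Longrightarrow>
    fm_rel E (ForcesEq P le p x y) (ForcesEq P' le' p' x' y')"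
  unfolding ForcesEq_def by (intro fm_rel_intros) auto

lemma fm_rel_ForcesMem [fm_rel_intros]:
  "(P, P') \<in> E \<Longrightarrow> (le, le') \<in> E \<Longrightarrow> (p, p') \<in> E \<Longrightarrow> (x, x') \<in> E \<Longrightarrow> (y, y') \<in> E \<Longrightarrow>
    fm_rel E (ForcesMem P le p x y) (ForcesMem P' le' p' x' y')"
  unfolding ForcesMem_def by (intro fm_rel_intros) auto

lemma fm_rel_IsCheck [fm_rel_intros]:
  "(P, P') \<in> E \<Longrightarrow> (x, x') \<in> E \<Longrightarrow> (c, c') \<in> E \<Longrightarrow> fm_rel E (IsCheck P x c) (IsCheck P' x' c')"
  unfolding IsCheck_def by (intro fm_rel_intros) auto


context forcing
begin

lemma forces_cong:
  "fm_rel E \<phi> \<phi>' \<Longrightarrow> (\<And>a a'. (a, a') \<in> E \<Longrightarrow> p \<tturnstile> Eq a a') \<Longrightarrow> p \<tturnstile> \<phi> \<longleftrightarrow> p \<tturnstile> \<phi>'"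
proof (induction arbitrary: p rule: fm_rel.induct)
  case (fm_rel_Mem a a' E b b')
  then have "p \<tturnstile> Eq a a'" "p \<tturnstile> Eq b b'" by blast+
  then show ?case
    using forces_Eq_names forces_mem_cong
    by (cases "p \<in> elts P") (metis forces_Mem, simp add: forces_outside)
next
  case (fm_rel_Eq a a' E b b')
  then have "p \<tturnstile> Eq a a'" "p \<tturnstile> Eq b b'" by blast+
  then show ?case
    using forces_Eq_names forces_eq_cong
    by (cases "p \<in> elts P") (metis forces_Eq, simp add: forces_outside)
next
  case (fm_rel_Neg E \<phi> \<phi>')
  then show ?case using forces_mono unfolding forces_Neg by blast
next
  case (fm_rel_Conj E \<phi> \<phi>' \<psi> \<psi>')
  then show ?case by (simp add: forces_Conj)
next
  case (fm_rel_Forall E F F')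
  have "p \<tturnstile> F \<tau> \<longleftrightarrow> p \<tturnstile> F' \<tau>" if "is_name \<tau>" for \<tau>
    by (rule fm_rel_Forall.IH) (use that fm_rel_Forall.prems in \<open>auto simp: forces_Eq\<close>)
  then show ?case by (simp add: forces_Forall)
qed

definition uniform :: "('v \<Rightarrow> 'v fm) \<Rightarrow> bool" where
  "uniform F \<longleftrightarrow> (\<forall>a a'. fm_rel (insert (a, a') (Id_on (Collect is_name))) (F a) (F a'))"

lemma uniformI:
  "(\<And>a a'. fm_rel (insert (a, a') (Id_on (Collect is_name))) (F a) (F a')) \<Longrightarrow> uniform F"
  by (simp add: uniform_def)

lemma fm_rel_uniform:
  "uniform F \<Longrightarrow> insert (a, a') (Id_on (Collect is_name)) \<subseteq> E \<Longrightarrow> fm_rel E (F a) (F a')"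
  unfolding uniform_def using fm_rel_mono by blast

lemma uniform_cong:
  assumes "uniform F" "is_name x" "is_name y" "forces_eq p x y"
  shows "p \<tturnstile> F x \<longleftrightarrow> p \<tturnstile> F y"
proof (rule forces_cong)
  show "fm_rel (insert (x, y) (Id_on (Collect is_name))) (F x) (F y)"
    using assms(1) by (simp add: uniform_def)
qed (use assms(2-) in \<open>auto simp: forces_Eq\<close>)

definition uniform2 :: "('v \<Rightarrow> 'v \<Rightarrow> 'v fm) \<Rightarrow> bool" where
  "uniform2 F \<longleftrightarrow> (\<forall>a a' b b'.
    fm_rel (insert (b, b') (insert (a, a') (Id_on (Collect is_name)))) (F a b) (F a' b'))"

lemma uniform2I:
  "(\<And>a a' b b'. fm_rel (insert (b, b') (insert (a, a') (Id_on (Collect is_name))))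
    (F a b) (F a' b')) \<Longrightarrow> uniform2 F"
  by (simp add: uniform2_def)

lemma fm_rel_uniform2:
  "uniform2 F \<Longrightarrow> insert (b, b') (insert (a, a') (Id_on (Collect is_name))) \<subseteq> E \<Longrightarrow>
    fm_rel E (F a b) (F a' b')"
  unfolding uniform2_def using fm_rel_mono by blast

lemma uniform2_cong:
  assumes "uniform2 F" "is_name x" "is_name x'" "forces_eq p x x'"
    and "is_name y" "is_name y'" "forces_eq p y y'"
  shows "p \<tturnstile> F x y \<longleftrightarrow> p \<tturnstile> F x' y'"
proof (rule forces_cong)
  show "fm_rel (insert (y, y') (insert (x, x') (Id_on (Collect is_name)))) (F x y) (F x' y')"
    using assms(1) by (simp add: uniform2_def)
qed (use assms(2-) in \<open>auto simp: forces_Eq\<close>)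

lemma forces_BForall_elts:
  assumes "is_name a"
  shows "p \<tturnstile> BForall a F \<longleftrightarrow> (\<forall>\<pi> s q \<tau>. \<langle>\<pi>, s\<rangle> \<in> elts a \<longrightarrow> q \<preceq> p \<longrightarrow> q \<preceq> s \<longrightarrow>
    is_name \<tau> \<longrightarrow> forces_eq q \<pi> \<tau> \<longrightarrow> q \<tturnstile> F \<tau>)" (is "_ \<longleftrightarrow> ?elts")
proof
  assume "p \<tturnstile> BForall a F"
  then show ?elts
    using forces_BForallD[OF _ assms] forces_mem_elt forces_mem_cong_left by blast
next
  assume elts: ?elts
  show "p \<tturnstile> BForall a F"
    unfolding forces_BForall[OF assms]
  proof (intro allI impI)
    fix \<tau> q assume \<tau>: "is_name \<tau>" "q \<preceq> p" "forces_mem q \<tau> a"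
    show "q \<tturnstile> F \<tau>"
      using \<tau>(3)[unfolded forces_mem_def]
    proof (intro forces_densely, elim densely_mono exE conjE)
      fix r \<pi> s assume "r \<preceq> q" "\<langle>\<pi>, s\<rangle> \<in> elts a" "r \<preceq> s" "forces_eq r \<pi> \<tau>"
      then show "r \<tturnstile> F \<tau>" using elts \<tau>(1,2) below_trans by blast
    qed
  qed
qed

lemma forces_BForall_uniform:
  assumes "is_name a" "uniform F"
  shows "p \<tturnstile> BForall a F \<longleftrightarrow> (\<forall>\<pi> s q. \<langle>\<pi>, s\<rangle> \<in> elts a \<longrightarrow> q \<preceq> p \<longrightarrow> q \<preceq> s \<longrightarrow> q \<tturnstile> F \<pi>)"
  unfolding forces_BForall_elts[OF assms(1)]
  using uniform_cong[OF assms(2)] is_name_pairD(1)[OF assms(1)] forces_eq_refl by meson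

lemma forces_BExists_uniform:
  assumes "is_name a" "uniform F"
  shows "p \<tturnstile> BExists a F \<longleftrightarrow> densely p (\<lambda>r. \<exists>\<pi> s. \<langle>\<pi>, s\<rangle> \<in> elts a \<and> r \<preceq> s \<and> r \<tturnstile> F \<pi>)"
    (is "_ \<longleftrightarrow> densely p ?elt")
proof
  assume "p \<tturnstile> BExists a F"
  then show "densely p ?elt"
    unfolding forces_BExists[OF assms(1)]
  proof (rule densely_bind, elim exE conjE)
    fix r \<tau> assume r: "is_name \<tau>" "forces_mem r \<tau> a" "r \<tturnstile> F \<tau>"
    from r(2)[unfolded forces_mem_def] show "densely r ?elt"
    proof (elim densely_mono exE conjE)
      fix q \<pi> s assume q: "q \<preceq> r" "\<langle>\<pi>, s\<rangle> \<in> elts a" "q \<preceq> s" "forces_eq q \<pi> \<tau>"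
      then have "q \<tturnstile> F \<pi>"
        using uniform_cong[OF assms(2) is_name_pairD(1)[OF assms(1)]] r forces_mono by blast
      then show "?elt q" using q by blast
    qed
  qed
next
  assume "densely p ?elt"
  then show "p \<tturnstile> BExists a F"
    unfolding forces_BExists[OF assms(1)]
    using is_name_pairD(1)[OF assms(1)] forces_mem_elt by (elim densely_mono) blast
qed

lemma forces_Exists_one_point:
  assumes "uniform F" "is_name u"
    and G: "\<And>q \<tau>. q \<preceq> p \<Longrightarrow> is_name \<tau> \<Longrightarrow> q \<tturnstile> G \<tau> \<longleftrightarrow> forces_eq q \<tau> u \<and> q \<tturnstile> F \<tau>"
  shows "p \<tturnstile> Exists G \<longleftrightarrow> p \<tturnstile> F u"
proof
  assume "p \<tturnstile> Exists G"
  then show "p \<tturnstile> F u"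
    unfolding forces_Exists
  proof (intro forces_densely, elim densely_mono exE conjE)
    fix r \<tau> assume "r \<preceq> p" "is_name \<tau>" "r \<tturnstile> G \<tau>"
    then show "r \<tturnstile> F u" using G uniform_cong[OF assms(1) _ assms(2)] by blast
  qed
next
  assume "p \<tturnstile> F u"
  then show "p \<tturnstile> Exists G"
    unfolding forces_Exists using G assms(2) forces_mono by (intro densely_all) auto
qed


section \<open>Names for sets and pairs\<close>

text \<open>A name for the set of those \<^term>\<open>g i\<close> with \<^term>\<open>i \<in> I\<close> for which \<^term>\<open>A i p\<close> holds for
  some condition \<^term>\<open>p\<close> of the generic filter.\<close>

definition set_name :: "'i set \<Rightarrow> ('i \<Rightarrow> 'v) \<Rightarrow> ('i \<Rightarrow> 'v \<Rightarrow> bool) \<Rightarrow> 'v" where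
  "set_name I g A = vset {\<langle>g i, p\<rangle> |i p. i \<in> I \<and> p \<in> elts P \<and> A i p}"

lemma elts_set_name:
  assumes "small (g ` I)"
  shows "elts (set_name I g A) = {\<langle>g i, p\<rangle> |i p. i \<in> I \<and> p \<in> elts P \<and> A i p}"
  unfolding set_name_def
  by (rule elts_vset, rule small_subset[OF small_vpair_image[OF assms small_elts[of P]]]) auto

lemma is_name_set_name:
  "small (g ` I) \<Longrightarrow> (\<And>i. i \<in> I \<Longrightarrow> is_name (g i)) \<Longrightarrow> is_name (set_name I g A)"
  by (rule is_nameI) (auto simp: elts_set_name)

lemma forces_mem_set_name:
  assumes "small (g ` I)" and mono: "\<And>i p q. i \<in> I \<Longrightarrow> A i p \<Longrightarrow> q \<preceq> p \<Longrightarrow> A i q"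
  shows "forces_mem p \<tau> (set_name I g A) \<longleftrightarrow> densely p (\<lambda>r. \<exists>i\<in>I. A i r \<and> forces_eq r \<tau> (g i))"
  unfolding forces_mem_def
proof (rule densely_cong)
  fix r assume "r \<preceq> p"
  then have "r \<in> elts P" using below_cond by blast
  then show "(\<exists>\<pi> s. \<langle>\<pi>, s\<rangle> \<in> elts (set_name I g A) \<and> r \<preceq> s \<and> forces_eq r \<pi> \<tau>) \<longleftrightarrow>
      (\<exists>i\<in>I. A i r \<and> forces_eq r \<tau> (g i))"
    using mono
    by (simp add: elts_set_name[OF assms(1)] forces_eq_commute[of _ \<tau>]) (metis below_refl)
qed

definition family_name :: "'i set \<Rightarrow> ('i \<Rightarrow> 'v) \<Rightarrow> 'v" where
  "family_name I g = set_name I g (\<lambda>_ _. True)"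

lemma elts_family_name:
  "small (g ` I) \<Longrightarrow> elts (family_name I g) = {\<langle>g i, p\<rangle> |i p. i \<in> I \<and> p \<in> elts P}"
  by (simp add: family_name_def elts_set_name)

lemma vpair_mem_family_name:
  "small (g ` I) \<Longrightarrow> \<langle>\<pi>, p\<rangle> \<in> elts (family_name I g) \<longleftrightarrow> \<pi> \<in> g ` I \<and> p \<in> elts P"
  by (auto simp: elts_family_name)

lemma is_name_family_name:
  "small (g ` I) \<Longrightarrow> (\<And>i. i \<in> I \<Longrightarrow> is_name (g i)) \<Longrightarrow> is_name (family_name I g)"
  unfolding family_name_def by (rule is_name_set_name)

lemma forces_mem_family_name:
  "small (g ` I) \<Longrightarrow> forces_mem p \<tau> (family_name I g) \<longleftrightarrow> densely p (\<lambda>r. \<exists>i\<in>I. forces_eq r \<tau> (g i))"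
  unfolding family_name_def by (subst forces_mem_set_name) auto

lemma forces_mem_family_nameI: "small (g ` I) \<Longrightarrow> i \<in> I \<Longrightarrow> forces_mem p (g i) (family_name I g)"
  unfolding forces_mem_family_name by (rule densely_all) (metis forces_eq_refl)

lemma forces_BForall_family_name:
  assumes "small (g ` I)" "\<And>i. i \<in> I \<Longrightarrow> is_name (g i)" "uniform F"
  shows "p \<tturnstile> BForall (family_name I g) F \<longleftrightarrow> (\<forall>i\<in>I. p \<tturnstile> F (g i))"
proof -
  have name: "is_name (family_name I g)" using assms by (intro is_name_family_name)
  show ?thesis
  proof (intro iffI ballI)
    fix i assume all: "p \<tturnstile> BForall (family_name I g) F" and i: "i \<in> I"
    have "q \<tturnstile> F (g i)" if "q \<preceq> p" for q
      by (rule forces_BForallD[OF all name assms(2)[OF i] that forces_mem_family_nameI[OF assms(1) i]])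
    then show "p \<tturnstile> F (g i)" using forces_below_iff by blast
  next
    assume "\<forall>i\<in>I. p \<tturnstile> F (g i)"
    then show "p \<tturnstile> BForall (family_name I g) F"
      unfolding forces_BForall_uniform[OF name assms(3)] vpair_mem_family_name[OF assms(1)]
      using forces_mono by blast
  qed
qed

lemma forces_BExists_family_name:
  assumes "small (g ` I)" "\<And>i. i \<in> I \<Longrightarrow> is_name (g i)" "uniform F"
  shows "p \<tturnstile> BExists (family_name I g) F \<longleftrightarrow> densely p (\<lambda>r. \<exists>i\<in>I. r \<tturnstile> F (g i))"
proof -
  have name: "is_name (family_name I g)" using assms by (intro is_name_family_name)
  show ?thesis
  proof
    assume "p \<tturnstile> BExists (family_name I g) F"
    then show "densely p (\<lambda>r. \<exists>i\<in>I. r \<tturnstile> F (g i))"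
      unfolding forces_BExists_uniform[OF name assms(3)] vpair_mem_family_name[OF assms(1)]
      by (rule densely_mono) blast
  next
    assume "densely p (\<lambda>r. \<exists>i\<in>I. r \<tturnstile> F (g i))"
    then show "p \<tturnstile> BExists (family_name I g) F"
      unfolding forces_BExists[OF name]
    proof (elim densely_mono bexE)
      fix r i assume "i \<in> I" "r \<tturnstile> F (g i)"
      then show "\<exists>\<tau>. is_name \<tau> \<and> forces_mem r \<tau> (family_name I g) \<and> r \<tturnstile> F \<tau>"
        using assms(2) forces_mem_family_nameI[OF assms(1)] by (intro exI[of _ "g i"]) simp
    qed
  qed
qed

definition upair_name :: "'v \<Rightarrow> 'v \<Rightarrow> 'v" where
  "upair_name x y = family_name {x, y} id"

definition pair_name :: "'v \<Rightarrow> 'v \<Rightarrow> 'v" where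
  "pair_name x y = upair_name (upair_name x x) (upair_name x y)"

definition triple_name :: "'v \<Rightarrow> 'v \<Rightarrow> 'v \<Rightarrow> 'v" where
  "triple_name x y z = pair_name x (pair_name y z)"

lemma elts_upair_name: "elts (upair_name x y) = {\<langle>z, p\<rangle> |z p. z \<in> {x, y} \<and> p \<in> elts P}"
  by (simp add: upair_name_def elts_family_name)

lemma is_name_upair_name [simp]: "is_name x \<Longrightarrow> is_name y \<Longrightarrow> is_name (upair_name x y)"
  unfolding upair_name_def by (rule is_name_family_name) auto

lemma is_name_pair_name [simp]: "is_name x \<Longrightarrow> is_name y \<Longrightarrow> is_name (pair_name x y)"
  by (simp add: pair_name_def)

lemma is_name_triple_name [simp]:
  "is_name x \<Longrightarrow> is_name y \<Longrightarrow> is_name z \<Longrightarrow> is_name (triple_name x y z)"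
  by (simp add: triple_name_def)

lemma forces_mem_upair_name:
  "forces_mem p z (upair_name x y) \<longleftrightarrow> densely p (\<lambda>r. forces_eq r z x \<or> forces_eq r z y)"
  by (simp add: upair_name_def forces_mem_family_name)

lemma forces_mem_singleton_name: "forces_mem p z (upair_name x x) \<longleftrightarrow> forces_eq p z x"
  by (simp add: forces_mem_upair_name)

lemma forces_mem_upair_name_left [simp]: "forces_mem p x (upair_name x y)"
  and forces_mem_upair_name_right [simp]: "forces_mem p y (upair_name x y)"
  by (auto simp: forces_mem_upair_name intro: densely_all)

lemma upair_name_cong:
  assumes "forces_eq p x x'" "forces_eq p y y'"
  shows "forces_eq p (upair_name x y) (upair_name x' y')"
proof -
  have "forces_mem q z (upair_name x' y')"
    if eq: "forces_eq p x x'" "forces_eq p y y'" and z: "q \<preceq> p" "\<langle>z, s\<rangle> \<in> elts (upair_name x y)"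
    for x y x' y' q z s
  proof -
    have "z = x \<or> z = y" using z(2) by (auto simp: elts_upair_name)
    moreover have "forces_eq q x' x" "forces_eq q y' y"
      using eq z(1) forces_eq_mono forces_eq_sym by blast+
    ultimately show ?thesis
      using forces_mem_cong_left forces_mem_upair_name_left forces_mem_upair_name_right by blast
  qed
  then show ?thesis
    unfolding forces_eq_iff[of p "upair_name x y"] using assms forces_eq_sym by blast
qed

lemma pair_name_cong:
  "forces_eq p x x' \<Longrightarrow> forces_eq p y y' \<Longrightarrow> forces_eq p (pair_name x y) (pair_name x' y')"
  unfolding pair_name_def by (intro upair_name_cong)

lemma singleton_name_eq_upair_nameD:
  assumes "forces_eq p (upair_name x x) (upair_name x' y')"
  shows "forces_eq p x x'"
proof -
  have "forces_mem p x' (upair_name x x)"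
    using forces_mem_cong_right[OF forces_eq_sym[OF assms]] by simp
  then show ?thesis using forces_eq_sym unfolding forces_mem_singleton_name by blast
qed

lemma pair_name_eq_fstD:
  assumes "forces_eq p (pair_name x y) (pair_name x' y')"
  shows "forces_eq p x x'"
proof -
  have "forces_mem p (upair_name x x) (pair_name x' y')"
    using assms forces_mem_cong_right forces_mem_upair_name_left unfolding pair_name_def by blast
  then have "densely p (\<lambda>r. forces_eq r x x')"
    unfolding pair_name_def forces_mem_upair_name
    by (elim densely_mono) (auto dest: singleton_name_eq_upair_nameD)
  then show ?thesis by simp
qed

lemma pair_name_eq_snd_cases:
  assumes "forces_eq p (pair_name x y) (pair_name x' y')"
  shows "densely p (\<lambda>r. forces_eq r y y' \<or> forces_eq r y x)"
proof -
  have "forces_mem p (upair_name x y) (pair_name x' y')"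
    using assms forces_mem_cong_right forces_mem_upair_name_right unfolding pair_name_def by blast
  then have "densely p (\<lambda>r. forces_eq r (upair_name x y) (upair_name x' x') \<or>
      forces_eq r (upair_name x y) (upair_name x' y'))"
    unfolding pair_name_def forces_mem_upair_name .
  then have "densely p (\<lambda>r. forces_mem r y (upair_name x' y'))"
  proof (rule densely_mono)
    fix r assume "forces_eq r (upair_name x y) (upair_name x' x') \<or>
      forces_eq r (upair_name x y) (upair_name x' y')"
    then have "forces_mem r y (upair_name x' x') \<or> forces_mem r y (upair_name x' y')"
      using forces_mem_cong_right forces_mem_upair_name_right by blast
    then show "forces_mem r y (upair_name x' y')"
      using forces_mem_singleton_name forces_mem_upair_name_left forces_mem_cong_left forces_eq_sym
      by meson
  qed
  then have "densely p (\<lambda>r. forces_eq r y x' \<or> forces_eq r y y')"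
    unfolding forces_mem_upair_name by (rule densely_densely)
  then show ?thesis
    by (rule densely_mono)
      (meson pair_name_eq_fstD[OF assms] forces_eq_mono forces_eq_sym forces_eq_trans)
qed

lemma pair_name_eq_sndD:
  assumes "forces_eq p (pair_name x y) (pair_name x' y')"
  shows "forces_eq p y y'"
proof -
  have fst: "forces_eq p x x'" by (rule pair_name_eq_fstD[OF assms])
  have "densely p (\<lambda>r. forces_eq r y y')"
    using pair_name_eq_snd_cases[OF assms]
  proof (rule densely_bind)
    fix r assume r: "r \<preceq> p" "forces_eq r y y' \<or> forces_eq r y x"
    have "densely r (\<lambda>r. forces_eq r y' y \<or> forces_eq r y' x')"
      using pair_name_eq_snd_cases[OF forces_eq_sym[OF assms]] r(1) by (rule densely_below)
    then show "densely r (\<lambda>r. forces_eq r y y')"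
      by (rule densely_mono) (meson r fst forces_eq_mono forces_eq_sym forces_eq_trans below_trans)
  qed
  then show ?thesis by simp
qed

lemma triple_name_eqD:
  assumes "forces_eq p (triple_name x y z) (triple_name x' y' z')"
  shows "forces_eq p x x'" "forces_eq p y y'" "forces_eq p z z'"
  using assms pair_name_eq_fstD pair_name_eq_sndD unfolding triple_name_def by blast+

lemma densely_ex_component_of_pair_name:
  assumes "is_name z" "forces_eq p z (pair_name x y)"
  shows "densely p (\<lambda>r. \<exists>\<rho>\<in>trcl z. is_name \<rho> \<and> forces_eq r \<rho> x)"
proof -
  have "forces_mem p (upair_name x x) z"
    using forces_mem_cong_right[OF forces_eq_sym[OF assms(2)]] by (simp add: pair_name_def)
  then show ?thesis
    unfolding forces_mem_def
  proof (rule densely_bind, elim exE conjE)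
    fix q y s assume y: "\<langle>y, s\<rangle> \<in> elts z" "forces_eq q y (upair_name x x)"
    have "forces_mem q x y" using forces_mem_cong_right[OF forces_eq_sym[OF y(2)]] by simp
    then show "densely q (\<lambda>r. \<exists>\<rho>\<in>trcl z. is_name \<rho> \<and> forces_eq r \<rho> x)"
      unfolding forces_mem_def
    proof (elim densely_mono exE conjE)
      fix r \<rho> t assume "\<langle>\<rho>, t\<rangle> \<in> elts y" "forces_eq r \<rho> x"
      moreover from this have "\<rho> \<in> trcl z" "is_name \<rho>"
        using vpair_mem_trcl(1) y(1) trcl_trans is_name_pairD(1) assms(1) by metis+
      ultimately show "\<exists>\<rho>\<in>trcl z. is_name \<rho> \<and> forces_eq r \<rho> x" by blast
    qed
  qed
qed

lemma forces_IsUpair: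
  assumes "is_name x" "is_name y" "is_name z"
  shows "p \<tturnstile> IsUpair x y z \<longleftrightarrow> forces_eq p z (upair_name x y)"
proof -
  have "q \<tturnstile> Disj (Eq w x) (Eq w y) \<longleftrightarrow> forces_mem q w (upair_name x y)" if "is_name w" for w q
    using that assms by (simp add: forces_Disj forces_mem_upair_name forces_Eq)
  then have "p \<tturnstile> IsUpair x y z \<longleftrightarrow> (\<forall>w. is_name w \<longrightarrow> (\<forall>q. q \<preceq> p \<longrightarrow>
      (forces_mem q w z \<longleftrightarrow> forces_mem q w (upair_name x y))))"
    using assms by (simp add: IsUpair_def forces_Forall forces_Iff forces_Mem)
  also have "\<dots> \<longleftrightarrow> forces_eq p z (upair_name x y)"
    using forces_eq_extensional[of z "upair_name x y" p] assms forces_eq_mono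
      forces_mem_cong[OF forces_eq_refl] by (metis is_name_upair_name)
  finally show ?thesis .
qed

lemma forces_IsPair:
  assumes "is_name x" "is_name y" "is_name z"
  shows "p \<tturnstile> IsPair x y z \<longleftrightarrow> forces_eq p z (pair_name x y)"
proof -
  have "q \<tturnstile> Exists (\<lambda>b. Conj (IsUpair x x a) (Conj (IsUpair x y b) (IsUpair a b z))) \<longleftrightarrow>
      forces_eq q a (upair_name x x) \<and> q \<tturnstile> IsUpair a (upair_name x y) z" if "is_name a" for q a
  proof -
    have "q \<tturnstile> Exists (\<lambda>b. Conj (IsUpair x x a) (Conj (IsUpair x y b) (IsUpair a b z))) \<longleftrightarrow>
        q \<tturnstile> Conj (IsUpair x x a) (IsUpair a (upair_name x y) z)"
      by (rule forces_Exists_one_point[where u = "upair_name x y"])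
        (use assms that in \<open>auto intro!: uniformI fm_rel_intros simp: forces_Conj forces_IsUpair\<close>)
    then show ?thesis using assms that by (simp add: forces_Conj forces_IsUpair)
  qed
  then have "p \<tturnstile> IsPair x y z \<longleftrightarrow> p \<tturnstile> IsUpair (upair_name x x) (upair_name x y) z"
    unfolding IsPair_def
    by (intro forces_Exists_one_point[where u = "upair_name x x"])
      (use assms in \<open>auto intro!: uniformI fm_rel_intros\<close>)
  then show ?thesis using assms by (simp add: forces_IsUpair pair_name_def)
qed

lemma forces_PairIn:
  assumes "is_name x" "is_name y" "is_name z"
  shows "p \<tturnstile> PairIn x y z \<longleftrightarrow> forces_mem p (pair_name x y) z"
proof -
  have "p \<tturnstile> PairIn x y z \<longleftrightarrow> p \<tturnstile> Mem (pair_name x y) z"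
    unfolding PairIn_def
    by (rule forces_Exists_one_point[where u = "pair_name x y"])
      (use assms in \<open>auto intro!: uniformI fm_rel_intros simp: forces_Conj forces_IsPair\<close>)
  then show ?thesis using assms by (simp add: forces_Mem)
qed

lemma forces_TripleIn:
  assumes "is_name x" "is_name y" "is_name z" "is_name w"
  shows "p \<tturnstile> TripleIn x y z w \<longleftrightarrow> forces_mem p (triple_name x y z) w"
proof -
  have "p \<tturnstile> TripleIn x y z w \<longleftrightarrow> p \<tturnstile> PairIn x (pair_name y z) w"
    unfolding TripleIn_def
    by (rule forces_Exists_one_point[where u = "pair_name y z"])
      (use assms in \<open>auto intro!: uniformI fm_rel_intros simp: forces_Conj forces_IsPair\<close>)
  then show ?thesis using assms by (simp add: forces_PairIn triple_name_def)
qed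

end


section \<open>Canonical names\<close>

context forcing
begin

lemma check_eq_family_name: "check P x = family_name (elts x) (check P)"
  by (rule extensionality) (simp add: elts_check elts_family_name small_image)

lemma is_name_check [simp]: "is_name (check P x)"
  by (induction x rule: elts_induct) (auto intro!: is_nameI simp: elts_check)

lemma forces_mem_check:
  "forces_mem p \<tau> (check P x) \<longleftrightarrow> densely p (\<lambda>r. \<exists>y\<in>elts x. forces_eq r \<tau> (check P y))"
  unfolding check_eq_family_name[of x] by (rule forces_mem_family_name) auto

lemma forces_mem_checkI: "y \<in> elts x \<Longrightarrow> forces_mem p (check P y) (check P x)"
  unfolding check_eq_family_name[of x] by (rule forces_mem_family_nameI) auto

lemma forces_BForall_check_elts:
  "p \<tturnstile> BForall (check P x) F \<longleftrightarrow>
    (\<forall>y\<in>elts x. \<forall>q \<tau>. q \<preceq> p \<longrightarrow> is_name \<tau> \<longrightarrow> forces_eq q \<tau> (check P y) \<longrightarrow> q \<tturnstile> F \<tau>)"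
  unfolding forces_BForall_elts[OF is_name_check]
proof (intro iffI ballI allI impI)
  fix y q \<tau>
  assume "\<forall>\<pi> s q \<tau>. \<langle>\<pi>, s\<rangle> \<in> elts (check P x) \<longrightarrow> q \<preceq> p \<longrightarrow> q \<preceq> s \<longrightarrow> is_name \<tau> \<longrightarrow>
      forces_eq q \<pi> \<tau> \<longrightarrow> q \<tturnstile> F \<tau>"
    and "y \<in> elts x" "q \<preceq> p" "is_name \<tau>" "forces_eq q \<tau> (check P y)"
  moreover from this have "\<langle>check P y, q\<rangle> \<in> elts (check P x)" "q \<preceq> q"
    using below_cond(1) by (auto simp: elts_check)
  ultimately show "q \<tturnstile> F \<tau>" using forces_eq_sym by blast
next
  fix \<pi> s q \<tau>
  assume "\<forall>y\<in>elts x. \<forall>q \<tau>. q \<preceq> p \<longrightarrow> is_name \<tau> \<longrightarrow> forces_eq q \<tau> (check P y) \<longrightarrow> q \<tturnstile> F \<tau>"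
    and "\<langle>\<pi>, s\<rangle> \<in> elts (check P x)" "q \<preceq> p" "is_name \<tau>" "forces_eq q \<pi> \<tau>"
  then show "q \<tturnstile> F \<tau>" using forces_eq_sym by (auto simp: elts_check)
qed

lemma forces_BForall_check:
  "uniform F \<Longrightarrow> p \<tturnstile> BForall (check P x) F \<longleftrightarrow> (\<forall>y\<in>elts x. p \<tturnstile> F (check P y))"
  unfolding check_eq_family_name[of x] by (rule forces_BForall_family_name) auto

lemma forces_BExists_check:
  "uniform F \<Longrightarrow> p \<tturnstile> BExists (check P x) F \<longleftrightarrow> densely p (\<lambda>r. \<exists>y\<in>elts x. r \<tturnstile> F (check P y))"
  unfolding check_eq_family_name[of x] by (rule forces_BExists_family_name) auto

lemma forces_eq_check_iff: "p \<in> elts P \<Longrightarrow> forces_eq p (check P x) (check P y) \<longleftrightarrow> x = y"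
proof (induction x arbitrary: p y rule: elts_induct)
  case (step x)
  show ?case
  proof
    assume eq: "forces_eq p (check P x) (check P y)"
    have "z \<in> elts y" if z: "z \<in> elts x" for z
    proof -
      have "forces_mem p (check P z) (check P y)"
        using forces_mem_cong_right[OF eq] forces_mem_checkI[OF z] by blast
      then obtain r u where "r \<preceq> p" "u \<in> elts y" "forces_eq r (check P z) (check P u)"
        unfolding forces_mem_check using densely_ex step.prems by blast
      then show ?thesis using step.IH[OF z] below_cond by metis
    qed
    moreover have "z \<in> elts x" if z: "z \<in> elts y" for z
    proof -
      have "forces_mem p (check P z) (check P x)"
        using forces_mem_cong_right[OF forces_eq_sym[OF eq]] forces_mem_checkI[OF z] by blast
      then obtain r u where "r \<preceq> p" "u \<in> elts x" "forces_eq r (check P z) (check P u)"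
        unfolding forces_mem_check using densely_ex step.prems by blast
      then show ?thesis using step.IH[of u r z] below_cond forces_eq_sym by metis
    qed
    ultimately show "x = y" using extensionality by blast
  qed simp
qed

lemma forces_mem_check_iff: "p \<in> elts P \<Longrightarrow> forces_mem p (check P x) (check P y) \<longleftrightarrow> x \<in> elts y"
proof
  assume "p \<in> elts P" "forces_mem p (check P x) (check P y)"
  then obtain r u where "r \<preceq> p" "u \<in> elts y" "forces_eq r (check P x) (check P u)"
    unfolding forces_mem_check using densely_ex by blast
  then show "x \<in> elts y" using forces_eq_check_iff below_cond by metis
qed (rule forces_mem_checkI)

lemma upair_name_check: "upair_name (check P x) (check P y) = check P (vset {x, y})"
  by (rule extensionality) (auto simp: elts_upair_name elts_check)

lemma pair_name_check: "pair_name (check P x) (check P y) = check P \<langle>x, y\<rangle>"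
  by (simp add: pair_name_def upair_name_check vpair_def)

lemma small_check_values:
  assumes "small A"
  shows "small {x. \<exists>\<pi>\<in>A. \<exists>r\<in>elts P. forces_eq r \<pi> (check P x)}"
proof (rule small_subset)
  show "small {(THE x. forces_eq r \<pi> (check P x)) |\<pi> r. \<pi> \<in> A \<and> r \<in> elts P}"
    using assms by (intro small_image2) auto
  show "{x. \<exists>\<pi>\<in>A. \<exists>r\<in>elts P. forces_eq r \<pi> (check P x)} \<subseteq>
      {(THE x. forces_eq r \<pi> (check P x)) |\<pi> r. \<pi> \<in> A \<and> r \<in> elts P}"
  proof clarify
    fix x \<pi> r assume x: "\<pi> \<in> A" "r \<in> elts P" "forces_eq r \<pi> (check P x)"
    then have "(THE x. forces_eq r \<pi> (check P x)) = x"
      by (intro the_equality)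
        (auto dest: forces_eq_sym forces_eq_trans simp: forces_eq_check_iff[symmetric, of r])
    with x show "\<exists>\<pi>' r'. x = (THE x. forces_eq r' \<pi>' (check P x)) \<and> \<pi>' \<in> A \<and> r' \<in> elts P" by metis
  qed
qed

definition possible_elements :: "'v \<Rightarrow> 'v set" where
  "possible_elements \<tau> = {x. \<exists>p\<in>elts P. forces_mem p (check P x) \<tau>}"

lemma small_possible_elements: "small (possible_elements \<tau>)"
proof (rule small_subset[OF small_check_values[OF small_trcl[of \<tau>]]])
  show "possible_elements \<tau> \<subseteq> {x. \<exists>\<pi>\<in>trcl \<tau>. \<exists>r\<in>elts P. forces_eq r \<pi> (check P x)}"
  proof
    fix x assume "x \<in> possible_elements \<tau>"
    then obtain p where "p \<in> elts P" "forces_mem p (check P x) \<tau>"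
      by (auto simp: possible_elements_def)
    then obtain r \<pi> s where "r \<preceq> p" "\<langle>\<pi>, s\<rangle> \<in> elts \<tau>" "forces_eq r \<pi> (check P x)"
      unfolding forces_mem_def using densely_ex by blast
    then show "x \<in> {x. \<exists>\<pi>\<in>trcl \<tau>. \<exists>r\<in>elts P. forces_eq r \<pi> (check P x)}"
      using vpair_mem_trcl below_cond by blast
  qed
qed


section \<open>Forced countable sets of ordinals\<close>

lemma forces_Trans_check:
  assumes "transitive x"
  shows "p \<tturnstile> Trans (check P x)"
proof -
  have "p \<tturnstile> BForall (check P y) (\<lambda>z. Mem z (check P x))" if "y \<in> elts x" for y
    using that assms
    by (subst forces_BForall_check)
      (auto intro!: uniformI fm_rel_intros forces_mem_checkI simp: forces_Mem transitive_def)
  then show ?thesis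
    unfolding Trans_def
    by (subst forces_BForall_check) (auto intro!: uniformI fm_rel_intros)
qed

lemma forces_Ord_check:
  assumes "ordinal x"
  shows "p \<tturnstile> Ord (check P x)"
proof -
  have "p \<tturnstile> BForall (check P x) Trans"
    using assms by (subst forces_BForall_check)
      (auto intro!: uniformI fm_rel_intros forces_Trans_check simp: ordinal_def)
  then show ?thesis using assms by (simp add: Ord_def forces_Conj forces_Trans_check ordinal_def)
qed

lemma forces_LimitOrd_omega: "p \<tturnstile> LimitOrd (check P omega)"
proof -
  have num_mem_omega: "num n \<in> elts omega" for n by (simp add: elts_omega)
  have "p \<tturnstile> Exists (\<lambda>y. Mem y (check P omega))"
    using forces_mem_checkI[OF num_mem_omega] by (intro forces_ExistsI[of "check P (num 0)"])
      (auto simp: forces_Mem simp del: num.simps)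
  moreover have "p \<tturnstile> BExists (check P omega) (Mem (check P (num n)))" for n
    using forces_mem_checkI[OF num_mem_omega[of "Suc n"]] forces_mem_checkI[OF num_mem[of n "Suc n"]]
    by (intro forces_BExistsI) (auto simp: forces_Mem simp del: num.simps)
  then have "p \<tturnstile> BForall (check P omega) (\<lambda>y. BExists (check P omega) (Mem y))"
    by (subst forces_BForall_check) (auto intro!: uniformI fm_rel_intros simp: elts_omega)
  ultimately show ?thesis
    by (simp add: LimitOrd_def forces_Conj forces_Ord_check ordinal_omega)
qed

lemma forces_TransD:
  assumes "p \<tturnstile> Trans x" "is_name x" "is_name y" "is_name z" "q \<preceq> p"
    and "forces_mem q y x" "forces_mem q z y"
  shows "forces_mem q z x"
proof -
  have "q \<tturnstile> BForall y (\<lambda>z. Mem z x)"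
    using forces_BForallD[OF assms(1)[unfolded Trans_def] assms(2,3,5,6)] .
  then have "q \<tturnstile> Mem z x"
    using forces_BForallD assms below_cond below_refl by blast
  then show ?thesis using assms by (simp add: forces_Mem)
qed

lemma forces_Ord_elt:
  assumes "p \<tturnstile> Ord x" "is_name x" "is_name y" "q \<preceq> p" "forces_mem q y x"
  shows "q \<tturnstile> Ord y"
proof -
  have x: "p \<tturnstile> Trans x" "p \<tturnstile> BForall x Trans" using assms(1) by (auto simp: Ord_def forces_Conj)
  have "q \<tturnstile> BForall y Trans"
    unfolding forces_BForall[OF assms(3)]
  proof (intro allI impI)
    fix z r assume z: "is_name z" "r \<preceq> q" "forces_mem r z y"
    have r: "r \<preceq> p" "forces_mem r y x" using z(2) assms below_trans forces_mem_mono by blast+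
    have "forces_mem r z x" by (rule forces_TransD[OF x(1) assms(2,3) z(1) r z(3)])
    then show "r \<tturnstile> Trans z" by (rule forces_BForallD[OF x(2) assms(2) z(1) r(1)])
  qed
  moreover have "q \<tturnstile> Trans y" by (rule forces_BForallD[OF x(2) assms(2-5)])
  ultimately show ?thesis by (simp add: Ord_def forces_Conj)
qed

lemma forces_eq_check_ordinalI:
  assumes \<tau>: "is_name \<tau>" "p \<tturnstile> Trans \<tau>" and \<delta>: "ordinal \<delta>"
    and elt: "\<And>\<pi> q. is_name \<pi> \<Longrightarrow> q \<preceq> p \<Longrightarrow> forces_mem q \<pi> \<tau> \<Longrightarrow>
      densely q (\<lambda>r. \<exists>\<beta>. ordinal \<beta> \<and> forces_eq r \<pi> (check P \<beta>))"
    and below: "\<And>\<beta>. \<beta> \<in> elts \<delta> \<Longrightarrow> forces_mem p (check P \<beta>) \<tau>"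
    and notin: "\<And>q. q \<preceq> p \<Longrightarrow> \<not> forces_mem q (check P \<delta>) \<tau>"
  shows "forces_eq p \<tau> (check P \<delta>)"
proof (rule forces_eq_extensional[OF \<tau>(1) is_name_check])
  fix \<pi> q assume \<pi>: "is_name \<pi>" "q \<preceq> p"
  show "forces_mem q \<pi> \<tau> \<longleftrightarrow> forces_mem q \<pi> (check P \<delta>)"
  proof
    assume mem: "forces_mem q \<pi> \<tau>"
    show "forces_mem q \<pi> (check P \<delta>)"
      unfolding forces_mem_check using elt[OF \<pi> mem]
    proof (elim densely_mono exE conjE)
      fix r \<beta> assume r: "r \<preceq> q" "ordinal \<beta>" "forces_eq r \<pi> (check P \<beta>)"
      have "r \<preceq> p" using r(1) \<pi>(2) by (rule below_trans)
      have mem_r: "forces_mem r (check P \<beta>) \<tau>"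
        using forces_mem_cong_left[OF r(3) forces_mem_mono[OF mem r(1)]] .
      then have "\<beta> \<noteq> \<delta>" using notin[OF \<open>r \<preceq> p\<close>] by blast
      moreover have "\<delta> \<notin> elts \<beta>"
        using forces_TransD[OF \<tau>(2,1) is_name_check is_name_check \<open>r \<preceq> p\<close> mem_r forces_mem_checkI]
          notin[OF \<open>r \<preceq> p\<close>] by blast
      ultimately have "\<beta> \<in> elts \<delta>" using ordinal_linear[OF r(2) \<delta>] by blast
      with r(3) show "\<exists>y\<in>elts \<delta>. forces_eq r \<pi> (check P y)" by blast
    qed
  next
    assume "forces_mem q \<pi> (check P \<delta>)"
    then have "densely q (\<lambda>r. forces_mem r \<pi> \<tau>)"
      unfolding forces_mem_check
    proof (elim densely_mono bexE)
      fix r \<beta> assume r: "r \<preceq> q" "\<beta> \<in> elts \<delta>" "forces_eq r \<pi> (check P \<beta>)"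
      have "forces_mem r (check P \<beta>) \<tau>"
        using forces_mem_mono[OF below[OF r(2)]] below_trans[OF r(1) \<pi>(2)] by blast
      then show "forces_mem r \<pi> \<tau>" using forces_mem_cong_left[OF forces_eq_sym[OF r(3)]] by blast
    qed
    then show "forces_mem q \<pi> \<tau>" by simp
  qed
qed

lemma densely_check_elt:
  assumes elts: "\<And>\<pi> s r. \<langle>\<pi>, s\<rangle> \<in> elts \<tau> \<Longrightarrow> r \<preceq> p \<Longrightarrow> r \<preceq> s \<Longrightarrow>
    densely r (\<lambda>r. \<exists>\<beta>. \<Phi> \<beta> \<and> forces_eq r \<pi> (check P \<beta>))"
    and "forces_mem p \<pi> \<tau>"
  shows "densely p (\<lambda>r. \<exists>\<beta>. \<Phi> \<beta> \<and> forces_eq r \<pi> (check P \<beta>))"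
  using assms(2) unfolding forces_mem_def
proof (rule densely_bind, elim exE conjE)
  fix r \<pi>' s assume r: "r \<preceq> p" "\<langle>\<pi>', s\<rangle> \<in> elts \<tau>" "r \<preceq> s" "forces_eq r \<pi>' \<pi>"
  from elts[OF r(2,1,3)] show "densely r (\<lambda>r. \<exists>\<beta>. \<Phi> \<beta> \<and> forces_eq r \<pi> (check P \<beta>))"
    by (rule densely_mono) (meson r(4) forces_eq_mono forces_eq_sym forces_eq_trans)
qed

lemma ex_least_excluded_ordinal:
  assumes q: "q \<in> elts P"
  shows "\<exists>\<delta> r. ordinal \<delta> \<and> r \<preceq> q \<and> (\<forall>\<beta>\<in>elts \<delta>. forces_mem q (check P \<beta>) \<tau>) \<and>
    (\<forall>r'. r' \<preceq> r \<longrightarrow> \<not> forces_mem r' (check P \<delta>) \<tau>)"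
proof -
  define excluded where
    "excluded \<delta> \<longleftrightarrow> ordinal \<delta> \<and> (\<exists>r. r \<preceq> q \<and> (\<forall>r'. r' \<preceq> r \<longrightarrow> \<not> forces_mem r' (check P \<delta>) \<tau>))" for \<delta>
  obtain \<gamma> where "ordinal \<gamma>" "\<gamma> \<notin> possible_elements \<tau>"
    using ex_ordinal_notin[OF small_possible_elements] by blast
  then have "excluded \<gamma>"
    using below_refl[OF q] below_cond unfolding excluded_def possible_elements_def by blast
  from ex_elts_minimal[of excluded, OF this]
  obtain \<delta> where \<delta>: "excluded \<delta>" and minimal: "\<forall>\<beta>\<in>elts \<delta>. \<not> excluded \<beta>" by blast
  have "forces_mem q (check P \<beta>) \<tau>" if "\<beta> \<in> elts \<delta>" for \<beta>
  proof -
    have "\<not> excluded \<beta>" "ordinal \<beta>"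
      using that minimal \<delta> ordinal_elt unfolding excluded_def by blast+
    then have "densely q (\<lambda>r. forces_mem r (check P \<beta>) \<tau>)"
      unfolding excluded_def by (intro denselyI) blast
    then show ?thesis by simp
  qed
  then show ?thesis using \<delta> unfolding excluded_def by blast
qed

lemma forces_Ord_densely_check:
  "is_name \<tau> \<Longrightarrow> p \<tturnstile> Ord \<tau> \<Longrightarrow> densely p (\<lambda>r. \<exists>\<alpha>. ordinal \<alpha> \<and> forces_eq r \<tau> (check P \<alpha>))"
proof (induction \<tau> arbitrary: p rule: trcl_induct)
  case (step \<tau>)
  have elt: "densely q (\<lambda>r. \<exists>\<beta>. ordinal \<beta> \<and> forces_eq r \<pi> (check P \<beta>))"
    if q: "q \<preceq> p" and \<pi>: "forces_mem q \<pi> \<tau>" for \<pi> q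
  proof (rule densely_check_elt[OF _ \<pi>])
    fix \<pi>' s r assume \<pi>': "\<langle>\<pi>', s\<rangle> \<in> elts \<tau>" and r: "r \<preceq> q" "r \<preceq> s"
    note name = is_name_pairD(1)[OF step.prems(1) \<pi>']
    have "r \<tturnstile> Ord \<pi>'"
      using forces_Ord_elt[OF step.prems(2,1) name below_trans[OF r(1) q]]
        forces_mem_elt[OF \<pi>' r(2)] .
    then show "densely r (\<lambda>r. \<exists>\<beta>. ordinal \<beta> \<and> forces_eq r \<pi>' (check P \<beta>))"
      by (rule step.IH[OF vpair_mem_trcl(1)[OF \<pi>'] name])
  qed
  show ?case
  proof (rule denselyI)
    fix q assume q: "q \<preceq> p"
    obtain \<delta> r where \<delta>: "ordinal \<delta>" and r: "r \<preceq> q"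
      and below: "\<forall>\<beta>\<in>elts \<delta>. forces_mem q (check P \<beta>) \<tau>"
      and notin: "\<forall>r'. r' \<preceq> r \<longrightarrow> \<not> forces_mem r' (check P \<delta>) \<tau>"
      using ex_least_excluded_ordinal[OF below_cond(1)[OF q]] by blast
    have "r \<preceq> p" using r q by (rule below_trans)
    have "forces_eq r \<tau> (check P \<delta>)"
    proof (rule forces_eq_check_ordinalI[OF step.prems(1) _ \<delta>])
      show "r \<tturnstile> Trans \<tau>"
        using forces_mono[OF step.prems(2) \<open>r \<preceq> p\<close>] by (simp add: Ord_def forces_Conj)
      show "forces_mem r (check P \<beta>) \<tau>" if "\<beta> \<in> elts \<delta>" for \<beta>
        using that below forces_mem_mono[OF _ r] by blast
      show "densely q' (\<lambda>r. \<exists>\<beta>. ordinal \<beta> \<and> forces_eq r \<pi> (check P \<beta>))"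
        if "q' \<preceq> r" "forces_mem q' \<pi> \<tau>" for \<pi> q'
        using elt[OF below_trans[OF that(1) \<open>r \<preceq> p\<close>] that(2)] .
    qed (use notin in blast)
    then show "\<exists>r. r \<preceq> q \<and> (\<exists>\<alpha>. ordinal \<alpha> \<and> forces_eq r \<tau> (check P \<alpha>))" using r \<delta> by blast
  qed
qed

lemma forces_IsOmega_elt:
  assumes "p \<tturnstile> IsOmega w" "is_name w" "forces_mem p n w"
  shows "densely p (\<lambda>r. \<exists>k. forces_eq r n (check P (num k)))"
proof -
  have w: "p \<tturnstile> Ord w" "p \<tturnstile> BForall w (\<lambda>y. Neg (LimitOrd y))"
    using assms(1) by (auto simp: IsOmega_def LimitOrd_def forces_Conj)
  show ?thesis
    using forces_Ord_densely_check[OF assms(2) w(1)]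
  proof (rule densely_bind, elim exE conjE)
    fix r \<alpha> assume r: "r \<preceq> p" "ordinal \<alpha>" "forces_eq r w (check P \<alpha>)"
    have "omega \<notin> elts \<alpha>"
    proof
      assume "omega \<in> elts \<alpha>"
      then have "forces_mem r (check P omega) w"
        using forces_mem_cong_right[OF forces_eq_sym[OF r(3)]] forces_mem_checkI by blast
      then have "r \<tturnstile> Neg (LimitOrd (check P omega))"
        using forces_BForallD[OF w(2) assms(2) is_name_check r(1)] by blast
      then show False
        using forces_LimitOrd_omega below_refl[OF below_cond(1)[OF r(1)]]
        unfolding forces_Neg by blast
    qed
    then have \<alpha>: "elts \<alpha> \<subseteq> range num" by (rule ordinal_subset_omega[OF r(2)])
    have "forces_mem r n (check P \<alpha>)"
      using forces_mem_cong_right[OF r(3) forces_mem_mono[OF assms(3) r(1)]] .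
    then show "densely r (\<lambda>r. \<exists>k. forces_eq r n (check P (num k)))"
      unfolding forces_mem_check by (rule densely_mono) (use \<alpha> in blast)
  qed
qed

text \<open>Here \<^term>\<open>G q k \<alpha>\<close> is meant to express that \<^term>\<open>q\<close> forces \<^term>\<open>\<alpha>\<close> to be the element
  of \<^term>\<open>t\<close> with index \<^term>\<open>k\<close> in some enumeration.\<close>

definition enumeration :: "'v \<Rightarrow> 'v \<Rightarrow> ('v \<Rightarrow> nat \<Rightarrow> 'v \<Rightarrow> bool) \<Rightarrow> bool" where
  "enumeration p t G \<longleftrightarrow>
    (\<forall>q q' k \<alpha>. G q k \<alpha> \<longrightarrow> q' \<preceq> q \<longrightarrow> G q' k \<alpha>) \<and>
    (\<forall>q k \<alpha>. G q k \<alpha> \<longrightarrow> forces_mem q (check P \<alpha>) t) \<and>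
    (\<forall>q y. q \<preceq> p \<longrightarrow> is_name y \<longrightarrow> forces_mem q y t \<longrightarrow>
       densely q (\<lambda>r. \<exists>k \<alpha>. forces_eq r y (check P \<alpha>) \<and> G r k \<alpha>)) \<and>
    (\<forall>q k \<alpha> \<beta>. q \<preceq> p \<longrightarrow> G q k \<alpha> \<longrightarrow> G q k \<beta> \<longrightarrow> \<alpha> = \<beta>)"

lemma
  assumes "enumeration p t G"
  shows enumeration_mono: "G q k \<alpha> \<Longrightarrow> q' \<preceq> q \<Longrightarrow> G q' k \<alpha>"
    and enumeration_mem: "G q k \<alpha> \<Longrightarrow> forces_mem q (check P \<alpha>) t"
    and enumeration_total: "q \<preceq> p \<Longrightarrow> is_name y \<Longrightarrow> forces_mem q y t \<Longrightarrow>
      densely q (\<lambda>r. \<exists>k \<alpha>. forces_eq r y (check P \<alpha>) \<and> G r k \<alpha>)"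
    and enumeration_unique: "q \<preceq> p \<Longrightarrow> G q k \<alpha> \<Longrightarrow> G q k \<beta> \<Longrightarrow> \<alpha> = \<beta>"
  using assms unfolding enumeration_def by blast+

definition forces_indexed :: "'v \<Rightarrow> 'v \<Rightarrow> 'v \<Rightarrow> 'v \<Rightarrow> nat \<Rightarrow> 'v \<Rightarrow> bool" where
  "forces_indexed t w f q k \<alpha> \<longleftrightarrow> forces_mem q (check P \<alpha>) t \<and> forces_mem q (check P (num k)) w \<and>
     forces_mem q (pair_name (check P \<alpha>) (check P (num k))) f"

lemma forces_indexed_total:
  assumes names: "is_name t" "is_name w" "is_name f"
    and w: "q \<tturnstile> IsOmega w" and y: "is_name y" "q \<tturnstile> Ord y" "forces_mem q y t"
    and index: "q \<tturnstile> BExists w (\<lambda>n. PairIn y n f)"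
  shows "densely q (\<lambda>r. \<exists>k \<alpha>. forces_eq r y (check P \<alpha>) \<and> forces_indexed t w f r k \<alpha>)"
  using index unfolding forces_BExists[OF names(2)]
proof (rule densely_bind, elim exE conjE)
  fix q\<^sub>1 n assume n: "q\<^sub>1 \<preceq> q" "is_name n" "forces_mem q\<^sub>1 n w" "q\<^sub>1 \<tturnstile> PairIn y n f"
  have yn: "forces_mem q\<^sub>1 (pair_name y n) f" using n(4) y n(2) names by (simp add: forces_PairIn)
  show "densely q\<^sub>1 (\<lambda>r. \<exists>k \<alpha>. forces_eq r y (check P \<alpha>) \<and> forces_indexed t w f r k \<alpha>)"
    using forces_IsOmega_elt[OF forces_mono[OF w n(1)] names(2) n(3)]
  proof (rule densely_bind, elim exE)
    fix q\<^sub>2 k assume q\<^sub>2: "q\<^sub>2 \<preceq> q\<^sub>1" "forces_eq q\<^sub>2 n (check P (num k))"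
    have "q\<^sub>2 \<preceq> q" using q\<^sub>2(1) n(1) by (rule below_trans)
    show "densely q\<^sub>2 (\<lambda>r. \<exists>k \<alpha>. forces_eq r y (check P \<alpha>) \<and> forces_indexed t w f r k \<alpha>)"
      using forces_Ord_densely_check[OF y(1) forces_mono[OF y(2) \<open>q\<^sub>2 \<preceq> q\<close>]]
    proof (elim densely_mono exE conjE)
      fix r \<alpha> assume r: "r \<preceq> q\<^sub>2" "forces_eq r y (check P \<alpha>)"
      have rq: "r \<preceq> q\<^sub>1" "r \<preceq> q" using r(1) q\<^sub>2(1) n(1) below_trans by blast+
      have nk: "forces_eq r n (check P (num k))" using q\<^sub>2(2) r(1) by (rule forces_eq_mono)
      have "forces_mem r (check P \<alpha>) t"
        using forces_mem_cong_left[OF r(2) forces_mem_mono[OF y(3) rq(2)]] .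
      moreover have "forces_mem r (check P (num k)) w"
        using forces_mem_cong_left[OF nk forces_mem_mono[OF n(3) rq(1)]] .
      moreover have "forces_mem r (pair_name (check P \<alpha>) (check P (num k))) f"
        using forces_mem_cong_left[OF pair_name_cong[OF r(2) nk] forces_mem_mono[OF yn rq(1)]] .
      ultimately show "\<exists>k \<alpha>. forces_eq r y (check P \<alpha>) \<and> forces_indexed t w f r k \<alpha>"
        using r(2) unfolding forces_indexed_def by blast
    qed
  qed
qed

lemma forces_indexed_inject:
  assumes names: "is_name t" "is_name w" "is_name f" and q: "q \<in> elts P"
    and inj: "q \<tturnstile> BForall t (\<lambda>y. BForall t (\<lambda>z. BForall w (\<lambda>n.
      Imp (Conj (PairIn y n f) (PairIn z n f)) (Eq y z))))"
    and index: "forces_indexed t w f q k \<alpha>" "forces_indexed t w f q k \<beta>"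
  shows "\<alpha> = \<beta>"
proof -
  let ?\<alpha> = "check P \<alpha>" and ?\<beta> = "check P \<beta>" and ?k = "check P (num k)"
  have qq: "q \<preceq> q" using q by simp
  have mem: "forces_mem q ?\<alpha> t" "forces_mem q ?\<beta> t" "forces_mem q ?k w"
    using index by (simp_all add: forces_indexed_def)
  note forces_BForallD[OF inj names(1) is_name_check qq mem(1)]
  note forces_BForallD[OF this names(1) is_name_check qq mem(2)]
  note forces_BForallD[OF this names(2) is_name_check qq mem(3)]
  then have "q \<tturnstile> Imp (Conj (PairIn ?\<alpha> ?k f) (PairIn ?\<beta> ?k f)) (Eq ?\<alpha> ?\<beta>)" .
  moreover have "q \<tturnstile> Conj (PairIn ?\<alpha> ?k f) (PairIn ?\<beta> ?k f)"
    using index names by (simp add: forces_Conj forces_PairIn forces_indexed_def)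
  ultimately have "q \<tturnstile> Eq ?\<alpha> ?\<beta>" unfolding forces_Imp using qq by blast
  then show ?thesis using forces_eq_check_iff[OF q] by (simp add: forces_Eq)
qed

lemma ex_enumeration:
  assumes "p \<tturnstile> CountableSetOfOrdinals t" and t: "is_name t" and p: "p \<in> elts P"
  shows "\<exists>r G. r \<preceq> p \<and> enumeration r t G"
proof -
  have ord: "p \<tturnstile> BForall t Ord" and "p \<tturnstile> Countable t"
    using assms(1) by (auto simp: CountableSetOfOrdinals_def forces_Conj)
  from forces_ExistsE[OF this(2)[unfolded Countable_def] p]
  obtain r\<^sub>0 w where r\<^sub>0: "r\<^sub>0 \<preceq> p" "is_name w"
    and w: "r\<^sub>0 \<tturnstile> Conj (IsOmega w) (Exists (\<lambda>f. Conj (BForall t (\<lambda>y. BExists w (\<lambda>n. PairIn y n f)))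
      (Conj (BForall t (\<lambda>y. BForall w (\<lambda>m. BForall w (\<lambda>n.
          Imp (Conj (PairIn y m f) (PairIn y n f)) (Eq m n)))))
        (BForall t (\<lambda>y. BForall t (\<lambda>z. BForall w (\<lambda>n.
          Imp (Conj (PairIn y n f) (PairIn z n f)) (Eq y z))))))))" .
  have omega: "r\<^sub>0 \<tturnstile> IsOmega w" using w by (simp add: forces_Conj)
  from forces_ExistsE[OF w[unfolded forces_Conj, THEN conjunct2] below_cond(1)[OF r\<^sub>0(1)]]
  obtain r f where r: "r \<preceq> r\<^sub>0" "is_name f"
    and total: "r \<tturnstile> BForall t (\<lambda>y. BExists w (\<lambda>n. PairIn y n f))"
    and inj: "r \<tturnstile> BForall t (\<lambda>y. BForall t (\<lambda>z. BForall w (\<lambda>n.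
      Imp (Conj (PairIn y n f) (PairIn z n f)) (Eq y z))))"
    unfolding forces_Conj by blast
  have "r \<preceq> p" using r(1) r\<^sub>0(1) by (rule below_trans)
  have "enumeration r t (forces_indexed t w f)"
    unfolding enumeration_def
  proof (intro conjI allI impI)
    fix q y assume y: "q \<preceq> r" "is_name y" "forces_mem q y t"
    have "q \<tturnstile> IsOmega w" using omega y(1) r(1) forces_mono by blast
    moreover have "q \<tturnstile> Ord y"
      using forces_BForallD[OF ord t y(2) below_trans[OF y(1) \<open>r \<preceq> p\<close>] y(3)] .
    ultimately show "densely q (\<lambda>s. \<exists>k \<alpha>. forces_eq s y (check P \<alpha>) \<and> forces_indexed t w f s k \<alpha>)"
      using forces_indexed_total t r\<^sub>0(2) r(2) y(2,3) forces_BForallD[OF total t y(2,1,3)] by blast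
  next
    fix q k \<alpha> \<beta> assume q: "q \<preceq> r" "forces_indexed t w f q k \<alpha>" "forces_indexed t w f q k \<beta>"
    show "\<alpha> = \<beta>"
      by (rule forces_indexed_inject[OF t r\<^sub>0(2) r(2) below_cond(1)[OF q(1)]
            forces_mono[OF inj q(1)] q(2,3)])
  qed (use forces_mem_mono in \<open>auto simp: forces_indexed_def\<close>)
  then show ?thesis using \<open>r \<preceq> p\<close> by blast
qed

end


section \<open>Product posets\<close>

definition prod_set :: "'v::zfc \<Rightarrow> 'v \<Rightarrow> 'v" where
  "prod_set P Q = vset {\<langle>p, q\<rangle> |p q. p \<in> elts P \<and> q \<in> elts Q}"

definition prod_le :: "'v::zfc \<Rightarrow> 'v \<Rightarrow> 'v \<Rightarrow> 'v \<Rightarrow> 'v" where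
  "prod_le P leP Q leQ = vset {\<langle>\<langle>p, q\<rangle>, \<langle>p', q'\<rangle>\<rangle> |p q p' q'.
     p \<in> elts P \<and> q \<in> elts Q \<and> p' \<in> elts P \<and> q' \<in> elts Q \<and> leq leP p p' \<and> leq leQ q q'}"

lemma elts_prod_set: "elts (prod_set P Q) = {\<langle>p, q\<rangle> |p q. p \<in> elts P \<and> q \<in> elts Q}"
  unfolding prod_set_def by (intro elts_vset small_vpair_image small_elts)

lemma elts_prod_le: "elts (prod_le P leP Q leQ) = {\<langle>\<langle>p, q\<rangle>, \<langle>p', q'\<rangle>\<rangle> |p q p' q'.
    p \<in> elts P \<and> q \<in> elts Q \<and> p' \<in> elts P \<and> q' \<in> elts Q \<and> leq leP p p' \<and> leq leQ q q'}"
    (is "_ = ?S")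
proof -
  have "small {\<langle>c, d\<rangle> |c d. c \<in> elts (prod_set P Q) \<and> d \<in> elts (prod_set P Q)}"
    by (intro small_vpair_image small_elts)
  then have "small ?S" by (rule small_subset) (auto simp: elts_prod_set)
  then show ?thesis unfolding prod_le_def by simp
qed

locale two_forcing = P: forcing P leP + Q: forcing Q leQ for P leP Q leQ :: "'v::zfc"
begin

notation P.below (infix "\<preceq>\<^sub>P" 50)
  and Q.below (infix "\<preceq>\<^sub>Q" 50)
  and P.forces (infix "\<tturnstile>\<^sub>P" 50)

abbreviation PQ :: 'v where "PQ \<equiv> prod_set P Q"

abbreviation lePQ :: 'v where "lePQ \<equiv> prod_le P leP Q leQ"

abbreviation below_PQ :: "'v \<Rightarrow> 'v \<Rightarrow> bool" (infix "\<preceq>\<^sub>\<times>" 50) where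
  "c \<preceq>\<^sub>\<times> d \<equiv> leq lePQ c d"

lemma vpair_PQ [simp]: "\<langle>p, q\<rangle> \<in> elts PQ \<longleftrightarrow> p \<in> elts P \<and> q \<in> elts Q"
  by (auto simp: elts_prod_set)

lemma vpair_below_PQ [simp]: "\<langle>p, q\<rangle> \<preceq>\<^sub>\<times> \<langle>p', q'\<rangle> \<longleftrightarrow> p \<preceq>\<^sub>P p' \<and> q \<preceq>\<^sub>Q q'"
  using P.below_cond Q.below_cond by (auto simp: leq_def[of lePQ] elts_prod_le)

lemma PQ_cases [consumes 1]:
  assumes "c \<in> elts PQ"
  obtains p q where "c = \<langle>p, q\<rangle>" "p \<in> elts P" "q \<in> elts Q"
  using assms by (auto simp: elts_prod_set)

lemma forcing_poset_PQ: "forcing_poset PQ lePQ"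
proof -
  obtain p q where "p \<in> elts P" "q \<in> elts Q"
    using P.poset Q.poset unfolding forcing_poset_def by blast
  then have "\<langle>p, q\<rangle> \<in> elts PQ" by simp
  then have "elts PQ \<noteq> {}" by blast
  moreover have "elts lePQ \<subseteq> {\<langle>c, d\<rangle> |c d. c \<in> elts PQ \<and> d \<in> elts PQ}"
    by (auto simp: elts_prod_le)
  moreover have "\<forall>c\<in>elts PQ. c \<preceq>\<^sub>\<times> c"
    by (auto elim!: PQ_cases)
  moreover have "\<forall>c\<in>elts PQ. \<forall>d\<in>elts PQ. \<forall>e\<in>elts PQ. c \<preceq>\<^sub>\<times> d \<and> d \<preceq>\<^sub>\<times> e \<longrightarrow> c \<preceq>\<^sub>\<times> e"
    by (auto elim!: PQ_cases intro: P.below_trans Q.below_trans)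
  ultimately show ?thesis unfolding forcing_poset_def by blast
qed

sublocale PQ: forcing PQ lePQ
  by unfold_locales (rule forcing_poset_PQ)

notation PQ.forces (infix "\<tturnstile>\<^sub>\<times>" 50)

lemma below_PQ_cases [consumes 1]:
  assumes "c \<preceq>\<^sub>\<times> \<langle>p, q\<rangle>"
  obtains p' q' where "c = \<langle>p', q'\<rangle>" "p' \<preceq>\<^sub>P p" "q' \<preceq>\<^sub>Q q"
proof -
  from PQ.below_cond(1)[OF assms] obtain p' q' where "c = \<langle>p', q'\<rangle>" by (rule PQ_cases)
  with assms that show thesis by simp
qed

lemma PQ_densely: "PQ.densely \<langle>p, q\<rangle> \<Phi> \<longleftrightarrow>
    (\<forall>p' q'. p' \<preceq>\<^sub>P p \<longrightarrow> q' \<preceq>\<^sub>Q q \<longrightarrow> (\<exists>p'' q''. p'' \<preceq>\<^sub>P p' \<and> q'' \<preceq>\<^sub>Q q' \<and> \<Phi> \<langle>p'', q''\<rangle>))"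
proof (intro iffI allI impI)
  fix p' q' assume dense: "PQ.densely \<langle>p, q\<rangle> \<Phi>" and below: "p' \<preceq>\<^sub>P p" "q' \<preceq>\<^sub>Q q"
  obtain c where "c \<preceq>\<^sub>\<times> \<langle>p', q'\<rangle>" "\<Phi> c"
    by (rule PQ.denselyE[OF dense, of "\<langle>p', q'\<rangle>"]) (use below in auto)
  then show "\<exists>p'' q''. p'' \<preceq>\<^sub>P p' \<and> q'' \<preceq>\<^sub>Q q' \<and> \<Phi> \<langle>p'', q''\<rangle>" by (metis below_PQ_cases)
next
  assume dense: "\<forall>p' q'. p' \<preceq>\<^sub>P p \<longrightarrow> q' \<preceq>\<^sub>Q q \<longrightarrow> (\<exists>p'' q''. p'' \<preceq>\<^sub>P p' \<and> q'' \<preceq>\<^sub>Q q' \<and> \<Phi> \<langle>p'', q''\<rangle>)"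
  show "PQ.densely \<langle>p, q\<rangle> \<Phi>"
  proof (rule PQ.denselyI)
    fix c assume "c \<preceq>\<^sub>\<times> \<langle>p, q\<rangle>"
    then obtain p' q' where c: "c = \<langle>p', q'\<rangle>" "p' \<preceq>\<^sub>P p" "q' \<preceq>\<^sub>Q q" by (rule below_PQ_cases)
    then obtain p'' q'' where "p'' \<preceq>\<^sub>P p' \<and> q'' \<preceq>\<^sub>Q q' \<and> \<Phi> \<langle>p'', q''\<rangle>" using dense by blast
    then show "\<exists>d. d \<preceq>\<^sub>\<times> c \<and> \<Phi> d" using c by (intro exI[of _ "\<langle>p'', q''\<rangle>"]) simp
  qed
qed

lemma PQ_densely_left:
  assumes "P.densely p (\<lambda>r. PQ.densely \<langle>r, q\<rangle> \<Phi>)"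
  shows "PQ.densely \<langle>p, q\<rangle> \<Phi>"
  unfolding PQ_densely
proof (intro allI impI)
  fix p' q' assume "p' \<preceq>\<^sub>P p" "q' \<preceq>\<^sub>Q q"
  moreover from this obtain r where r: "r \<preceq>\<^sub>P p'" "PQ.densely \<langle>r, q\<rangle> \<Phi>"
    using P.denselyE[OF assms] by blast
  moreover have "r \<preceq>\<^sub>P r" using r(1) P.below_cond P.below_refl by blast
  ultimately show "\<exists>p'' q''. p'' \<preceq>\<^sub>P p' \<and> q'' \<preceq>\<^sub>Q q' \<and> \<Phi> \<langle>p'', q''\<rangle>"
    unfolding PQ_densely using P.below_trans by blast
qed

lemma PQ_forces_eq_densely_left:
  "P.densely p (\<lambda>r. PQ.forces_eq \<langle>r, q\<rangle> a b) \<Longrightarrow> PQ.forces_eq \<langle>p, q\<rangle> a b"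
  using PQ_densely_left[of p q "\<lambda>c. PQ.forces_eq c a b"] by simp

lemma PQ_densely_densely_left:
  assumes mono: "\<And>r r' x. \<Phi> \<langle>r, x\<rangle> \<Longrightarrow> r' \<preceq>\<^sub>P r \<Longrightarrow> \<Phi> \<langle>r', x\<rangle>"
  shows "PQ.densely \<langle>p, q\<rangle> (\<lambda>c. \<exists>r x. c = \<langle>r, x\<rangle> \<and> P.densely r (\<lambda>r. \<Phi> \<langle>r, x\<rangle>)) \<longleftrightarrow>
    PQ.densely \<langle>p, q\<rangle> \<Phi>"
  unfolding PQ_densely vpair_inject
proof (intro iffI allI impI)
  fix p' q' assume below: "p' \<preceq>\<^sub>P p" "q' \<preceq>\<^sub>Q q"
  {
    assume "\<forall>p' q'. p' \<preceq>\<^sub>P p \<longrightarrow> q' \<preceq>\<^sub>Q q \<longrightarrow> (\<exists>p'' q''. p'' \<preceq>\<^sub>P p' \<and> q'' \<preceq>\<^sub>Q q' \<and>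
      (\<exists>r x. (p'' = r \<and> q'' = x) \<and> P.densely r (\<lambda>r. \<Phi> \<langle>r, x\<rangle>)))"
    then obtain r x where "r \<preceq>\<^sub>P p'" "x \<preceq>\<^sub>Q q'" "P.densely r (\<lambda>r. \<Phi> \<langle>r, x\<rangle>)"
      using below by blast
    moreover from this obtain r' where "r' \<preceq>\<^sub>P r" "\<Phi> \<langle>r', x\<rangle>"
      using P.densely_ex P.below_cond by blast
    ultimately show "\<exists>p'' q''. p'' \<preceq>\<^sub>P p' \<and> q'' \<preceq>\<^sub>Q q' \<and> \<Phi> \<langle>p'', q''\<rangle>"
      using P.below_trans by blast
  next
    assume "\<forall>p' q'. p' \<preceq>\<^sub>P p \<longrightarrow> q' \<preceq>\<^sub>Q q \<longrightarrow> (\<exists>p'' q''. p'' \<preceq>\<^sub>P p' \<and> q'' \<preceq>\<^sub>Q q' \<and> \<Phi> \<langle>p'', q''\<rangle>)"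
    then obtain r x where "r \<preceq>\<^sub>P p'" "x \<preceq>\<^sub>Q q'" "\<Phi> \<langle>r, x\<rangle>" using below by blast
    moreover from this have "P.densely r (\<lambda>r. \<Phi> \<langle>r, x\<rangle>)" using mono by (intro P.densely_all)
    ultimately show "\<exists>p'' q''. p'' \<preceq>\<^sub>P p' \<and> q'' \<preceq>\<^sub>Q q' \<and>
        (\<exists>r x. (p'' = r \<and> q'' = x) \<and> P.densely r (\<lambda>r. \<Phi> \<langle>r, x\<rangle>))"
      by blast
  }
qed

lemma PQ_densely_imp_right:
  "PQ.densely \<langle>p, q\<rangle> (\<lambda>c. \<exists>r x. c = \<langle>r, x\<rangle> \<and> (x \<preceq>\<^sub>Q t \<longrightarrow> \<Phi> r x)) \<longleftrightarrow>
    (\<forall>x. x \<preceq>\<^sub>Q q \<longrightarrow> x \<preceq>\<^sub>Q t \<longrightarrow> PQ.densely \<langle>p, x\<rangle> (\<lambda>c. \<exists>r x. c = \<langle>r, x\<rangle> \<and> \<Phi> r x))"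
  unfolding PQ_densely vpair_inject
proof (intro iffI allI impI)
  fix x p' x'
  assume dense: "\<forall>p' q'. p' \<preceq>\<^sub>P p \<longrightarrow> q' \<preceq>\<^sub>Q q \<longrightarrow> (\<exists>p'' q''. p'' \<preceq>\<^sub>P p' \<and> q'' \<preceq>\<^sub>Q q' \<and>
      (\<exists>r x. (p'' = r \<and> q'' = x) \<and> (x \<preceq>\<^sub>Q t \<longrightarrow> \<Phi> r x)))"
    and x: "x \<preceq>\<^sub>Q q" "x \<preceq>\<^sub>Q t" and below: "p' \<preceq>\<^sub>P p" "x' \<preceq>\<^sub>Q x"
  have "x' \<preceq>\<^sub>Q q" using below(2) x(1) by (rule Q.below_trans)
  then obtain r y where "r \<preceq>\<^sub>P p'" "y \<preceq>\<^sub>Q x'" "y \<preceq>\<^sub>Q t \<longrightarrow> \<Phi> r y" using dense below(1) by blast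
  moreover from this have "y \<preceq>\<^sub>Q t" using below(2) x(2) Q.below_trans by blast
  ultimately show "\<exists>p'' q''. p'' \<preceq>\<^sub>P p' \<and> q'' \<preceq>\<^sub>Q x' \<and> (\<exists>r x. (p'' = r \<and> q'' = x) \<and> \<Phi> r x)"
    by blast
next
  fix p' q'
  assume dense: "\<forall>x. x \<preceq>\<^sub>Q q \<longrightarrow> x \<preceq>\<^sub>Q t \<longrightarrow> (\<forall>p' q'. p' \<preceq>\<^sub>P p \<longrightarrow> q' \<preceq>\<^sub>Q x \<longrightarrow>
      (\<exists>p'' q''. p'' \<preceq>\<^sub>P p' \<and> q'' \<preceq>\<^sub>Q q' \<and> (\<exists>r x. (p'' = r \<and> q'' = x) \<and> \<Phi> r x)))"
    and below: "p' \<preceq>\<^sub>P p" "q' \<preceq>\<^sub>Q q"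
  have refl: "p' \<preceq>\<^sub>P p'" "q' \<preceq>\<^sub>Q q'"
    using below P.below_cond P.below_refl Q.below_cond Q.below_refl by blast+
  show "\<exists>p'' q''. p'' \<preceq>\<^sub>P p' \<and> q'' \<preceq>\<^sub>Q q' \<and> (\<exists>r x. (p'' = r \<and> q'' = x) \<and> (x \<preceq>\<^sub>Q t \<longrightarrow> \<Phi> r x))"
  proof (cases "q' \<preceq>\<^sub>Q t")
    case True
    then obtain r x where "r \<preceq>\<^sub>P p'" "x \<preceq>\<^sub>Q q'" "\<Phi> r x"
      using dense[rule_format, OF below(2) True below(1) refl(2)] by blast
    then show ?thesis by blast
  next
    case False
    then show ?thesis using refl by blast
  qed
qed


section \<open>Product names as names for names\<close>

text \<open>\<^term>\<open>nest a\<close> is a \<open>P\<close>-name for the \<open>Q\<close>-name that results from the \<open>P \<times> Q\<close>-name \<^term>\<open>a\<close> by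
  evaluating only the first coordinates of its conditions.\<close>

definition nest :: "'v \<Rightarrow> 'v" where
  "nest = pair_rec (\<lambda>x c. {\<langle>P.pair_name x (check P t), r\<rangle> |r s t. c = \<langle>s, t\<rangle> \<and> r \<preceq>\<^sub>P s})"

lemma elts_nest: "elts (nest a) =
    {\<langle>P.pair_name (nest b) (check P t), r\<rangle> |b s t r. \<langle>b, \<langle>s, t\<rangle>\<rangle> \<in> elts a \<and> r \<preceq>\<^sub>P s}"
proof -
  have "small {\<langle>P.pair_name x (check P t), r\<rangle> |r s t. c = \<langle>s, t\<rangle> \<and> r \<preceq>\<^sub>P s}" for x c
  proof (cases "\<exists>s t. c = \<langle>s, t\<rangle>")
    case True
    then obtain s t where "c = \<langle>s, t\<rangle>" by blast
    then show ?thesis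
      by (intro small_subset[OF small_image[OF small_elts[of P]],
            of _ "\<lambda>r. \<langle>P.pair_name x (check P t), r\<rangle>"]) (auto dest: P.below_cond)
  qed simp
  then show ?thesis unfolding nest_def by (subst elts_pair_rec) blast+
qed

lemma vpair_mem_nest: "\<langle>\<pi>, r\<rangle> \<in> elts (nest a) \<longleftrightarrow>
    (\<exists>b s t. \<langle>b, \<langle>s, t\<rangle>\<rangle> \<in> elts a \<and> \<pi> = P.pair_name (nest b) (check P t) \<and> r \<preceq>\<^sub>P s)"
  by (auto simp: elts_nest)

lemma is_name_nest: "PQ.is_name a \<Longrightarrow> P.is_name (nest a)"
proof (induction a rule: trcl_induct)
  case (step a)
  show ?case
  proof (rule P.is_nameI)
    fix z assume "z \<in> elts (nest a)"
    then obtain b s t r where z: "z = \<langle>P.pair_name (nest b) (check P t), r\<rangle>"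
      "\<langle>b, \<langle>s, t\<rangle>\<rangle> \<in> elts a" "r \<preceq>\<^sub>P s"
      by (auto simp: elts_nest)
    then have "P.is_name (nest b)"
      using step PQ.is_name_pairD(1) vpair_mem_trcl(1) by blast
    then show "\<exists>\<sigma> p. z = \<langle>\<sigma>, p\<rangle> \<and> p \<in> elts P \<and> P.is_name \<sigma>" using z P.below_cond(1) by auto
  qed
qed

lemma is_name_nest_component: "PQ.is_name a \<Longrightarrow> \<langle>b, u\<rangle> \<in> elts a \<Longrightarrow> P.is_name (nest b)"
  using is_name_nest PQ.is_name_pairD(1) by blast

lemma PQ_name_elt_cases:
  assumes "PQ.is_name a" "\<langle>b, u\<rangle> \<in> elts a"
  obtains s t where "u = \<langle>s, t\<rangle>" "s \<in> elts P" "t \<in> elts Q"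
  using PQ.is_name_pairD(2)[OF assms] by (rule PQ_cases)

lemma forces_mem_nest: "P.forces_mem p \<tau> (nest a) \<longleftrightarrow> P.densely p (\<lambda>r. \<exists>b s t.
    \<langle>b, \<langle>s, t\<rangle>\<rangle> \<in> elts a \<and> r \<preceq>\<^sub>P s \<and> P.forces_eq r \<tau> (P.pair_name (nest b) (check P t)))"
  unfolding P.forces_mem_def
proof (rule P.densely_cong)
  fix r assume "r \<preceq>\<^sub>P p"
  then have refl: "r \<preceq>\<^sub>P r" using P.below_cond P.below_refl by blast
  show "(\<exists>\<pi> s. \<langle>\<pi>, s\<rangle> \<in> elts (nest a) \<and> r \<preceq>\<^sub>P s \<and> P.forces_eq r \<pi> \<tau>) \<longleftrightarrow> (\<exists>b s t.
      \<langle>b, \<langle>s, t\<rangle>\<rangle> \<in> elts a \<and> r \<preceq>\<^sub>P s \<and> P.forces_eq r \<tau> (P.pair_name (nest b) (check P t)))"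
    unfolding vpair_mem_nest
  proof (intro iffI; elim exE conjE)
    fix \<pi> r' b s t
    assume "r \<preceq>\<^sub>P r'" "P.forces_eq r \<pi> \<tau>" "\<langle>b, \<langle>s, t\<rangle>\<rangle> \<in> elts a"
      "\<pi> = P.pair_name (nest b) (check P t)" "r' \<preceq>\<^sub>P s"
    then show "\<exists>b s t. \<langle>b, \<langle>s, t\<rangle>\<rangle> \<in> elts a \<and> r \<preceq>\<^sub>P s \<and>
        P.forces_eq r \<tau> (P.pair_name (nest b) (check P t))"
      using P.below_trans P.forces_eq_sym by blast
  next
    fix b s t
    assume "\<langle>b, \<langle>s, t\<rangle>\<rangle> \<in> elts a" "r \<preceq>\<^sub>P s" "P.forces_eq r \<tau> (P.pair_name (nest b) (check P t))"
    then show "\<exists>\<pi> r'. (\<exists>b s t. \<langle>b, \<langle>s, t\<rangle>\<rangle> \<in> elts a \<and> \<pi> = P.pair_name (nest b) (check P t) \<and>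
        r' \<preceq>\<^sub>P s) \<and> r \<preceq>\<^sub>P r' \<and> P.forces_eq r \<pi> \<tau>"
      using refl P.forces_eq_sym by blast
  qed
qed

lemma forces_mem_nestI:
  "\<langle>b, \<langle>s, t\<rangle>\<rangle> \<in> elts a \<Longrightarrow> p \<preceq>\<^sub>P s \<Longrightarrow> P.forces_mem p (P.pair_name (nest b) (check P t)) (nest a)"
  unfolding forces_mem_nest using P.below_trans P.forces_eq_refl by (intro P.densely_all) blast

lemma forces_pair_mem_nest:
  "P.forces_mem p (P.pair_name \<pi> \<sigma>) (nest a) \<longleftrightarrow> P.densely p (\<lambda>r. \<exists>b s t. \<langle>b, \<langle>s, t\<rangle>\<rangle> \<in> elts a \<and>
    r \<preceq>\<^sub>P s \<and> P.forces_eq r \<pi> (nest b) \<and> P.forces_eq r \<sigma> (check P t))"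
  unfolding forces_mem_nest
  by (rule P.densely_cong) (metis P.pair_name_cong P.pair_name_eq_fstD P.pair_name_eq_sndD)

lemma densely_ex_eq_nest_component:
  assumes eq: "P.forces_eq p (nest a) (nest b)" and c: "\<langle>c, \<langle>s, t\<rangle>\<rangle> \<in> elts a" "p \<preceq>\<^sub>P s"
  shows "P.densely p (\<lambda>r. \<exists>d s'. \<langle>d, \<langle>s', t\<rangle>\<rangle> \<in> elts b \<and> r \<preceq>\<^sub>P s' \<and> P.forces_eq r (nest d) (nest c))"
proof -
  have "P.forces_mem p (P.pair_name (nest c) (check P t)) (nest b)"
    using P.forces_mem_cong_right[OF eq forces_mem_nestI[OF c]] .
  then show ?thesis
    unfolding forces_pair_mem_nest
  proof (elim P.densely_mono exE conjE)
    fix r d s' t' assume r: "r \<preceq>\<^sub>P p" and d: "\<langle>d, \<langle>s', t'\<rangle>\<rangle> \<in> elts b" "r \<preceq>\<^sub>P s'"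
      "P.forces_eq r (nest c) (nest d)" "P.forces_eq r (check P t) (check P t')"
    have "t = t'" using d(4) P.forces_eq_check_iff[OF P.below_cond(1)[OF r]] by blast
    then show "\<exists>d s'. \<langle>d, \<langle>s', t\<rangle>\<rangle> \<in> elts b \<and> r \<preceq>\<^sub>P s' \<and> P.forces_eq r (nest d) (nest c)"
      using d(1,2) P.forces_eq_sym[OF d(3)] by blast
  qed
qed

lemma forces_eq_of_nest:
  assumes "PQ.is_name a" "PQ.is_name b" "P.forces_eq p (nest a) (nest b)" "q \<in> elts Q"
  shows "PQ.forces_eq \<langle>p, q\<rangle> a b"
proof (rule PQ.forces_eq_bisimulation[of "\<lambda>w a b. \<exists>p q. w = \<langle>p, q\<rangle> \<and> q \<in> elts Q \<and>
    PQ.is_name a \<and> PQ.is_name b \<and> P.forces_eq p (nest a) (nest b)"])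
  fix w a b c u w'
  assume "\<exists>p q. w = \<langle>p, q\<rangle> \<and> q \<in> elts Q \<and> PQ.is_name a \<and> PQ.is_name b \<and>
      P.forces_eq p (nest a) (nest b)"
    and c: "\<langle>c, u\<rangle> \<in> elts a" and w': "w' \<preceq>\<^sub>\<times> w" "w' \<preceq>\<^sub>\<times> u"
  then obtain p q where w: "w = \<langle>p, q\<rangle>" and names: "PQ.is_name a" "PQ.is_name b"
    and eq: "P.forces_eq p (nest a) (nest b)"
    by blast
  obtain s t where u: "u = \<langle>s, t\<rangle>" using names(1) c by (rule PQ_name_elt_cases)
  obtain p' q' where pq': "w' = \<langle>p', q'\<rangle>" "p' \<preceq>\<^sub>P p" "p' \<preceq>\<^sub>P s" "q' \<preceq>\<^sub>Q t"
    using w' w u by (metis below_PQ_cases vpair_below_PQ)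
  note dense = densely_ex_eq_nest_component[OF P.forces_eq_mono[OF eq pq'(2)] c[unfolded u] pq'(3)]
  show "PQ.densely w' (\<lambda>v. \<exists>d u'. \<langle>d, u'\<rangle> \<in> elts b \<and> v \<preceq>\<^sub>\<times> u' \<and> (\<exists>p q. v = \<langle>p, q\<rangle> \<and> q \<in> elts Q \<and>
      PQ.is_name d \<and> PQ.is_name c \<and> P.forces_eq p (nest d) (nest c)))"
    unfolding pq'(1) PQ_densely
  proof (intro allI impI)
    fix p\<^sub>1 q\<^sub>1 assume below: "p\<^sub>1 \<preceq>\<^sub>P p'" "q\<^sub>1 \<preceq>\<^sub>Q q'"
    obtain r d s' where r: "r \<preceq>\<^sub>P p\<^sub>1" "\<langle>d, \<langle>s', t\<rangle>\<rangle> \<in> elts b" "r \<preceq>\<^sub>P s'"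
      "P.forces_eq r (nest d) (nest c)"
      by (rule P.denselyE[OF dense below(1)]) blast
    have "\<langle>r, q\<^sub>1\<rangle> \<preceq>\<^sub>\<times> \<langle>s', t\<rangle>" using r(3) Q.below_trans[OF below(2) pq'(4)] by simp
    moreover have "q\<^sub>1 \<in> elts Q" "q\<^sub>1 \<preceq>\<^sub>Q q\<^sub>1" using below(2) Q.below_cond(1) by simp_all
    moreover have "PQ.is_name c" "PQ.is_name d"
      using PQ.is_name_pairD(1) names c r(2) by blast+
    ultimately show "\<exists>p'' q''. p'' \<preceq>\<^sub>P p\<^sub>1 \<and> q'' \<preceq>\<^sub>Q q\<^sub>1 \<and> (\<exists>d u'. \<langle>d, u'\<rangle> \<in> elts b \<and>
        \<langle>p'', q''\<rangle> \<preceq>\<^sub>\<times> u' \<and> (\<exists>p q. \<langle>p'', q''\<rangle> = \<langle>p, q\<rangle> \<and> q \<in> elts Q \<and>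
          PQ.is_name d \<and> PQ.is_name c \<and> P.forces_eq p (nest d) (nest c)))"
      using r(1,2,4) by blast
  qed
next
  show "\<exists>p' q'. \<langle>p, q\<rangle> = \<langle>p', q'\<rangle> \<and> q' \<in> elts Q \<and> PQ.is_name a \<and> PQ.is_name b \<and>
      P.forces_eq p' (nest a) (nest b)"
    using assms by blast
qed (use P.forces_eq_sym in blast)


section \<open>The forcing relation of the extension\<close>

abbreviation check_Q :: 'v where "check_Q \<equiv> check P Q"

abbreviation check_leQ :: 'v where "check_leQ \<equiv> check P leQ"

lemma forces_PairIn_check_leQ:
  assumes "p \<in> elts P" "P.is_name \<tau>" "P.is_name \<rho>"
    and "P.forces_eq p \<tau> (check P x)" "P.forces_eq p \<rho> (check P y)"
  shows "p \<tturnstile>\<^sub>P PairIn \<tau> \<rho> check_leQ \<longleftrightarrow> x \<preceq>\<^sub>Q y"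
proof -
  have "p \<tturnstile>\<^sub>P PairIn \<tau> \<rho> check_leQ \<longleftrightarrow>
      P.forces_mem p (P.pair_name (check P x) (check P y)) check_leQ"
    using P.forces_mem_cong[OF P.pair_name_cong[OF assms(4,5)] P.forces_eq_refl] assms(2,3)
    by (simp add: P.forces_PairIn)
  then show ?thesis using assms(1) by (simp add: P.pair_name_check P.forces_mem_check_iff leq_def)
qed

lemma forces_BelowForall_check:
  assumes \<rho>: "P.is_name \<rho>" "P.forces_eq p \<rho> (check P q)"
  shows "p \<tturnstile>\<^sub>P BelowForall check_Q check_leQ \<rho> F \<longleftrightarrow> (\<forall>x r \<tau>. x \<preceq>\<^sub>Q q \<longrightarrow> r \<preceq>\<^sub>P p \<longrightarrow>
    P.is_name \<tau> \<longrightarrow> P.forces_eq r \<tau> (check P x) \<longrightarrow> r \<tturnstile>\<^sub>P F \<tau>)"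
proof -
  have "r \<tturnstile>\<^sub>P Imp (PairIn \<tau> \<rho> check_leQ) (F \<tau>) \<longleftrightarrow> (x \<preceq>\<^sub>Q q \<longrightarrow> r \<tturnstile>\<^sub>P F \<tau>)"
    if "r \<preceq>\<^sub>P p" "P.is_name \<tau>" "P.forces_eq r \<tau> (check P x)" for r \<tau> x
  proof (rule P.forces_Imp_decided)
    fix r' assume r': "r' \<preceq>\<^sub>P r"
    show "r' \<tturnstile>\<^sub>P PairIn \<tau> \<rho> check_leQ \<longleftrightarrow> x \<preceq>\<^sub>Q q"
      by (rule forces_PairIn_check_leQ[OF P.below_cond(1)[OF r'] that(2) \<rho>(1)
            P.forces_eq_mono[OF that(3) r']
            P.forces_eq_mono[OF \<rho>(2) P.below_trans[OF r' that(1)]]])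
  qed
  then show ?thesis
    unfolding BelowForall_def P.forces_BForall_check_elts using Q.below_cond(1) by blast
qed

lemma forces_BelowExists_check:
  assumes \<rho>: "P.is_name \<rho>" "P.forces_eq p \<rho> (check P q)" and F: "P.uniform F"
  shows "p \<tturnstile>\<^sub>P BelowExists check_Q check_leQ \<rho> F \<longleftrightarrow>
    P.densely p (\<lambda>r. \<exists>x. x \<preceq>\<^sub>Q q \<and> r \<tturnstile>\<^sub>P F (check P x))"
proof -
  have "P.uniform (\<lambda>\<tau>. Conj (PairIn \<tau> \<rho> check_leQ) (F \<tau>))"
    by (intro P.uniformI fm_rel_intros P.fm_rel_uniform[OF F]) (use \<rho>(1) in auto)
  then have "p \<tturnstile>\<^sub>P BelowExists check_Q check_leQ \<rho> F \<longleftrightarrow>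
      P.densely p (\<lambda>r. \<exists>x\<in>elts Q. r \<tturnstile>\<^sub>P Conj (PairIn (check P x) \<rho> check_leQ) (F (check P x)))"
    unfolding BelowExists_def by (rule P.forces_BExists_check)
  also have "\<dots> \<longleftrightarrow> P.densely p (\<lambda>r. \<exists>x. x \<preceq>\<^sub>Q q \<and> r \<tturnstile>\<^sub>P F (check P x))"
  proof (rule P.densely_cong)
    fix r assume r: "r \<preceq>\<^sub>P p"
    have "r \<tturnstile>\<^sub>P PairIn (check P x) \<rho> check_leQ \<longleftrightarrow> x \<preceq>\<^sub>Q q" for x
      by (rule forces_PairIn_check_leQ[OF P.below_cond(1)[OF r] _ \<rho>(1) _
            P.forces_eq_mono[OF \<rho>(2) r]])
        simp_all
    then show "(\<exists>x\<in>elts Q. r \<tturnstile>\<^sub>P Conj (PairIn (check P x) \<rho> check_leQ) (F (check P x))) \<longleftrightarrow>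
        (\<exists>x. x \<preceq>\<^sub>Q q \<and> r \<tturnstile>\<^sub>P F (check P x))"
      unfolding P.forces_Conj using Q.below_cond(1) by blast
  qed
  finally show ?thesis .
qed

lemma forces_DenseBelow_check:
  assumes \<rho>: "P.is_name \<rho>" "P.forces_eq p \<rho> (check P q)" and F: "P.uniform F"
  shows "p \<tturnstile>\<^sub>P DenseBelow check_Q check_leQ \<rho> F \<longleftrightarrow>
    PQ.densely \<langle>p, q\<rangle> (\<lambda>c. \<exists>r x. c = \<langle>r, x\<rangle> \<and> r \<tturnstile>\<^sub>P F (check P x))"
proof -
  have "p \<tturnstile>\<^sub>P DenseBelow check_Q check_leQ \<rho> F \<longleftrightarrow> (\<forall>x r \<tau>. x \<preceq>\<^sub>Q q \<longrightarrow> r \<preceq>\<^sub>P p \<longrightarrow> P.is_name \<tau> \<longrightarrow>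
      P.forces_eq r \<tau> (check P x) \<longrightarrow> P.densely r (\<lambda>r. \<exists>y. y \<preceq>\<^sub>Q x \<and> r \<tturnstile>\<^sub>P F (check P y)))"
    unfolding DenseBelow_def forces_BelowForall_check[OF \<rho>] using forces_BelowExists_check[OF _ _ F]
    by blast
  also have "\<dots> \<longleftrightarrow> (\<forall>x. x \<preceq>\<^sub>Q q \<longrightarrow> (\<forall>r. r \<preceq>\<^sub>P p \<longrightarrow>
      P.densely r (\<lambda>r. \<exists>y. y \<preceq>\<^sub>Q x \<and> r \<tturnstile>\<^sub>P F (check P y))))"
    using P.is_name_check P.forces_eq_refl by blast
  also have "\<dots> \<longleftrightarrow> PQ.densely \<langle>p, q\<rangle> (\<lambda>c. \<exists>r x. c = \<langle>r, x\<rangle> \<and> r \<tturnstile>\<^sub>P F (check P x))"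
    unfolding P.densely_below_iff unfolding P.densely_def by (simp add: PQ_densely) metis
  finally show ?thesis .
qed

lemma forces_DenseBelow_Imp_check:
  assumes F: "P.uniform F"
  shows "p \<tturnstile>\<^sub>P DenseBelow check_Q check_leQ (check P q)
      (\<lambda>x. Imp (PairIn x (check P t) check_leQ) (F x)) \<longleftrightarrow>
    (\<forall>x. x \<preceq>\<^sub>Q q \<longrightarrow> x \<preceq>\<^sub>Q t \<longrightarrow> p \<tturnstile>\<^sub>P DenseBelow check_Q check_leQ (check P x) F)"
proof -
  have "P.uniform (\<lambda>x. Imp (PairIn x (check P t) check_leQ) (F x))"
    by (intro P.uniformI fm_rel_intros P.fm_rel_uniform[OF F]) auto
  from forces_DenseBelow_check[OF P.is_name_check P.forces_eq_refl this]
  have "p \<tturnstile>\<^sub>P DenseBelow check_Q check_leQ (check P q)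
      (\<lambda>x. Imp (PairIn x (check P t) check_leQ) (F x)) \<longleftrightarrow> PQ.densely \<langle>p, q\<rangle> (\<lambda>c. \<exists>r x. c = \<langle>r, x\<rangle> \<and>
        r \<tturnstile>\<^sub>P Imp (PairIn (check P x) (check P t) check_leQ) (F (check P x)))" .
  also have "\<dots> \<longleftrightarrow> PQ.densely \<langle>p, q\<rangle> (\<lambda>c. \<exists>r x. c = \<langle>r, x\<rangle> \<and> (x \<preceq>\<^sub>Q t \<longrightarrow> r \<tturnstile>\<^sub>P F (check P x)))"
  proof (rule PQ.densely_cong)
    fix c assume "c \<preceq>\<^sub>\<times> \<langle>p, q\<rangle>"
    then obtain r x where c: "c = \<langle>r, x\<rangle>" "r \<preceq>\<^sub>P p" by (rule below_PQ_cases)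
    have "r \<tturnstile>\<^sub>P Imp (PairIn (check P x) (check P t) check_leQ) (F (check P x)) \<longleftrightarrow>
        (x \<preceq>\<^sub>Q t \<longrightarrow> r \<tturnstile>\<^sub>P F (check P x))"
      by (intro P.forces_Imp_decided forces_PairIn_check_leQ) (auto dest: P.below_cond(1))
    then show "(\<exists>r x. c = \<langle>r, x\<rangle> \<and>
          r \<tturnstile>\<^sub>P Imp (PairIn (check P x) (check P t) check_leQ) (F (check P x))) \<longleftrightarrow>
        (\<exists>r x. c = \<langle>r, x\<rangle> \<and> (x \<preceq>\<^sub>Q t \<longrightarrow> r \<tturnstile>\<^sub>P F (check P x)))"
      by (simp add: c(1))
  qed
  finally show ?thesis
    unfolding PQ_densely_imp_right forces_DenseBelow_check[OF P.is_name_check P.forces_eq_refl F] .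
qed

lemma forces_PairIn_nestI:
  assumes "PQ.is_name a" "\<langle>c, \<langle>s, t\<rangle>\<rangle> \<in> elts a" "p \<preceq>\<^sub>P s"
  shows "p \<tturnstile>\<^sub>P PairIn (nest c) (check P t) (nest a)"
  using assms forces_mem_nestI is_name_nest is_name_nest_component
  by (simp add: P.forces_PairIn[OF is_name_nest_component[OF assms(1,2)]])

lemma densely_pair_of_PairIn_nest:
  assumes a: "PQ.is_name a" and F: "P.uniform2 F" and names: "P.is_name \<pi>" "P.is_name \<sigma>"
    and pair: "p \<tturnstile>\<^sub>P PairIn \<pi> \<sigma> (nest a)"
  shows "P.densely p (\<lambda>r. \<exists>c s t. \<langle>c, \<langle>s, t\<rangle>\<rangle> \<in> elts a \<and> r \<preceq>\<^sub>P s \<and>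
    (r \<tturnstile>\<^sub>P F \<pi> \<sigma> \<longleftrightarrow> r \<tturnstile>\<^sub>P F (nest c) (check P t)))"
proof -
  have "P.forces_mem p (P.pair_name \<pi> \<sigma>) (nest a)"
    using pair names is_name_nest[OF a] by (simp add: P.forces_PairIn)
  then show ?thesis
    unfolding forces_pair_mem_nest
  proof (elim P.densely_mono exE conjE)
    fix r c s t assume c: "\<langle>c, \<langle>s, t\<rangle>\<rangle> \<in> elts a" "r \<preceq>\<^sub>P s"
      "P.forces_eq r \<pi> (nest c)" "P.forces_eq r \<sigma> (check P t)"
    then show "\<exists>c s t. \<langle>c, \<langle>s, t\<rangle>\<rangle> \<in> elts a \<and> r \<preceq>\<^sub>P s \<and>
        (r \<tturnstile>\<^sub>P F \<pi> \<sigma> \<longleftrightarrow> r \<tturnstile>\<^sub>P F (nest c) (check P t))"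
      using P.uniform2_cong[OF F names(1) is_name_nest_component[OF a c(1)] c(3) names(2)
          P.is_name_check c(4)] by blast
  qed
qed

lemma forces_Forall_pair_nest:
  assumes a: "PQ.is_name a" and F: "P.uniform2 F"
  shows "p \<tturnstile>\<^sub>P Forall (\<lambda>\<pi>. Forall (\<lambda>\<sigma>. Imp (PairIn \<pi> \<sigma> (nest a)) (F \<pi> \<sigma>))) \<longleftrightarrow>
    (\<forall>c s t r. \<langle>c, \<langle>s, t\<rangle>\<rangle> \<in> elts a \<longrightarrow> r \<preceq>\<^sub>P p \<longrightarrow> r \<preceq>\<^sub>P s \<longrightarrow> r \<tturnstile>\<^sub>P F (nest c) (check P t))"
    (is "?forall \<longleftrightarrow> ?elts")
proof
  assume forall: ?forall
  show ?elts
  proof (intro allI impI)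
    fix c s t r assume c: "\<langle>c, \<langle>s, t\<rangle>\<rangle> \<in> elts a" "r \<preceq>\<^sub>P p" "r \<preceq>\<^sub>P s"
    have "p \<tturnstile>\<^sub>P Imp (PairIn (nest c) (check P t) (nest a)) (F (nest c) (check P t))"
      using forall is_name_nest_component[OF a c(1)] unfolding P.forces_Forall by simp
    then show "r \<tturnstile>\<^sub>P F (nest c) (check P t)"
      using forces_PairIn_nestI[OF a c(1,3)] c(2) unfolding P.forces_Imp by blast
  qed
next
  assume elts: ?elts
  show ?forall
    unfolding P.forces_Forall P.forces_Imp
  proof (intro allI impI P.forces_densely)
    fix \<pi> \<sigma> q assume "P.is_name \<pi>" "P.is_name \<sigma>" and q: "q \<preceq>\<^sub>P p" and "q \<tturnstile>\<^sub>P PairIn \<pi> \<sigma> (nest a)"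
    from densely_pair_of_PairIn_nest[OF a F this(1,2,4)] show "P.densely q (\<lambda>r. r \<tturnstile>\<^sub>P F \<pi> \<sigma>)"
    proof (elim P.densely_mono exE conjE)
      fix r c s t assume "r \<preceq>\<^sub>P q" "\<langle>c, \<langle>s, t\<rangle>\<rangle> \<in> elts a" "r \<preceq>\<^sub>P s"
        "r \<tturnstile>\<^sub>P F \<pi> \<sigma> \<longleftrightarrow> r \<tturnstile>\<^sub>P F (nest c) (check P t)"
      then show "r \<tturnstile>\<^sub>P F \<pi> \<sigma>" using elts P.below_trans[OF _ q] by blast
    qed
  qed
qed

lemma forces_Exists_pair_nest:
  assumes a: "PQ.is_name a" and F: "P.uniform2 F"
  shows "p \<tturnstile>\<^sub>P Exists (\<lambda>\<pi>. Exists (\<lambda>\<sigma>. Conj (PairIn \<pi> \<sigma> (nest a)) (F \<pi> \<sigma>))) \<longleftrightarrow>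
    P.densely p (\<lambda>r. \<exists>c s t. \<langle>c, \<langle>s, t\<rangle>\<rangle> \<in> elts a \<and> r \<preceq>\<^sub>P s \<and> r \<tturnstile>\<^sub>P F (nest c) (check P t))"
    (is "_ \<longleftrightarrow> P.densely p ?elt")
proof
  assume "p \<tturnstile>\<^sub>P Exists (\<lambda>\<pi>. Exists (\<lambda>\<sigma>. Conj (PairIn \<pi> \<sigma> (nest a)) (F \<pi> \<sigma>)))"
  then show "P.densely p ?elt"
    unfolding P.forces_Exists[where p = p]
  proof (rule P.densely_bind, elim exE conjE)
    fix r\<^sub>1 \<pi> assume \<pi>: "P.is_name \<pi>"
      and "r\<^sub>1 \<tturnstile>\<^sub>P Exists (\<lambda>\<sigma>. Conj (PairIn \<pi> \<sigma> (nest a)) (F \<pi> \<sigma>))"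
    from this(2) show "P.densely r\<^sub>1 ?elt"
      unfolding P.forces_Exists P.forces_Conj
    proof (rule P.densely_bind, elim exE conjE)
      fix r\<^sub>2 \<sigma> assume \<sigma>: "P.is_name \<sigma>" "r\<^sub>2 \<tturnstile>\<^sub>P PairIn \<pi> \<sigma> (nest a)" "r\<^sub>2 \<tturnstile>\<^sub>P F \<pi> \<sigma>"
      from densely_pair_of_PairIn_nest[OF a F \<pi> \<sigma>(1,2)] show "P.densely r\<^sub>2 ?elt"
        using P.forces_mono[OF \<sigma>(3)] by (elim P.densely_mono) blast
    qed
  qed
next
  assume "P.densely p ?elt"
  then show "p \<tturnstile>\<^sub>P Exists (\<lambda>\<pi>. Exists (\<lambda>\<sigma>. Conj (PairIn \<pi> \<sigma> (nest a)) (F \<pi> \<sigma>)))"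
  proof (intro P.forces_densely, elim P.densely_mono exE conjE)
    fix r c s t assume r: "\<langle>c, \<langle>s, t\<rangle>\<rangle> \<in> elts a" "r \<preceq>\<^sub>P s" "r \<tturnstile>\<^sub>P F (nest c) (check P t)"
    then show "r \<tturnstile>\<^sub>P Exists (\<lambda>\<pi>. Exists (\<lambda>\<sigma>. Conj (PairIn \<pi> \<sigma> (nest a)) (F \<pi> \<sigma>)))"
      using forces_PairIn_nestI[OF a r(1,2)] is_name_nest_component[OF a r(1)]
      by (intro P.forces_ExistsI[of "nest c"] P.forces_ExistsI[of "check P t"])
        (simp_all add: P.forces_Conj)
  qed
qed

end


subsection \<open>Atomic formulas\<close>

definition ExistsEltAt :: "'v \<Rightarrow> 'v \<Rightarrow> 'v \<Rightarrow> ('v \<Rightarrow> 'v fm) \<Rightarrow> 'v fm" where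
  "ExistsEltAt le r \<sigma> F =
     Exists (\<lambda>\<pi>. Exists (\<lambda>s. Conj (PairIn \<pi> s \<sigma>) (Conj (PairIn r s le) (F \<pi>))))"

lemma ForcesMem_unfold: "ForcesMem P le p \<tau> \<sigma> =
    DenseBelow P le p (\<lambda>q. ExistsEltAt le q \<sigma> (\<lambda>\<pi>. ForcesEq P le q \<pi> \<tau>))"
  by (simp add: ForcesMem_def ExistsEltAt_def)

lemma ForcesSubClause_unfold: "ForcesSubClause P le K p \<tau> \<sigma> =
    Forall (\<lambda>\<pi>. Forall (\<lambda>s. Imp (PairIn \<pi> s \<tau>)
      (DenseBelow P le p (\<lambda>r. Imp (PairIn r s le) (ExistsEltAt le r \<sigma> (K r \<pi>))))))"
  by (simp add: ForcesSubClause_def ExistsEltAt_def)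

lemma fm_rel_ExistsEltAt [fm_rel_intros]:
  "(le, le') \<in> E \<Longrightarrow> (r, r') \<in> E \<Longrightarrow> (\<sigma>, \<sigma>') \<in> E \<Longrightarrow>
    (\<And>s s' \<pi> \<pi>'. fm_rel (insert (s, s') (insert (\<pi>, \<pi>') E)) (F \<pi>) (F' \<pi>')) \<Longrightarrow>
    fm_rel E (ExistsEltAt le r \<sigma> F) (ExistsEltAt le' r' \<sigma>' F')"
  unfolding ExistsEltAt_def by (intro fm_rel_intros) auto

context two_forcing
begin

lemma forces_ExistsEltAt_nest:
  assumes b: "PQ.is_name b" and F: "P.uniform F" and x: "x \<in> elts Q"
    and F_iff: "\<And>r d s t. r \<preceq>\<^sub>P p \<Longrightarrow> \<langle>d, \<langle>s, t\<rangle>\<rangle> \<in> elts b \<Longrightarrow> r \<preceq>\<^sub>P s \<Longrightarrow>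
      r \<tturnstile>\<^sub>P F (nest d) \<longleftrightarrow> PQ.forces_eq \<langle>r, x\<rangle> d c"
  shows "p \<tturnstile>\<^sub>P ExistsEltAt check_leQ (check P x) (nest b) F \<longleftrightarrow>
    P.densely p (\<lambda>r. \<exists>d u. \<langle>d, u\<rangle> \<in> elts b \<and> \<langle>r, x\<rangle> \<preceq>\<^sub>\<times> u \<and> PQ.forces_eq \<langle>r, x\<rangle> d c)"
proof -
  have "P.uniform2 (\<lambda>\<pi> \<sigma>. Conj (PairIn (check P x) \<sigma> check_leQ) (F \<pi>))"
    by (intro P.uniform2I fm_rel_intros P.fm_rel_uniform[OF F]) auto
  from forces_Exists_pair_nest[OF b this]
  have "p \<tturnstile>\<^sub>P ExistsEltAt check_leQ (check P x) (nest b) F \<longleftrightarrow>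
    P.densely p (\<lambda>r. \<exists>d s t. \<langle>d, \<langle>s, t\<rangle>\<rangle> \<in> elts b \<and> r \<preceq>\<^sub>P s \<and>
      r \<tturnstile>\<^sub>P Conj (PairIn (check P x) (check P t) check_leQ) (F (nest d)))"
    unfolding ExistsEltAt_def .
  also have "\<dots> \<longleftrightarrow> P.densely p (\<lambda>r. \<exists>d u. \<langle>d, u\<rangle> \<in> elts b \<and> \<langle>r, x\<rangle> \<preceq>\<^sub>\<times> u \<and> PQ.forces_eq \<langle>r, x\<rangle> d c)"
  proof (rule P.densely_cong)
    fix r assume r: "r \<preceq>\<^sub>P p"
    have "r \<tturnstile>\<^sub>P PairIn (check P x) (check P t) check_leQ \<longleftrightarrow> x \<preceq>\<^sub>Q t" for t
      by (rule forces_PairIn_check_leQ[OF P.below_cond(1)[OF r]]) simp_all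
    then have "r \<tturnstile>\<^sub>P Conj (PairIn (check P x) (check P t) check_leQ) (F (nest d)) \<longleftrightarrow>
        x \<preceq>\<^sub>Q t \<and> PQ.forces_eq \<langle>r, x\<rangle> d c" if "\<langle>d, \<langle>s, t\<rangle>\<rangle> \<in> elts b" "r \<preceq>\<^sub>P s" for d s t
      using F_iff[OF r that] by (simp add: P.forces_Conj)
    then show "(\<exists>d s t. \<langle>d, \<langle>s, t\<rangle>\<rangle> \<in> elts b \<and> r \<preceq>\<^sub>P s \<and>
          r \<tturnstile>\<^sub>P Conj (PairIn (check P x) (check P t) check_leQ) (F (nest d))) \<longleftrightarrow>
        (\<exists>d u. \<langle>d, u\<rangle> \<in> elts b \<and> \<langle>r, x\<rangle> \<preceq>\<^sub>\<times> u \<and> PQ.forces_eq \<langle>r, x\<rangle> d c)"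
      by (metis PQ_name_elt_cases[OF b] vpair_below_PQ)
  qed
  finally show ?thesis .
qed

lemma PQ_densely_mem:
  "PQ.densely \<langle>p, q\<rangle> (\<lambda>w. \<exists>r x. w = \<langle>r, x\<rangle> \<and>
      P.densely r (\<lambda>r. \<exists>d u. \<langle>d, u\<rangle> \<in> elts b \<and> \<langle>r, x\<rangle> \<preceq>\<^sub>\<times> u \<and> PQ.forces_eq \<langle>r, x\<rangle> d c)) \<longleftrightarrow>
    PQ.forces_mem \<langle>p, q\<rangle> c b"
  unfolding PQ.forces_mem_def
proof (rule PQ_densely_densely_left)
  fix r r' x
  assume "\<exists>d u. \<langle>d, u\<rangle> \<in> elts b \<and> \<langle>r, x\<rangle> \<preceq>\<^sub>\<times> u \<and> PQ.forces_eq \<langle>r, x\<rangle> d c" and r': "r' \<preceq>\<^sub>P r"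
  then obtain d u where d: "\<langle>d, u\<rangle> \<in> elts b" "\<langle>r, x\<rangle> \<preceq>\<^sub>\<times> u" "PQ.forces_eq \<langle>r, x\<rangle> d c" by blast
  have "\<langle>r', x\<rangle> \<preceq>\<^sub>\<times> \<langle>r, x\<rangle>" using r' PQ.below_cond(1)[OF d(2)] by simp
  then show "\<exists>d u. \<langle>d, u\<rangle> \<in> elts b \<and> \<langle>r', x\<rangle> \<preceq>\<^sub>\<times> u \<and> PQ.forces_eq \<langle>r', x\<rangle> d c"
    using d PQ.below_trans PQ.forces_eq_mono by blast
qed

lemma uniform_ExistsEltAt_nest:
  assumes "PQ.is_name b" "P.uniform2 F"
  shows "P.uniform (\<lambda>x. ExistsEltAt check_leQ x (nest b) (F x))"
  by (intro P.uniformI fm_rel_intros P.fm_rel_uniform2[OF assms(2)])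
    (use is_name_nest[OF assms(1)] in auto)

lemma forces_DenseBelow_ExistsEltAt_nest:
  assumes b: "PQ.is_name b" and F: "P.uniform2 F"
    and F_iff: "\<And>r x d s t. r \<preceq>\<^sub>P p \<Longrightarrow> x \<preceq>\<^sub>Q q \<Longrightarrow> \<langle>d, \<langle>s, t\<rangle>\<rangle> \<in> elts b \<Longrightarrow> r \<preceq>\<^sub>P s \<Longrightarrow>
      r \<tturnstile>\<^sub>P F (check P x) (nest d) \<longleftrightarrow> PQ.forces_eq \<langle>r, x\<rangle> d c"
  shows "p \<tturnstile>\<^sub>P DenseBelow check_Q check_leQ (check P q)
    (\<lambda>x. ExistsEltAt check_leQ x (nest b) (F x)) \<longleftrightarrow> PQ.forces_mem \<langle>p, q\<rangle> c b"
proof -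
  have uniform: "P.uniform (F (check P x))" for x
    by (intro P.uniformI P.fm_rel_uniform2[OF F]) auto
  have "p \<tturnstile>\<^sub>P DenseBelow check_Q check_leQ (check P q) (\<lambda>x. ExistsEltAt check_leQ x (nest b) (F x)) \<longleftrightarrow>
      PQ.densely \<langle>p, q\<rangle> (\<lambda>w. \<exists>r x. w = \<langle>r, x\<rangle> \<and>
        r \<tturnstile>\<^sub>P ExistsEltAt check_leQ (check P x) (nest b) (F (check P x)))"
    by (rule forces_DenseBelow_check[OF P.is_name_check P.forces_eq_refl
          uniform_ExistsEltAt_nest[OF b F]])
  also have "\<dots> \<longleftrightarrow> PQ.densely \<langle>p, q\<rangle> (\<lambda>w. \<exists>r x. w = \<langle>r, x\<rangle> \<and>
      P.densely r (\<lambda>r. \<exists>d u. \<langle>d, u\<rangle> \<in> elts b \<and> \<langle>r, x\<rangle> \<preceq>\<^sub>\<times> u \<and> PQ.forces_eq \<langle>r, x\<rangle> d c))"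
  proof (rule PQ.densely_cong)
    fix w assume "w \<preceq>\<^sub>\<times> \<langle>p, q\<rangle>"
    then obtain r x where w: "w = \<langle>r, x\<rangle>" "r \<preceq>\<^sub>P p" "x \<preceq>\<^sub>Q q" by (rule below_PQ_cases)
    have "r \<tturnstile>\<^sub>P ExistsEltAt check_leQ (check P x) (nest b) (F (check P x)) \<longleftrightarrow>
        P.densely r (\<lambda>r. \<exists>d u. \<langle>d, u\<rangle> \<in> elts b \<and> \<langle>r, x\<rangle> \<preceq>\<^sub>\<times> u \<and> PQ.forces_eq \<langle>r, x\<rangle> d c)"
      by (rule forces_ExistsEltAt_nest[OF b uniform Q.below_cond(1)[OF w(3)]])
        (rule F_iff[OF P.below_trans[OF _ w(2)] w(3)])
    then show "(\<exists>r x. w = \<langle>r, x\<rangle> \<and>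
          r \<tturnstile>\<^sub>P ExistsEltAt check_leQ (check P x) (nest b) (F (check P x))) \<longleftrightarrow>
        (\<exists>r x. w = \<langle>r, x\<rangle> \<and>
          P.densely r (\<lambda>r. \<exists>d u. \<langle>d, u\<rangle> \<in> elts b \<and> \<langle>r, x\<rangle> \<preceq>\<^sub>\<times> u \<and> PQ.forces_eq \<langle>r, x\<rangle> d c))"
      by (simp add: w(1))
  qed
  finally show ?thesis unfolding PQ_densely_mem .
qed

lemma PQ_name_all_below_iff:
  assumes "PQ.is_name a"
  shows "(\<forall>c u w. \<langle>c, u\<rangle> \<in> elts a \<longrightarrow> w \<preceq>\<^sub>\<times> \<langle>p, q\<rangle> \<longrightarrow> w \<preceq>\<^sub>\<times> u \<longrightarrow> \<Phi> c w) \<longleftrightarrow>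
    (\<forall>c s t r. \<langle>c, \<langle>s, t\<rangle>\<rangle> \<in> elts a \<longrightarrow> r \<preceq>\<^sub>P p \<longrightarrow> r \<preceq>\<^sub>P s \<longrightarrow>
      (\<forall>x. x \<preceq>\<^sub>Q q \<longrightarrow> x \<preceq>\<^sub>Q t \<longrightarrow> \<Phi> c \<langle>r, x\<rangle>))" (is "_ \<longleftrightarrow> ?components")
proof (intro iffI allI impI)
  fix c u w
  assume components: ?components and c: "\<langle>c, u\<rangle> \<in> elts a" and w: "w \<preceq>\<^sub>\<times> \<langle>p, q\<rangle>" "w \<preceq>\<^sub>\<times> u"
  obtain s t where u: "u = \<langle>s, t\<rangle>" using assms c by (rule PQ_name_elt_cases)
  obtain r x where "w = \<langle>r, x\<rangle>" "r \<preceq>\<^sub>P p" "x \<preceq>\<^sub>Q q" using w(1) by (rule below_PQ_cases)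
  then show "\<Phi> c w" using components c w(2) unfolding u by simp
qed simp

lemma forces_ForcesSubClause_nest:
  assumes a: "PQ.is_name a" and b: "PQ.is_name b" and E: "P.is_name E"
    and F: "\<And>A r r' \<pi> \<pi>' \<sigma> \<sigma>'. (r, r') \<in> A \<Longrightarrow> (\<pi>, \<pi>') \<in> A \<Longrightarrow> (\<sigma>, \<sigma>') \<in> A \<Longrightarrow> (E, E) \<in> A \<Longrightarrow>
      fm_rel A (F r \<pi> \<sigma>) (F r' \<pi>' \<sigma>')"
    and F_iff: "\<And>r x c s t d s' t'. r \<preceq>\<^sub>P p \<Longrightarrow> x \<preceq>\<^sub>Q q \<Longrightarrow> \<langle>c, \<langle>s, t\<rangle>\<rangle> \<in> elts a \<Longrightarrow>
      \<langle>d, \<langle>s', t'\<rangle>\<rangle> \<in> elts b \<Longrightarrow> r \<preceq>\<^sub>P s \<Longrightarrow> r \<preceq>\<^sub>P s' \<Longrightarrow>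
      r \<tturnstile>\<^sub>P F (check P x) (nest c) (nest d) \<longleftrightarrow> PQ.forces_eq \<langle>r, x\<rangle> d c"
  shows "p \<tturnstile>\<^sub>P ForcesSubClause check_Q check_leQ F (check P q) (nest a) (nest b) \<longleftrightarrow>
    (\<forall>c u w. \<langle>c, u\<rangle> \<in> elts a \<longrightarrow> w \<preceq>\<^sub>\<times> \<langle>p, q\<rangle> \<longrightarrow> w \<preceq>\<^sub>\<times> u \<longrightarrow> PQ.forces_mem w c b)"
proof -
  define G where "G \<pi> x = ExistsEltAt check_leQ x (nest b) (F x \<pi>)" for \<pi> x
  define H where "H \<pi> s =
    DenseBelow check_Q check_leQ (check P q) (\<lambda>x. Imp (PairIn x s check_leQ) (G \<pi> x))" for \<pi> s
  have "P.uniform2 H"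
    unfolding H_def G_def
    by (intro P.uniform2I fm_rel_intros F) (use is_name_nest[OF b] E in auto)
  from forces_Forall_pair_nest[OF a this]
  have "p \<tturnstile>\<^sub>P ForcesSubClause check_Q check_leQ F (check P q) (nest a) (nest b) \<longleftrightarrow>
      (\<forall>c s t r. \<langle>c, \<langle>s, t\<rangle>\<rangle> \<in> elts a \<longrightarrow> r \<preceq>\<^sub>P p \<longrightarrow> r \<preceq>\<^sub>P s \<longrightarrow> r \<tturnstile>\<^sub>P H (nest c) (check P t))"
    by (simp add: ForcesSubClause_unfold H_def G_def)
  also have "\<dots> \<longleftrightarrow> (\<forall>c s t r. \<langle>c, \<langle>s, t\<rangle>\<rangle> \<in> elts a \<longrightarrow> r \<preceq>\<^sub>P p \<longrightarrow> r \<preceq>\<^sub>P s \<longrightarrow>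
      (\<forall>x. x \<preceq>\<^sub>Q q \<longrightarrow> x \<preceq>\<^sub>Q t \<longrightarrow> PQ.forces_mem \<langle>r, x\<rangle> c b))"
  proof (intro all_cong1 imp_cong refl)
    fix c s t r assume c: "\<langle>c, \<langle>s, t\<rangle>\<rangle> \<in> elts a" and r: "r \<preceq>\<^sub>P p" "r \<preceq>\<^sub>P s"
    have F_c: "P.uniform2 (\<lambda>x. F x (nest c))"
      by (intro P.uniform2I F) (use is_name_nest_component[OF a c] E in auto)
    have "r \<tturnstile>\<^sub>P DenseBelow check_Q check_leQ (check P x) (G (nest c)) \<longleftrightarrow> PQ.forces_mem \<langle>r, x\<rangle> c b"
      if x: "x \<preceq>\<^sub>Q q" for x
      unfolding G_def
    proof (rule forces_DenseBelow_ExistsEltAt_nest[OF b F_c])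
      fix r' x' d s' t'
      assume below: "r' \<preceq>\<^sub>P r" "x' \<preceq>\<^sub>Q x" and d: "\<langle>d, \<langle>s', t'\<rangle>\<rangle> \<in> elts b" "r' \<preceq>\<^sub>P s'"
      show "r' \<tturnstile>\<^sub>P F (check P x') (nest c) (nest d) \<longleftrightarrow> PQ.forces_eq \<langle>r', x'\<rangle> d c"
        by (rule F_iff[OF P.below_trans[OF below(1) r(1)] Q.below_trans[OF below(2) x] c d(1)
              P.below_trans[OF below(1) r(2)] d(2)])
    qed
    then show "r \<tturnstile>\<^sub>P H (nest c) (check P t) \<longleftrightarrow>
        (\<forall>x. x \<preceq>\<^sub>Q q \<longrightarrow> x \<preceq>\<^sub>Q t \<longrightarrow> PQ.forces_mem \<langle>r, x\<rangle> c b)"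
      using forces_DenseBelow_Imp_check[OF uniform_ExistsEltAt_nest[OF b F_c]]
      unfolding H_def G_def by blast
  qed
  finally show ?thesis unfolding PQ_name_all_below_iff[OF a] .
qed

lemma forces_ForcesEqClause_nest:
  assumes a: "PQ.is_name a" and b: "PQ.is_name b" and E: "P.is_name E"
    and E_iff: "\<And>r x c s t d s' t'. r \<preceq>\<^sub>P p \<Longrightarrow> x \<preceq>\<^sub>Q q \<Longrightarrow> \<langle>c, \<langle>s, t\<rangle>\<rangle> \<in> elts a \<Longrightarrow>
      \<langle>d, \<langle>s', t'\<rangle>\<rangle> \<in> elts b \<Longrightarrow> r \<preceq>\<^sub>P s \<Longrightarrow> r \<preceq>\<^sub>P s' \<Longrightarrow>
      P.forces_mem r (P.triple_name (check P x) (nest c) (nest d)) E \<longleftrightarrow> PQ.forces_eq \<langle>r, x\<rangle> c d"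
  shows "p \<tturnstile>\<^sub>P ForcesEqClause check_Q check_leQ E (check P q) (nest a) (nest b) \<longleftrightarrow>
    PQ.forces_eq \<langle>p, q\<rangle> a b"
proof -
  have TripleIn: "r \<tturnstile>\<^sub>P TripleIn (check P x) (nest c) (nest d) E \<longleftrightarrow> PQ.forces_eq \<langle>r, x\<rangle> c d"
    if "r \<preceq>\<^sub>P p" "x \<preceq>\<^sub>Q q" "\<langle>c, \<langle>s, t\<rangle>\<rangle> \<in> elts a" "\<langle>d, \<langle>s', t'\<rangle>\<rangle> \<in> elts b" "r \<preceq>\<^sub>P s" "r \<preceq>\<^sub>P s'"
    for r x c s t d s' t'
    using E_iff[OF that] E is_name_nest_component[OF a that(3)] is_name_nest_component[OF b that(4)]
    by (simp add: P.forces_TripleIn)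
  have "p \<tturnstile>\<^sub>P ForcesSubClause check_Q check_leQ (\<lambda>r \<pi> \<pi>'. TripleIn r \<pi> \<pi>' E)
      (check P q) (nest a) (nest b) \<longleftrightarrow>
    (\<forall>c u w. \<langle>c, u\<rangle> \<in> elts a \<longrightarrow> w \<preceq>\<^sub>\<times> \<langle>p, q\<rangle> \<longrightarrow> w \<preceq>\<^sub>\<times> u \<longrightarrow> PQ.forces_mem w c b)"
  proof (rule forces_ForcesSubClause_nest[OF a b E])
    fix r x c s t d s' t'
    assume "r \<preceq>\<^sub>P p" "x \<preceq>\<^sub>Q q" "\<langle>c, \<langle>s, t\<rangle>\<rangle> \<in> elts a" "\<langle>d, \<langle>s', t'\<rangle>\<rangle> \<in> elts b" "r \<preceq>\<^sub>P s" "r \<preceq>\<^sub>P s'"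
    from TripleIn[OF this]
    show "r \<tturnstile>\<^sub>P TripleIn (check P x) (nest c) (nest d) E \<longleftrightarrow> PQ.forces_eq \<langle>r, x\<rangle> d c"
      by (simp add: PQ.forces_eq_commute)
  qed (rule fm_rel_TripleIn)
  moreover have "p \<tturnstile>\<^sub>P ForcesSubClause check_Q check_leQ (\<lambda>r \<pi>' \<pi>. TripleIn r \<pi> \<pi>' E)
      (check P q) (nest b) (nest a) \<longleftrightarrow>
    (\<forall>c u w. \<langle>c, u\<rangle> \<in> elts b \<longrightarrow> w \<preceq>\<^sub>\<times> \<langle>p, q\<rangle> \<longrightarrow> w \<preceq>\<^sub>\<times> u \<longrightarrow> PQ.forces_mem w c a)"
  proof (rule forces_ForcesSubClause_nest[OF b a E])
    fix r x c s t d s' t'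
    assume "r \<preceq>\<^sub>P p" "x \<preceq>\<^sub>Q q" "\<langle>c, \<langle>s, t\<rangle>\<rangle> \<in> elts b" "\<langle>d, \<langle>s', t'\<rangle>\<rangle> \<in> elts a" "r \<preceq>\<^sub>P s" "r \<preceq>\<^sub>P s'"
    then show "r \<tturnstile>\<^sub>P TripleIn (check P x) (nest d) (nest c) E \<longleftrightarrow> PQ.forces_eq \<langle>r, x\<rangle> d c"
      by (intro TripleIn)
  qed (rule fm_rel_TripleIn)
  ultimately show ?thesis
    unfolding ForcesEqClause_def P.forces_Conj PQ.forces_eq_iff[of "\<langle>p, q\<rangle>" a b] by blast
qed

lemma forces_NameClosedD:
  assumes "p \<tturnstile>\<^sub>P NameClosed check_Q D" and D: "P.is_name D" and x: "P.is_name x"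
    and z: "P.is_name z" and mem: "P.forces_mem p x D" "P.forces_mem p z x"
  shows "P.densely p (\<lambda>r. \<exists>\<sigma> t. P.is_name \<sigma> \<and> t \<in> elts Q \<and> P.forces_mem r \<sigma> D \<and>
    P.forces_eq r z (P.pair_name \<sigma> (check P t)))"
proof (cases "p \<in> elts P")
  case True
  have pp: "p \<preceq>\<^sub>P p" using True by simp
  note P.forces_BForallD[OF assms(1)[unfolded NameClosed_def] D x pp mem(1)]
  from P.forces_BForallD[OF this x z pp mem(2)]
  have "p \<tturnstile>\<^sub>P BExists D (\<lambda>\<sigma>. BExists check_Q (\<lambda>p. IsPair \<sigma> p z))" .
  then show ?thesis
    unfolding P.forces_BExists[OF D]
  proof (rule P.densely_bind, elim exE conjE)
    fix q \<sigma> assume \<sigma>: "P.is_name \<sigma>" "P.forces_mem q \<sigma> D" "q \<tturnstile>\<^sub>P BExists check_Q (\<lambda>p. IsPair \<sigma> p z)"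
    have "P.densely q (\<lambda>r. \<exists>t\<in>elts Q. r \<tturnstile>\<^sub>P IsPair \<sigma> (check P t) z)"
      using \<sigma>(3) by (subst (asm) P.forces_BExists_check)
        (use \<sigma>(1) z in \<open>auto intro!: P.uniformI fm_rel_intros\<close>)
    then show "P.densely q (\<lambda>r. \<exists>\<sigma> t. P.is_name \<sigma> \<and> t \<in> elts Q \<and> P.forces_mem r \<sigma> D \<and>
        P.forces_eq r z (P.pair_name \<sigma> (check P t)))"
    proof (elim P.densely_mono bexE)
      fix r t assume "r \<preceq>\<^sub>P q" "t \<in> elts Q" "r \<tturnstile>\<^sub>P IsPair \<sigma> (check P t) z"
      then show "\<exists>\<sigma> t. P.is_name \<sigma> \<and> t \<in> elts Q \<and> P.forces_mem r \<sigma> D \<and>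
          P.forces_eq r z (P.pair_name \<sigma> (check P t))"
        using \<sigma>(1) z P.forces_mem_mono[OF \<sigma>(2)] by (auto simp: P.forces_IsPair)
    qed
  qed
next
  case False
  then show ?thesis using P.below_cond(2) unfolding P.densely_def by blast
qed

lemma nest_mem_NameClosed:
  assumes "p \<tturnstile>\<^sub>P NameClosed check_Q D" "P.is_name D" "PQ.is_name c"
    and "P.forces_mem p (nest c) D" and e: "\<langle>e, \<langle>s, t\<rangle>\<rangle> \<in> elts c" "p \<preceq>\<^sub>P s"
  shows "P.forces_mem p (nest e) D"
proof -
  have "P.is_name (P.pair_name (nest e) (check P t))"
    using is_name_nest_component[OF assms(3) e(1)] by simp
  from forces_NameClosedD[OF assms(1,2) is_name_nest[OF assms(3)] this assms(4)
      forces_mem_nestI[OF e]]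
  have "P.densely p (\<lambda>r. P.forces_mem r (nest e) D)"
  proof (elim P.densely_mono exE conjE)
    fix r \<sigma> t' assume \<sigma>: "P.forces_mem r \<sigma> D"
      "P.forces_eq r (P.pair_name (nest e) (check P t)) (P.pair_name \<sigma> (check P t'))"
    show "P.forces_mem r (nest e) D"
      using P.forces_mem_cong_left[OF P.forces_eq_sym[OF P.pair_name_eq_fstD[OF \<sigma>(2)]] \<sigma>(1)] .
  qed
  then show ?thesis by simp
qed

lemma EqRecursion_nest_unique:
  assumes D: "P.is_name D" and E: "P.is_name E" and closed: "r \<tturnstile>\<^sub>P NameClosed check_Q D"
    and rec: "r \<tturnstile>\<^sub>P EqRecursion check_Q check_leQ D E"
  shows "PQ.is_name c \<Longrightarrow> PQ.is_name d \<Longrightarrow> p \<preceq>\<^sub>P r \<Longrightarrow> q \<in> elts Q \<Longrightarrow>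
    P.forces_mem p (nest c) D \<Longrightarrow> P.forces_mem p (nest d) D \<Longrightarrow>
    P.forces_mem p (P.triple_name (check P q) (nest c) (nest d)) E \<longleftrightarrow> PQ.forces_eq \<langle>p, q\<rangle> c d"
proof (induction c arbitrary: p q d rule: trcl_induct)
  case (step c)
  note c = step.prems(1) and d = step.prems(2) and p = step.prems(3) and q = step.prems(4)
    and mem = step.prems(5,6)
  have pp: "p \<preceq>\<^sub>P p" using p P.below_cond P.below_refl by blast
  note names = is_name_nest[OF c] is_name_nest[OF d]
  note P.forces_BForallD[OF rec[unfolded EqRecursion_def] P.is_name_check P.is_name_check p
      P.forces_mem_checkI[OF q]]
  note P.forces_BForallD[OF this D names(1) pp mem(1)]
  from P.forces_BForallD[OF this D names(2) pp mem(2)]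
  have "p \<tturnstile>\<^sub>P TripleIn (check P q) (nest c) (nest d) E \<longleftrightarrow>
      p \<tturnstile>\<^sub>P ForcesEqClause check_Q check_leQ E (check P q) (nest c) (nest d)"
    unfolding P.forces_Iff using pp by blast
  also have "\<dots> \<longleftrightarrow> PQ.forces_eq \<langle>p, q\<rangle> c d"
  proof (rule forces_ForcesEqClause_nest[OF c d E])
    fix p' x e s t f s' t'
    assume e: "\<langle>e, \<langle>s, t\<rangle>\<rangle> \<in> elts c" "p' \<preceq>\<^sub>P s" and f: "\<langle>f, \<langle>s', t'\<rangle>\<rangle> \<in> elts d" "p' \<preceq>\<^sub>P s'"
      and p': "p' \<preceq>\<^sub>P p" and x: "x \<preceq>\<^sub>Q q"
    have p'r: "p' \<preceq>\<^sub>P r" using p' p by (rule P.below_trans)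
    note closed' = P.forces_mono[OF closed p'r]
    have "P.forces_mem p' (nest e) D" "P.forces_mem p' (nest f) D"
      using nest_mem_NameClosed[OF closed' D c P.forces_mem_mono[OF mem(1) p'] e]
        nest_mem_NameClosed[OF closed' D d P.forces_mem_mono[OF mem(2) p'] f] .
    then show "P.forces_mem p' (P.triple_name (check P x) (nest e) (nest f)) E \<longleftrightarrow>
        PQ.forces_eq \<langle>p', x\<rangle> e f"
      using step.IH[OF vpair_mem_trcl(1)[OF e(1)]] PQ.is_name_pairD(1)[OF c e(1)]
        PQ.is_name_pairD(1)[OF d f(1)] p'r Q.below_cond(1)[OF x] by blast
  qed
  finally show ?case using names E by (simp add: P.forces_TripleIn)
qed

definition closed_names :: "'v set \<Rightarrow> bool" where
  "closed_names A \<longleftrightarrow> small A \<and> (\<forall>c\<in>A. PQ.is_name c \<and> (\<forall>e u. \<langle>e, u\<rangle> \<in> elts c \<longrightarrow> e \<in> A))"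

lemma closed_namesD:
  assumes "closed_names A"
  shows "small A" "c \<in> A \<Longrightarrow> PQ.is_name c" "c \<in> A \<Longrightarrow> \<langle>e, u\<rangle> \<in> elts c \<Longrightarrow> e \<in> A"
    "small (nest ` A)" "c \<in> A \<Longrightarrow> P.is_name (nest c)"
  using assms is_name_nest unfolding closed_names_def by blast+

lemma closed_names_subnames: "closed_names (PQ.subnames a \<union> PQ.subnames b)"
  unfolding closed_names_def
  using PQ.subnames_step PQ.subnames_is_name PQ.small_subnames by blast

lemma forces_NameClosed_family_name:
  assumes A: "closed_names A"
  shows "p \<tturnstile>\<^sub>P NameClosed check_Q (P.family_name A nest)"
proof -
  let ?D = "P.family_name A nest"
  note A_nest = closed_namesD(4)[OF A] closed_namesD(5)[OF A]
  have D: "P.is_name ?D" by (rule P.is_name_family_name[OF A_nest])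
  have "p \<tturnstile>\<^sub>P BForall (nest c) (\<lambda>z. BExists ?D (\<lambda>\<sigma>. BExists check_Q (\<lambda>p. IsPair \<sigma> p z)))"
    if c: "c \<in> A" for c
  proof (subst P.forces_BForall_uniform)
    show "P.is_name (nest c)" using A_nest(2) c .
    show "P.uniform (\<lambda>z. BExists ?D (\<lambda>\<sigma>. BExists check_Q (\<lambda>p. IsPair \<sigma> p z)))"
      by (intro P.uniformI fm_rel_intros) (use D in auto)
    show "\<forall>\<pi> s q. \<langle>\<pi>, s\<rangle> \<in> elts (nest c) \<longrightarrow> q \<preceq>\<^sub>P p \<longrightarrow> q \<preceq>\<^sub>P s \<longrightarrow>
        q \<tturnstile>\<^sub>P BExists ?D (\<lambda>\<sigma>. BExists check_Q (\<lambda>p. IsPair \<sigma> p \<pi>))"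
    proof (intro allI impI)
      fix \<pi> s q assume "\<langle>\<pi>, s\<rangle> \<in> elts (nest c)"
      then obtain e u t where e: "\<langle>e, \<langle>u, t\<rangle>\<rangle> \<in> elts c" "\<pi> = P.pair_name (nest e) (check P t)"
        unfolding vpair_mem_nest by blast
      have "e \<in> A" "t \<in> elts Q"
        using closed_namesD[OF A] c e(1) PQ.is_name_pairD(2)[OF _ e(1)] by auto
      moreover from this have "P.is_name (nest e)" using A_nest(2) by blast
      ultimately show "q \<tturnstile>\<^sub>P BExists ?D (\<lambda>\<sigma>. BExists check_Q (\<lambda>p. IsPair \<sigma> p \<pi>))"
        using D e(2) P.forces_mem_family_nameI[OF A_nest(1)] P.forces_mem_checkI[of t Q]
        by (intro P.forces_BExistsI[of _ "nest e"] P.forces_BExistsI[of _ "check P t"])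
          (simp_all add: P.forces_IsPair)
    qed
  qed
  then show ?thesis
    unfolding NameClosed_def
    by (subst P.forces_BForall_family_name[OF A_nest])
      (use D in \<open>auto intro!: P.uniformI fm_rel_intros\<close>)
qed

text \<open>A name for the restriction of the forcing relation of \<open>Q\<close> between the names in \<^term>\<open>A\<close>.\<close>

definition eq_name :: "'v set \<Rightarrow> 'v" where
  "eq_name A = P.set_name (elts Q \<times> A \<times> A)
     (\<lambda>(q, c, d). P.triple_name (check P q) (nest c) (nest d))
     (\<lambda>(q, c, d) p. PQ.forces_eq \<langle>p, q\<rangle> c d)"

lemma small_triple_names:
  assumes "closed_names A"
  shows "small ((\<lambda>(q, c, d). P.triple_name (check P q) (nest c) (nest d)) ` (elts Q \<times> A \<times> A))"
proof -
  have "small {P.triple_name (check P q) (nest c) (nest d) |q c d. q \<in> elts Q \<and> c \<in> A \<and> d \<in> A}"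
    using closed_namesD(1)[OF assms] by (intro small_image3) auto
  then show ?thesis by (rule small_subset) auto
qed

lemma is_name_eq_name: "closed_names A \<Longrightarrow> P.is_name (eq_name A)"
  unfolding eq_name_def
  by (rule P.is_name_set_name[OF small_triple_names])
    (auto intro!: P.is_name_triple_name intro: closed_namesD(5))

lemma forces_mem_eq_name:
  assumes "closed_names A"
  shows "P.forces_mem p \<tau> (eq_name A) \<longleftrightarrow>
    P.densely p (\<lambda>r. \<exists>q\<in>elts Q. \<exists>c\<in>A. \<exists>d\<in>A. PQ.forces_eq \<langle>r, q\<rangle> c d \<and>
      P.forces_eq r \<tau> (P.triple_name (check P q) (nest c) (nest d)))"
proof -
  have "P.forces_mem p \<tau> (eq_name A) \<longleftrightarrow> P.densely p (\<lambda>r. \<exists>i\<in>elts Q \<times> A \<times> A.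
      (case i of (q, c, d) \<Rightarrow> \<lambda>r. PQ.forces_eq \<langle>r, q\<rangle> c d) r \<and>
      P.forces_eq r \<tau> ((\<lambda>(q, c, d). P.triple_name (check P q) (nest c) (nest d)) i))"
    unfolding eq_name_def
    by (rule P.forces_mem_set_name[OF small_triple_names[OF assms]]) (auto elim!: PQ.forces_eq_mono)
  then show ?thesis by simp
qed

lemma forces_triple_mem_eq_name:
  assumes A: "closed_names A" and q: "q \<in> elts Q" and cd: "c \<in> A" "d \<in> A"
  shows "P.forces_mem p (P.triple_name (check P q) (nest c) (nest d)) (eq_name A) \<longleftrightarrow>
    PQ.forces_eq \<langle>p, q\<rangle> c d"
  unfolding forces_mem_eq_name[OF A]
proof
  assume "P.densely p (\<lambda>r. \<exists>q'\<in>elts Q. \<exists>c'\<in>A. \<exists>d'\<in>A. PQ.forces_eq \<langle>r, q'\<rangle> c' d' \<and>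
    P.forces_eq r (P.triple_name (check P q) (nest c) (nest d))
      (P.triple_name (check P q') (nest c') (nest d')))"
  then have "P.densely p (\<lambda>r. PQ.forces_eq \<langle>r, q\<rangle> c d)"
  proof (elim P.densely_mono bexE conjE)
    fix r q' c' d' assume r: "r \<preceq>\<^sub>P p" and "c' \<in> A" "d' \<in> A" and eq': "PQ.forces_eq \<langle>r, q'\<rangle> c' d'"
      and eq: "P.forces_eq r (P.triple_name (check P q) (nest c) (nest d))
        (P.triple_name (check P q') (nest c') (nest d'))"
    have "q = q'"
      using P.triple_name_eqD(1)[OF eq] P.forces_eq_check_iff[OF P.below_cond(1)[OF r]] by blast
    moreover have "PQ.forces_eq \<langle>r, q\<rangle> c c'" "PQ.forces_eq \<langle>r, q\<rangle> d d'"
      using forces_eq_of_nest P.triple_name_eqD(2,3)[OF eq] closed_namesD(2)[OF A] q cd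
        \<open>c' \<in> A\<close> \<open>d' \<in> A\<close> by blast+
    ultimately show "PQ.forces_eq \<langle>r, q\<rangle> c d"
      using eq' PQ.forces_eq_trans PQ.forces_eq_sym by blast
  qed
  then show "PQ.forces_eq \<langle>p, q\<rangle> c d" by (rule PQ_forces_eq_densely_left)
next
  assume eq: "PQ.forces_eq \<langle>p, q\<rangle> c d"
  have "PQ.forces_eq \<langle>r, q\<rangle> c d" if "r \<preceq>\<^sub>P p" for r
    using PQ.forces_eq_mono[OF eq, of "\<langle>r, q\<rangle>"] that q by simp
  then show "P.densely p (\<lambda>r. \<exists>q'\<in>elts Q. \<exists>c'\<in>A. \<exists>d'\<in>A. PQ.forces_eq \<langle>r, q'\<rangle> c' d' \<and>
      P.forces_eq r (P.triple_name (check P q) (nest c) (nest d))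
        (P.triple_name (check P q') (nest c') (nest d')))"
    using q cd P.forces_eq_refl by (intro P.densely_all) blast
qed

lemma forces_EqRecursion_eq_name:
  assumes A: "closed_names A"
  shows "p \<tturnstile>\<^sub>P EqRecursion check_Q check_leQ (P.family_name A nest) (eq_name A)"
proof -
  let ?D = "P.family_name A nest" and ?E = "eq_name A"
  note A_nest = closed_namesD(4)[OF A] closed_namesD(5)[OF A]
  have D: "P.is_name ?D" by (rule P.is_name_family_name[OF A_nest])
  note E = is_name_eq_name[OF A]
  have iff: "p \<tturnstile>\<^sub>P Iff (TripleIn (check P q) (nest c) (nest d) ?E)
      (ForcesEqClause check_Q check_leQ ?E (check P q) (nest c) (nest d))"
    if q: "q \<in> elts Q" and c: "c \<in> A" and d: "d \<in> A" for q c d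
    unfolding P.forces_Iff
  proof (intro allI impI)
    fix r
    have "r \<tturnstile>\<^sub>P ForcesEqClause check_Q check_leQ ?E (check P q) (nest c) (nest d) \<longleftrightarrow>
        PQ.forces_eq \<langle>r, q\<rangle> c d"
    proof (rule forces_ForcesEqClause_nest[OF closed_namesD(2)[OF A c] closed_namesD(2)[OF A d] E])
      fix r' x e s t f s' t'
      assume "x \<preceq>\<^sub>Q q" "\<langle>e, \<langle>s, t\<rangle>\<rangle> \<in> elts c" "\<langle>f, \<langle>s', t'\<rangle>\<rangle> \<in> elts d"
      then show "P.forces_mem r' (P.triple_name (check P x) (nest e) (nest f)) ?E \<longleftrightarrow>
          PQ.forces_eq \<langle>r', x\<rangle> e f"
        using forces_triple_mem_eq_name[OF A] closed_namesD(3)[OF A] c d Q.below_cond(1) by blast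
    qed
    then show "r \<tturnstile>\<^sub>P TripleIn (check P q) (nest c) (nest d) ?E \<longleftrightarrow>
        r \<tturnstile>\<^sub>P ForcesEqClause check_Q check_leQ ?E (check P q) (nest c) (nest d)"
      using forces_triple_mem_eq_name[OF A q c d] A_nest(2) c d E by (simp add: P.forces_TripleIn)
  qed
  have "p \<tturnstile>\<^sub>P BForall ?D (\<lambda>y. Iff (TripleIn (check P q) (nest c) y ?E)
      (ForcesEqClause check_Q check_leQ ?E (check P q) (nest c) y))" if "q \<in> elts Q" "c \<in> A" for q c
    by (subst P.forces_BForall_family_name[OF A_nest])
      (use that A_nest(2) E iff in \<open>auto intro!: P.uniformI fm_rel_intros\<close>)
  then have "p \<tturnstile>\<^sub>P BForall ?D (\<lambda>x. BForall ?D (\<lambda>y. Iff (TripleIn (check P q) x y ?E)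
      (ForcesEqClause check_Q check_leQ ?E (check P q) x y)))" if "q \<in> elts Q" for q
    by (subst P.forces_BForall_family_name[OF A_nest])
      (use that E D in \<open>auto intro!: P.uniformI fm_rel_intros\<close>)
  then show ?thesis
    unfolding EqRecursion_def
    by (subst P.forces_BForall_check) (use E D in \<open>auto intro!: P.uniformI fm_rel_intros\<close>)
qed

lemma forces_eq_of_ForcesEq_nest:
  assumes a: "PQ.is_name a" and b: "PQ.is_name b" and q: "q \<in> elts Q"
    and "p \<tturnstile>\<^sub>P ForcesEq check_Q check_leQ (check P q) (nest a) (nest b)"
  shows "PQ.forces_eq \<langle>p, q\<rangle> a b"
proof -
  note names = is_name_nest[OF a] is_name_nest[OF b]
  from assms(4) have "P.densely p (\<lambda>r. PQ.forces_eq \<langle>r, q\<rangle> a b)"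
    unfolding ForcesEq_unfold P.forces_Exists[where p = p]
  proof (rule P.densely_bind, elim exE conjE)
    fix r D assume D: "P.is_name D" and "r \<tturnstile>\<^sub>P Exists (\<lambda>E. Conj (NameClosed check_Q D)
      (Conj (Mem (nest a) D) (Conj (Mem (nest b) D) (Conj (EqRecursion check_Q check_leQ D E)
        (TripleIn (check P q) (nest a) (nest b) E)))))"
    from this(2) show "P.densely r (\<lambda>r. PQ.forces_eq \<langle>r, q\<rangle> a b)"
      unfolding P.forces_Exists
    proof (elim P.densely_mono exE conjE)
      fix r' E assume r': "r' \<preceq>\<^sub>P r" and E: "P.is_name E" and "r' \<tturnstile>\<^sub>P Conj (NameClosed check_Q D)
        (Conj (Mem (nest a) D) (Conj (Mem (nest b) D) (Conj (EqRecursion check_Q check_leQ D E)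
          (TripleIn (check P q) (nest a) (nest b) E))))"
      then have closed: "r' \<tturnstile>\<^sub>P NameClosed check_Q D"
        and mem: "P.forces_mem r' (nest a) D" "P.forces_mem r' (nest b) D"
        and rec: "r' \<tturnstile>\<^sub>P EqRecursion check_Q check_leQ D E"
        and eq: "P.forces_mem r' (P.triple_name (check P q) (nest a) (nest b)) E"
        using names D E by (simp_all add: P.forces_Conj P.forces_Mem P.forces_TripleIn)
      have "r' \<preceq>\<^sub>P r'" using r' P.below_cond P.below_refl by blast
      from EqRecursion_nest_unique[OF D E closed rec a b this q mem] eq
      show "PQ.forces_eq \<langle>r', q\<rangle> a b" by blast
    qed
  qed
  then show ?thesis by (rule PQ_forces_eq_densely_left)
qed

lemma forces_ForcesEq_nest_of_eq:
  assumes a: "PQ.is_name a" and b: "PQ.is_name b" and q: "q \<in> elts Q"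
    and eq: "PQ.forces_eq \<langle>p, q\<rangle> a b"
  shows "p \<tturnstile>\<^sub>P ForcesEq check_Q check_leQ (check P q) (nest a) (nest b)"
proof -
  define A where "A = PQ.subnames a \<union> PQ.subnames b"
  have A: "closed_names A" unfolding A_def by (rule closed_names_subnames)
  have ab: "a \<in> A" "b \<in> A" using a b PQ.subnames_self by (auto simp: A_def)
  note A_nest = closed_namesD(4)[OF A] closed_namesD(5)[OF A]
  have D: "P.is_name (P.family_name A nest)" by (rule P.is_name_family_name[OF A_nest])
  note E = is_name_eq_name[OF A]
  have "p \<tturnstile>\<^sub>P Mem (nest a) (P.family_name A nest)" "p \<tturnstile>\<^sub>P Mem (nest b) (P.family_name A nest)"
    using P.forces_mem_family_nameI[OF A_nest(1)] ab A_nest by (simp_all add: P.forces_Mem D)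
  moreover have "p \<tturnstile>\<^sub>P TripleIn (check P q) (nest a) (nest b) (eq_name A)"
    using eq forces_triple_mem_eq_name[OF A q ab] ab A_nest(2) E by (simp add: P.forces_TripleIn)
  ultimately show ?thesis
    unfolding ForcesEq_unfold
    using forces_NameClosed_family_name[OF A] forces_EqRecursion_eq_name[OF A]
    by (intro P.forces_ExistsI[OF D] P.forces_ExistsI[OF E]) (simp add: P.forces_Conj)
qed

lemma forces_ForcesMem_nest:
  assumes a: "PQ.is_name a" and b: "PQ.is_name b"
  shows "p \<tturnstile>\<^sub>P ForcesMem check_Q check_leQ (check P q) (nest a) (nest b) \<longleftrightarrow>
    PQ.forces_mem \<langle>p, q\<rangle> a b"
  unfolding ForcesMem_unfold
proof (rule forces_DenseBelow_ExistsEltAt_nest[OF b])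
  show "P.uniform2 (\<lambda>x \<pi>. ForcesEq check_Q check_leQ x \<pi> (nest a))"
    by (intro P.uniform2I fm_rel_intros) (use is_name_nest[OF a] in auto)
  fix r x d s t assume "x \<preceq>\<^sub>Q q" "\<langle>d, \<langle>s, t\<rangle>\<rangle> \<in> elts b"
  then show "r \<tturnstile>\<^sub>P ForcesEq check_Q check_leQ (check P x) (nest d) (nest a) \<longleftrightarrow>
      PQ.forces_eq \<langle>r, x\<rangle> d a"
    using forces_eq_of_ForcesEq_nest forces_ForcesEq_nest_of_eq a PQ.is_name_pairD(1)[OF b]
      Q.below_cond(1) by blast
qed

lemma forces_IsName_nest:
  assumes a: "PQ.is_name a"
  shows "p \<tturnstile>\<^sub>P IsName check_Q (nest a)"
proof -
  let ?A = "PQ.subnames a \<union> PQ.subnames a"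
  have A: "closed_names ?A" by (rule closed_names_subnames)
  note A_nest = closed_namesD(4)[OF A] closed_namesD(5)[OF A]
  have D: "P.is_name (P.family_name ?A nest)" by (rule P.is_name_family_name[OF A_nest])
  have "P.forces_mem p (nest a) (P.family_name ?A nest)"
    using P.forces_mem_family_nameI[OF A_nest(1)] PQ.subnames_self[OF a] by blast
  then show ?thesis
    unfolding IsName_def using forces_NameClosed_family_name[OF A] is_name_nest[OF a] D
    by (intro P.forces_ExistsI[OF D]) (simp add: P.forces_Conj P.forces_Mem)
qed

lemma forces_IsName_elt:
  assumes \<tau>: "p \<tturnstile>\<^sub>P IsName check_Q \<tau>" "P.is_name \<tau>" and z: "\<langle>z, s\<rangle> \<in> elts \<tau>" "p \<preceq>\<^sub>P s"
  shows "P.densely p (\<lambda>r. \<exists>\<rho>\<in>trcl \<tau>. \<exists>x\<in>elts Q. P.is_name \<rho> \<and> r \<tturnstile>\<^sub>P IsName check_Q \<rho> \<and>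
    P.forces_eq r z (P.pair_name \<rho> (check P x)))"
  using \<tau>(1)[unfolded IsName_def P.forces_Exists]
proof (rule P.densely_bind, elim exE conjE)
  fix q D assume q: "q \<preceq>\<^sub>P p" and D: "P.is_name D" and "q \<tturnstile>\<^sub>P Conj (NameClosed check_Q D) (Mem \<tau> D)"
  then have closed: "q \<tturnstile>\<^sub>P NameClosed check_Q D" and mem: "P.forces_mem q \<tau> D"
    using \<tau>(2) by (auto simp: P.forces_Conj P.forces_Mem)
  have name_z: "P.is_name z" using P.is_name_pairD(1)[OF \<tau>(2) z(1)] .
  have "P.forces_mem q z \<tau>" using P.forces_mem_elt[OF z(1) P.below_trans[OF q z(2)]] .
  from forces_NameClosedD[OF closed D \<tau>(2) name_z mem this]
  show "P.densely q (\<lambda>r. \<exists>\<rho>\<in>trcl \<tau>. \<exists>x\<in>elts Q. P.is_name \<rho> \<and> r \<tturnstile>\<^sub>P IsName check_Q \<rho> \<and>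
      P.forces_eq r z (P.pair_name \<rho> (check P x)))"
  proof (rule P.densely_bind, elim exE conjE)
    fix q\<^sub>1 \<sigma> x assume q\<^sub>1: "q\<^sub>1 \<preceq>\<^sub>P q" and x: "x \<in> elts Q" and \<sigma>: "P.forces_mem q\<^sub>1 \<sigma> D"
      "P.forces_eq q\<^sub>1 z (P.pair_name \<sigma> (check P x))"
    show "P.densely q\<^sub>1 (\<lambda>r. \<exists>\<rho>\<in>trcl \<tau>. \<exists>x\<in>elts Q. P.is_name \<rho> \<and> r \<tturnstile>\<^sub>P IsName check_Q \<rho> \<and>
        P.forces_eq r z (P.pair_name \<rho> (check P x)))"
      using P.densely_ex_component_of_pair_name[OF name_z \<sigma>(2)]
    proof (elim P.densely_mono bexE conjE)
      fix r \<rho> assume r: "r \<preceq>\<^sub>P q\<^sub>1" and \<rho>: "\<rho> \<in> trcl z" "P.is_name \<rho>" "P.forces_eq r \<rho> \<sigma>"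
      have "P.forces_mem r \<rho> D"
        using P.forces_mem_cong_left[OF P.forces_eq_sym[OF \<rho>(3)] P.forces_mem_mono[OF \<sigma>(1) r]] .
      then have "r \<tturnstile>\<^sub>P Conj (NameClosed check_Q D) (Mem \<rho> D)"
        using P.forces_mono[OF closed P.below_trans[OF r q\<^sub>1]] \<rho>(2) D
        by (simp add: P.forces_Conj P.forces_Mem)
      then have "r \<tturnstile>\<^sub>P IsName check_Q \<rho>" unfolding IsName_def by (rule P.forces_ExistsI[OF D])
      moreover have "P.forces_eq r z (P.pair_name \<rho> (check P x))"
        using P.forces_eq_mono[OF \<sigma>(2) r]
          P.pair_name_cong[OF P.forces_eq_sym[OF \<rho>(3)] P.forces_eq_refl]
        by (rule P.forces_eq_trans)
      moreover have "\<rho> \<in> trcl \<tau>" using trcl_trans[OF \<rho>(1) vpair_mem_trcl(1)[OF z(1)]] .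
      ultimately show "\<exists>\<rho>\<in>trcl \<tau>. \<exists>x\<in>elts Q. P.is_name \<rho> \<and> r \<tturnstile>\<^sub>P IsName check_Q \<rho> \<and>
          P.forces_eq r z (P.pair_name \<rho> (check P x))"
        using \<rho>(2) x by blast
    qed
  qed
qed

subsection \<open>Arbitrary formulas\<close>

definition represents :: "'v \<Rightarrow> 'v \<Rightarrow> 'v \<Rightarrow> bool" where
  "represents p \<tau> a \<longleftrightarrow> P.is_name \<tau> \<and> PQ.is_name a \<and> P.forces_eq p \<tau> (nest a)"

lemma representsD:
  assumes "represents p \<tau> a"
  shows "P.is_name \<tau>" "PQ.is_name a" "P.forces_eq p \<tau> (nest a)"
  using assms by (simp_all add: represents_def)

lemma represents_mono: "represents p \<tau> a \<Longrightarrow> q \<preceq>\<^sub>P p \<Longrightarrow> represents q \<tau> a"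
  unfolding represents_def using P.forces_eq_mono by blast

lemma represents_nest: "PQ.is_name a \<Longrightarrow> represents p (nest a) a"
  by (simp add: represents_def is_name_nest P.forces_eq_refl)

text \<open>The name with the largest interpretation contained in \<^term>\<open>\<tau>\<close> among those that are built from
  the elements of \<^term>\<open>Z\<close>.\<close>

definition collapse :: "'v set \<Rightarrow> 'v \<Rightarrow> 'v" where
  "collapse Z \<tau> = vset {\<langle>b, \<langle>r, x\<rangle>\<rangle> |b r x. b \<in> Z \<and> r \<in> elts P \<and> x \<in> elts Q \<and> PQ.is_name b \<and>
     P.forces_mem r (P.pair_name (nest b) (check P x)) \<tau>}"

lemma elts_collapse:
  assumes "small Z"
  shows "elts (collapse Z \<tau>) = {\<langle>b, \<langle>r, x\<rangle>\<rangle> |b r x. b \<in> Z \<and> r \<in> elts P \<and> x \<in> elts Q \<and> PQ.is_name b \<and>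
    P.forces_mem r (P.pair_name (nest b) (check P x)) \<tau>}"
proof -
  have "small {\<langle>b, \<langle>r, x\<rangle>\<rangle> |b r x. b \<in> Z \<and> r \<in> elts P \<and> x \<in> elts Q}"
    using assms by (intro small_image3 small_elts)
  then show ?thesis unfolding collapse_def by (intro elts_vset) (auto elim: small_subset)
qed

lemma is_name_collapse: "small Z \<Longrightarrow> PQ.is_name (collapse Z \<tau>)"
  by (rule PQ.is_nameI) (auto simp: elts_collapse)

lemma forces_eq_nest_collapse:
  assumes \<tau>: "P.is_name \<tau>" "p \<tturnstile>\<^sub>P IsName check_Q \<tau>" and Z: "small Z"
    and ex_rep: "\<And>r \<rho>. \<rho> \<in> trcl \<tau> \<Longrightarrow> P.is_name \<rho> \<Longrightarrow> r \<in> elts P \<Longrightarrow> r \<tturnstile>\<^sub>P IsName check_Q \<rho> \<Longrightarrow>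
      \<exists>b\<in>Z. represents r \<rho> b"
  shows "P.forces_eq p \<tau> (nest (collapse Z \<tau>))"
  unfolding P.forces_eq_iff
proof (intro conjI allI impI)
  fix z s q assume z: "\<langle>z, s\<rangle> \<in> elts \<tau>" "q \<preceq>\<^sub>P p" "q \<preceq>\<^sub>P s"
  have "P.densely q (\<lambda>r. P.forces_mem r z (nest (collapse Z \<tau>)))"
    using forces_IsName_elt[OF P.forces_mono[OF \<tau>(2) z(2)] \<tau>(1) z(1,3)]
  proof (elim P.densely_mono bexE conjE)
    fix r \<rho> x assume r: "r \<preceq>\<^sub>P q" and \<rho>: "\<rho> \<in> trcl \<tau>" "P.is_name \<rho>" "r \<tturnstile>\<^sub>P IsName check_Q \<rho>"
      and x: "x \<in> elts Q" and eq: "P.forces_eq r z (P.pair_name \<rho> (check P x))"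
    have r_P: "r \<in> elts P" using P.below_cond(1)[OF r] .
    obtain b where b: "b \<in> Z" "represents r \<rho> b" using ex_rep[OF \<rho>(1,2) r_P \<rho>(3)] by blast
    have eq': "P.forces_eq r z (P.pair_name (nest b) (check P x))"
      using eq P.pair_name_cong[OF representsD(3)[OF b(2)] P.forces_eq_refl]
      by (rule P.forces_eq_trans)
    have "P.forces_mem r (P.pair_name (nest b) (check P x)) \<tau>"
      using P.forces_mem_cong_left[OF eq'] P.forces_mem_elt[OF z(1) P.below_trans[OF r z(3)]] .
    then have "\<langle>b, \<langle>r, x\<rangle>\<rangle> \<in> elts (collapse Z \<tau>)"
      using b(1) representsD(2)[OF b(2)] r_P x by (simp add: elts_collapse[OF Z])
    from forces_mem_nestI[OF this P.below_refl[OF r_P]]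
    show "P.forces_mem r z (nest (collapse Z \<tau>))"
      by (rule P.forces_mem_cong_left[OF P.forces_eq_sym[OF eq']])
  qed
  then show "P.forces_mem q z (nest (collapse Z \<tau>))" by simp
next
  fix z s q assume "\<langle>z, s\<rangle> \<in> elts (nest (collapse Z \<tau>))" "q \<preceq>\<^sub>P s"
  then obtain b r x where "\<langle>b, \<langle>r, x\<rangle>\<rangle> \<in> elts (collapse Z \<tau>)"
    "z = P.pair_name (nest b) (check P x)" "q \<preceq>\<^sub>P r"
    unfolding vpair_mem_nest using P.below_trans by blast
  then show "P.forces_mem q z \<tau>" using P.forces_mem_mono by (auto simp: elts_collapse[OF Z])
qed

lemma forces_IsName_ex_represents:
  "P.is_name \<tau> \<Longrightarrow> p \<in> elts P \<Longrightarrow> p \<tturnstile>\<^sub>P IsName check_Q \<tau> \<Longrightarrow> \<exists>a. represents p \<tau> a"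
proof (induction \<tau> arbitrary: p rule: trcl_induct)
  case (step \<tau>)
  define rep where "rep r \<rho> = (SOME a. represents r \<rho> a)" for r \<rho>
  define Z where "Z = {rep r \<rho> |r \<rho>. r \<in> elts P \<and> \<rho> \<in> trcl \<tau>}"
  have Z: "small Z" unfolding Z_def by (intro small_image2 small_trcl small_elts)
  have "\<exists>b\<in>Z. represents r \<rho> b"
    if "\<rho> \<in> trcl \<tau>" "P.is_name \<rho>" "r \<in> elts P" "r \<tturnstile>\<^sub>P IsName check_Q \<rho>" for r \<rho>
  proof
    show "represents r \<rho> (rep r \<rho>)" unfolding rep_def using step.IH[OF that] by (rule someI_ex)
    show "rep r \<rho> \<in> Z" using that unfolding Z_def by blast
  qed
  from forces_eq_nest_collapse[OF step.prems(1,3) Z this] show ?case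
    using step.prems(1) is_name_collapse[OF Z] unfolding represents_def by blast
qed

lemma forces_ForcesEq_iff:
  assumes \<tau>: "represents p \<tau> a" and \<sigma>: "represents p \<sigma> b" and q: "q \<in> elts Q"
    and \<rho>: "P.is_name \<rho>" "P.forces_eq p \<rho> (check P q)"
  shows "p \<tturnstile>\<^sub>P ForcesEq check_Q check_leQ \<rho> \<tau> \<sigma> \<longleftrightarrow> PQ.forces_eq \<langle>p, q\<rangle> a b"
proof -
  note names = representsD(2)[OF \<tau>] representsD(2)[OF \<sigma>]
  have "fm_rel ({(\<rho>, check P q), (\<tau>, nest a), (\<sigma>, nest b)} \<union> Id_on (Collect P.is_name))
      (ForcesEq check_Q check_leQ \<rho> \<tau> \<sigma>) (ForcesEq check_Q check_leQ (check P q) (nest a) (nest b))"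
    by (intro fm_rel_intros) auto
  then have "p \<tturnstile>\<^sub>P ForcesEq check_Q check_leQ \<rho> \<tau> \<sigma> \<longleftrightarrow>
      p \<tturnstile>\<^sub>P ForcesEq check_Q check_leQ (check P q) (nest a) (nest b)"
    by (rule P.forces_cong)
      (use \<rho> representsD[OF \<tau>] representsD[OF \<sigma>] is_name_nest in \<open>auto simp: P.forces_Eq\<close>)
  also have "\<dots> \<longleftrightarrow> PQ.forces_eq \<langle>p, q\<rangle> a b"
    using forces_eq_of_ForcesEq_nest[OF names q] forces_ForcesEq_nest_of_eq[OF names q] by blast
  finally show ?thesis .
qed

lemma forces_ForcesMem_iff:
  assumes \<tau>: "represents p \<tau> a" and \<sigma>: "represents p \<sigma> b"
    and \<rho>: "P.is_name \<rho>" "P.forces_eq p \<rho> (check P q)"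
  shows "p \<tturnstile>\<^sub>P ForcesMem check_Q check_leQ \<rho> \<tau> \<sigma> \<longleftrightarrow> PQ.forces_mem \<langle>p, q\<rangle> a b"
proof -
  have "fm_rel ({(\<rho>, check P q), (\<tau>, nest a), (\<sigma>, nest b)} \<union> Id_on (Collect P.is_name))
      (ForcesMem check_Q check_leQ \<rho> \<tau> \<sigma>) (ForcesMem check_Q check_leQ (check P q) (nest a) (nest b))"
    by (intro fm_rel_intros) auto
  then have "p \<tturnstile>\<^sub>P ForcesMem check_Q check_leQ \<rho> \<tau> \<sigma> \<longleftrightarrow>
      p \<tturnstile>\<^sub>P ForcesMem check_Q check_leQ (check P q) (nest a) (nest b)"
    by (rule P.forces_cong)
      (use \<rho> representsD[OF \<tau>] representsD[OF \<sigma>] is_name_nest in \<open>auto simp: P.forces_Eq\<close>)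
  then show ?thesis by (simp add: forces_ForcesMem_nest representsD(2)[OF \<tau>] representsD(2)[OF \<sigma>])
qed

lemma forces_BelowForall_Neg_iff:
  assumes \<rho>: "P.is_name \<rho>" "P.forces_eq p \<rho> (check P q)"
    and F_iff: "\<And>x r \<tau>. x \<preceq>\<^sub>Q q \<Longrightarrow> r \<preceq>\<^sub>P p \<Longrightarrow> P.is_name \<tau> \<Longrightarrow> P.forces_eq r \<tau> (check P x) \<Longrightarrow>
      r \<tturnstile>\<^sub>P F \<tau> \<longleftrightarrow> \<Phi> \<langle>r, x\<rangle>"
  shows "p \<tturnstile>\<^sub>P BelowForall check_Q check_leQ \<rho> (\<lambda>x. Neg (F x)) \<longleftrightarrow> (\<forall>c. c \<preceq>\<^sub>\<times> \<langle>p, q\<rangle> \<longrightarrow> \<not> \<Phi> c)"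
  unfolding forces_BelowForall_check[OF \<rho>] P.forces_Neg
proof (intro iffI allI impI)
  fix x r \<tau> r' assume none: "\<forall>c. c \<preceq>\<^sub>\<times> \<langle>p, q\<rangle> \<longrightarrow> \<not> \<Phi> c" and x: "x \<preceq>\<^sub>Q q" and r: "r \<preceq>\<^sub>P p"
    and \<tau>: "P.is_name \<tau>" "P.forces_eq r \<tau> (check P x)" and r': "r' \<preceq>\<^sub>P r"
  have r'_p: "r' \<preceq>\<^sub>P p" using r' r by (rule P.below_trans)
  have "\<not> \<Phi> \<langle>r', x\<rangle>" using none r'_p x by simp
  then show "\<not> r' \<tturnstile>\<^sub>P F \<tau>" using F_iff[OF x r'_p \<tau>(1) P.forces_eq_mono[OF \<tau>(2) r']] by simp
next
  fix c assume none: "\<forall>x r \<tau>. x \<preceq>\<^sub>Q q \<longrightarrow> r \<preceq>\<^sub>P p \<longrightarrow> P.is_name \<tau> \<longrightarrow>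
      P.forces_eq r \<tau> (check P x) \<longrightarrow> (\<forall>r'. r' \<preceq>\<^sub>P r \<longrightarrow> \<not> r' \<tturnstile>\<^sub>P F \<tau>)" and "c \<preceq>\<^sub>\<times> \<langle>p, q\<rangle>"
  then obtain r x where c: "c = \<langle>r, x\<rangle>" "r \<preceq>\<^sub>P p" "x \<preceq>\<^sub>Q q" by (elim below_PQ_cases)
  have "r \<preceq>\<^sub>P r" using c(2) P.below_cond P.below_refl by blast
  then have "\<not> r \<tturnstile>\<^sub>P F (check P x)"
    using none c(2,3) P.is_name_check P.forces_eq_refl by blast
  then show "\<not> \<Phi> c" unfolding c(1) using F_iff[OF c(3,2) P.is_name_check P.forces_eq_refl] by simp
qed

lemma forces_Forall_IsName_iff:
  assumes p: "p \<in> elts P"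
    and F_iff: "\<And>r \<tau> a. r \<preceq>\<^sub>P p \<Longrightarrow> represents r \<tau> a \<Longrightarrow> r \<tturnstile>\<^sub>P F \<tau> \<longleftrightarrow> \<Phi> r a"
  shows "p \<tturnstile>\<^sub>P Forall (\<lambda>\<tau>. Imp (IsName check_Q \<tau>) (F \<tau>)) \<longleftrightarrow> (\<forall>a. PQ.is_name a \<longrightarrow> \<Phi> p a)"
  unfolding P.forces_Forall P.forces_Imp
proof (intro iffI allI impI)
  fix \<tau> r assume all: "\<forall>a. PQ.is_name a \<longrightarrow> \<Phi> p a"
    and \<tau>: "P.is_name \<tau>" "r \<tturnstile>\<^sub>P IsName check_Q \<tau>" and r: "r \<preceq>\<^sub>P p"
  obtain a where a: "represents r \<tau> a"
    using forces_IsName_ex_represents[OF \<tau>(1) P.below_cond(1)[OF r] \<tau>(2)] by blast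
  note nest_a = represents_nest[OF representsD(2)[OF a]]
  have "p \<tturnstile>\<^sub>P F (nest a)" using F_iff[OF P.below_refl[OF p] nest_a] all representsD(2)[OF a] by blast
  then have "r \<tturnstile>\<^sub>P F (nest a)" using r by (rule P.forces_mono)
  then show "r \<tturnstile>\<^sub>P F \<tau>" using F_iff[OF r nest_a] F_iff[OF r a] by blast
next
  fix a assume all: "\<forall>\<tau>. P.is_name \<tau> \<longrightarrow> (\<forall>r. r \<preceq>\<^sub>P p \<longrightarrow> r \<tturnstile>\<^sub>P IsName check_Q \<tau> \<longrightarrow> r \<tturnstile>\<^sub>P F \<tau>)"
    and a: "PQ.is_name a"
  have "p \<tturnstile>\<^sub>P F (nest a)"
    using all is_name_nest[OF a] forces_IsName_nest[OF a] P.below_refl[OF p] by blast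
  then show "\<Phi> p a" using F_iff[OF P.below_refl[OF p] represents_nest[OF a]] by blast
qed

theorem forces_Forces_iff:
  "fm_rel E \<phi> \<phi>' \<Longrightarrow> (\<And>a \<tau>. (a, \<tau>) \<in> E \<Longrightarrow> represents p \<tau> a) \<Longrightarrow> p \<in> elts P \<Longrightarrow> q \<in> elts Q \<Longrightarrow>
    P.is_name \<rho> \<Longrightarrow> P.forces_eq p \<rho> (check P q) \<Longrightarrow>
    p \<tturnstile>\<^sub>P Forces check_Q check_leQ \<phi>' \<rho> \<longleftrightarrow> \<langle>p, q\<rangle> \<tturnstile>\<^sub>\<times> \<phi>"
proof (induction arbitrary: p q \<rho> rule: fm_rel.induct)
  case (fm_rel_Mem a \<tau> E b \<sigma>)
  then have rep: "represents p \<tau> a" "represents p \<sigma> b" by blast+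
  then show ?case
    using forces_ForcesMem_iff[OF rep fm_rel_Mem.prems(4,5)]
    by (simp add: PQ.forces_Mem representsD)
next
  case (fm_rel_Eq a \<tau> E b \<sigma>)
  then have rep: "represents p \<tau> a" "represents p \<sigma> b" by blast+
  then show ?case
    using forces_ForcesEq_iff[OF rep fm_rel_Eq.prems(3-5)] by (simp add: PQ.forces_Eq representsD)
next
  case (fm_rel_Neg E \<phi> \<phi>')
  show ?case
    unfolding Forces.simps PQ.forces_Neg
  proof (rule forces_BelowForall_Neg_iff[OF fm_rel_Neg.prems(4,5)])
    fix x r \<tau> assume "x \<preceq>\<^sub>Q q" "r \<preceq>\<^sub>P p" "P.is_name \<tau>" "P.forces_eq r \<tau> (check P x)"
    then show "r \<tturnstile>\<^sub>P Forces check_Q check_leQ \<phi>' \<tau> \<longleftrightarrow> \<langle>r, x\<rangle> \<tturnstile>\<^sub>\<times> \<phi>"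
      by (intro fm_rel_Neg.IH represents_mono[OF fm_rel_Neg.prems(1)])
        (auto dest: P.below_cond(1) Q.below_cond(1))
  qed
next
  case (fm_rel_Conj E \<phi> \<phi>' \<psi> \<psi>')
  then show ?case by (simp add: P.forces_Conj PQ.forces_Conj)
next
  case (fm_rel_Forall E F F')
  show ?case
    unfolding Forces.simps PQ.forces_Forall
  proof (rule forces_Forall_IsName_iff[OF fm_rel_Forall.prems(2)])
    fix r \<tau> a assume r: "r \<preceq>\<^sub>P p" and "represents r \<tau> a"
    then show "r \<tturnstile>\<^sub>P Forces check_Q check_leQ (F' \<tau>) \<rho> \<longleftrightarrow> \<langle>r, q\<rangle> \<tturnstile>\<^sub>\<times> F a"
      by (intro fm_rel_Forall.IH P.forces_eq_mono[OF fm_rel_Forall.prems(5) r])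
        (use fm_rel_Forall.prems(3,4) P.below_cond(1)[OF r]
          represents_mono[OF fm_rel_Forall.prems(1) r] in auto)
  qed
qed

end


section \<open>Canonical names in the extension\<close>

definition CheckClause :: "'v \<Rightarrow> 'v \<Rightarrow> 'v \<Rightarrow> 'v \<Rightarrow> 'v fm" where
  "CheckClause P f y e =
     BExists y (\<lambda>z. BExists P (\<lambda>p. Exists (\<lambda>v. Conj (PairIn z v f) (IsPair v p e))))"

lemma fm_rel_CheckClause [fm_rel_intros]:
  "(P, P') \<in> E \<Longrightarrow> (f, f') \<in> E \<Longrightarrow> (y, y') \<in> E \<Longrightarrow> (e, e') \<in> E \<Longrightarrow>
    fm_rel E (CheckClause P f y e) (CheckClause P' f' y' e')"
  unfolding CheckClause_def by (intro fm_rel_intros) auto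

context two_forcing
begin

text \<open>The \<open>P\<close>-name \<^term>\<open>x\<close>, regarded as a \<open>P \<times> Q\<close>-name. Hence \<^term>\<open>nest (lift x)\<close> is a \<open>P\<close>-name
  for the canonical \<open>Q\<close>-name, computed in the extension, of the set named by \<^term>\<open>x\<close>.\<close>

definition lift :: "'v \<Rightarrow> 'v" where
  "lift = pair_rec (\<lambda>x p. {\<langle>x, \<langle>p, r\<rangle>\<rangle> |r. r \<in> elts Q})"

lemma elts_lift: "elts (lift x) = {\<langle>lift z, \<langle>p, r\<rangle>\<rangle> |z p r. \<langle>z, p\<rangle> \<in> elts x \<and> r \<in> elts Q}"
proof -
  have "small {\<langle>x, \<langle>p, r\<rangle>\<rangle> |r. r \<in> elts Q}" for x p
    by (rule small_subset[OF small_image[OF small_elts[of Q]], of _ "\<lambda>r. \<langle>x, \<langle>p, r\<rangle>\<rangle>"]) auto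
  then show ?thesis unfolding lift_def by (subst elts_pair_rec) blast+
qed

lemma vpair_mem_lift:
  "\<langle>b, \<langle>p, r\<rangle>\<rangle> \<in> elts (lift x) \<longleftrightarrow> (\<exists>z. b = lift z \<and> \<langle>z, p\<rangle> \<in> elts x \<and> r \<in> elts Q)"
  by (auto simp: elts_lift)

lemma is_name_lift: "P.is_name x \<Longrightarrow> PQ.is_name (lift x)"
proof (induction x rule: trcl_induct)
  case (step x)
  show ?case
    by (rule PQ.is_nameI)
      (use step P.is_name_pairD[OF step.prems] vpair_mem_trcl(1) in \<open>fastforce simp: elts_lift\<close>)
qed

lemma is_name_nest_lift: "P.is_name x \<Longrightarrow> P.is_name (nest (lift x))"
  by (intro is_name_nest is_name_lift)

lemma lift_check: "lift (check P x) = check PQ x"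
proof (induction x rule: elts_induct)
  case (step x)
  have "elts (lift (check P x)) = elts (check PQ x)"
    unfolding elts_lift using step by (auto simp: elts_check elts_prod_set; metis)
  then show ?case by (simp add: elts_inject)
qed

lemma forces_mem_nest_lift: "P.forces_mem p \<tau> (nest (lift x)) \<longleftrightarrow> P.densely p (\<lambda>r. \<exists>z s.
    \<langle>z, s\<rangle> \<in> elts x \<and> r \<preceq>\<^sub>P s \<and>
    (\<exists>t\<in>elts Q. P.forces_eq r \<tau> (P.pair_name (nest (lift z)) (check P t))))"
  unfolding forces_mem_nest vpair_mem_lift by (rule P.densely_cong) blast

lemma forces_mem_nest_liftI:
  assumes z: "P.forces_mem p z x" and t: "t \<in> elts Q"
    and cong: "\<And>r z' s. \<langle>z', s\<rangle> \<in> elts x \<Longrightarrow> P.forces_eq r z z' \<Longrightarrow>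
      P.forces_eq r (nest (lift z)) (nest (lift z'))"
  shows "P.forces_mem p (P.pair_name (nest (lift z)) (check P t)) (nest (lift x))"
  unfolding forces_mem_nest_lift using z[unfolded P.forces_mem_def]
proof (elim P.densely_mono exE conjE)
  fix r z' s assume z': "\<langle>z', s\<rangle> \<in> elts x" "r \<preceq>\<^sub>P s" "P.forces_eq r z' z"
  have "P.forces_eq r (P.pair_name (nest (lift z)) (check P t))
      (P.pair_name (nest (lift z')) (check P t))"
    using cong[OF z'(1) P.forces_eq_sym[OF z'(3)]] P.forces_eq_refl by (rule P.pair_name_cong)
  then show "\<exists>z' s. \<langle>z', s\<rangle> \<in> elts x \<and> r \<preceq>\<^sub>P s \<and> (\<exists>t'\<in>elts Q.
      P.forces_eq r (P.pair_name (nest (lift z)) (check P t))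
        (P.pair_name (nest (lift z')) (check P t')))"
    using z' t by blast
qed

lemma nest_lift_cong: "P.forces_eq p x y \<Longrightarrow> P.forces_eq p (nest (lift x)) (nest (lift y))"
proof (induction x arbitrary: p y rule: trcl_induct)
  case (step x)
  show ?case
    unfolding P.forces_eq_iff[of p "nest (lift x)"] vpair_mem_nest vpair_mem_lift
  proof (intro conjI allI impI; elim exE conjE)
    fix u s q b s' t z
    assume z: "\<langle>z, s'\<rangle> \<in> elts x" "t \<in> elts Q" "q \<preceq>\<^sub>P p" "q \<preceq>\<^sub>P s" "s \<preceq>\<^sub>P s'"
      and u: "u = P.pair_name (nest b) (check P t)" "b = lift z"
    have "P.forces_mem q z y"
      using P.forces_eqD1[OF step.prems z(1,3) P.below_trans[OF z(4,5)]] .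
    then show "P.forces_mem q u (nest (lift y))"
      unfolding u using z(2) step.IH[OF vpair_mem_trcl(1)[OF z(1)]] by (rule forces_mem_nest_liftI)
  next
    fix u s q b s' t z
    assume z: "\<langle>z, s'\<rangle> \<in> elts y" "t \<in> elts Q" "q \<preceq>\<^sub>P p" "q \<preceq>\<^sub>P s" "s \<preceq>\<^sub>P s'"
      and u: "u = P.pair_name (nest b) (check P t)" "b = lift z"
    have "P.forces_mem q z x"
      using P.forces_eqD2[OF step.prems z(1,3) P.below_trans[OF z(4,5)]] .
    then show "P.forces_mem q u (nest (lift x))"
      unfolding u using z(2)
    proof (rule forces_mem_nest_liftI)
      fix r z' v assume "\<langle>z', v\<rangle> \<in> elts x" "P.forces_eq r z z'"
      then show "P.forces_eq r (nest (lift z)) (nest (lift z'))"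
        using step.IH[OF vpair_mem_trcl(1)] P.forces_eq_sym by blast
    qed
  qed
qed

definition check_graph :: "'v \<Rightarrow> 'v" where
  "check_graph x = P.family_name (P.subnames x) (\<lambda>y. P.pair_name y (nest (lift y)))"

lemma small_check_graph: "small ((\<lambda>y. P.pair_name y (nest (lift y))) ` P.subnames x)"
  using P.small_subnames by (rule small_image)

lemma is_name_check_graph: "P.is_name (check_graph x)"
  unfolding check_graph_def
proof (rule P.is_name_family_name[OF small_check_graph])
  fix y assume "y \<in> P.subnames x"
  then have "P.is_name y" by (rule P.subnames_is_name)
  then show "P.is_name (P.pair_name y (nest (lift y)))" by (simp add: is_name_nest_lift)
qed

lemma forces_PairIn_check_graph:
  assumes y: "y \<in> P.subnames x" and v: "P.is_name v"
  shows "p \<tturnstile>\<^sub>P PairIn y v (check_graph x) \<longleftrightarrow> P.forces_eq p v (nest (lift y))"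
proof -
  have "p \<tturnstile>\<^sub>P PairIn y v (check_graph x) \<longleftrightarrow> P.densely p (\<lambda>r. \<exists>y'\<in>P.subnames x.
      P.forces_eq r (P.pair_name y v) (P.pair_name y' (nest (lift y'))))"
    using P.forces_PairIn[OF P.subnames_is_name[OF y] v is_name_check_graph]
      P.forces_mem_family_name[OF small_check_graph] unfolding check_graph_def by blast
  also have "\<dots> \<longleftrightarrow> P.forces_eq p v (nest (lift y))"
  proof
    assume "P.densely p (\<lambda>r. \<exists>y'\<in>P.subnames x.
        P.forces_eq r (P.pair_name y v) (P.pair_name y' (nest (lift y'))))"
    then have "P.densely p (\<lambda>r. P.forces_eq r v (nest (lift y)))"
    proof (elim P.densely_mono bexE)
      fix r y' assume eq: "P.forces_eq r (P.pair_name y v) (P.pair_name y' (nest (lift y')))"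
      have "P.forces_eq r (nest (lift y')) (nest (lift y))"
        using nest_lift_cong[OF P.forces_eq_sym[OF P.pair_name_eq_fstD[OF eq]]] .
      with P.pair_name_eq_sndD[OF eq] show "P.forces_eq r v (nest (lift y))"
        by (rule P.forces_eq_trans)
    qed
    then show "P.forces_eq p v (nest (lift y))" by simp
  next
    assume eq: "P.forces_eq p v (nest (lift y))"
    show "P.densely p (\<lambda>r. \<exists>y'\<in>P.subnames x.
        P.forces_eq r (P.pair_name y v) (P.pair_name y' (nest (lift y'))))"
    proof (rule P.densely_all)
      fix r assume "r \<preceq>\<^sub>P p"
      then have "P.forces_eq r (P.pair_name y v) (P.pair_name y (nest (lift y)))"
        using P.forces_eq_mono[OF eq] by (intro P.pair_name_cong P.forces_eq_refl)
      then show "\<exists>y'\<in>P.subnames x. P.forces_eq r (P.pair_name y v) (P.pair_name y' (nest (lift y')))"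
        using y by blast
    qed
  qed
  finally show ?thesis .
qed

lemma forces_Exists_check_graph_value:
  assumes z: "z \<in> P.subnames x" and e: "P.is_name e"
  shows "p \<tturnstile>\<^sub>P Exists (\<lambda>v. Conj (PairIn z v (check_graph x)) (IsPair v (check P t) e)) \<longleftrightarrow>
    P.forces_eq p e (P.pair_name (nest (lift z)) (check P t))"
proof -
  have lift_z: "P.is_name (nest (lift z))"
    using P.subnames_is_name[OF z] by (rule is_name_nest_lift)
  have "p \<tturnstile>\<^sub>P Exists (\<lambda>v. Conj (PairIn z v (check_graph x)) (IsPair v (check P t) e)) \<longleftrightarrow>
      p \<tturnstile>\<^sub>P IsPair (nest (lift z)) (check P t) e"
    by (rule P.forces_Exists_one_point[OF _ lift_z])
      (use e forces_PairIn_check_graph[OF z] in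
        \<open>auto intro!: P.uniformI fm_rel_intros simp: P.forces_Conj\<close>)
  then show ?thesis using e lift_z by (simp add: P.forces_IsPair)
qed

lemma forces_CheckClause_check_graph:
  assumes y: "y \<in> P.subnames x" and e: "P.is_name e"
  shows "p \<tturnstile>\<^sub>P CheckClause check_Q (check_graph x) y e \<longleftrightarrow> P.forces_mem p e (nest (lift y))"
proof -
  let ?value = "\<lambda>z t v. Conj (PairIn z v (check_graph x)) (IsPair v t e)"
  let ?eq = "\<lambda>z r. \<exists>t\<in>elts Q. P.forces_eq r e (P.pair_name (nest (lift z)) (check P t))"
  note f = is_name_check_graph[of x]
  have Q_iff: "r \<tturnstile>\<^sub>P BExists check_Q (\<lambda>t. Exists (?value z t)) \<longleftrightarrow> P.densely r (?eq z)"
    if z: "z \<in> P.subnames x" for r z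
    unfolding forces_Exists_check_graph_value[OF z e, symmetric]
    by (rule P.forces_BExists_check)
      (use e f P.subnames_is_name[OF z] in \<open>auto intro!: P.uniformI fm_rel_intros\<close>)
  have "p \<tturnstile>\<^sub>P CheckClause check_Q (check_graph x) y e \<longleftrightarrow> P.densely p (\<lambda>r. \<exists>z s.
      \<langle>z, s\<rangle> \<in> elts y \<and> r \<preceq>\<^sub>P s \<and> r \<tturnstile>\<^sub>P BExists check_Q (\<lambda>t. Exists (?value z t)))"
    unfolding CheckClause_def
    by (rule P.forces_BExists_uniform[OF P.subnames_is_name[OF y]])
      (use e f in \<open>auto intro!: P.uniformI fm_rel_intros\<close>)
  also have "\<dots> \<longleftrightarrow> P.densely p (\<lambda>r. \<exists>z. (\<exists>s. \<langle>z, s\<rangle> \<in> elts y \<and> r \<preceq>\<^sub>P s) \<and> P.densely r (?eq z))"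
    by (rule P.densely_cong) (use Q_iff P.subnames_step[OF y] in blast)
  also have "\<dots> \<longleftrightarrow> P.densely p (\<lambda>r. \<exists>z. (\<exists>s. \<langle>z, s\<rangle> \<in> elts y \<and> r \<preceq>\<^sub>P s) \<and> ?eq z r)"
    by (rule P.densely_Ex_densely) (use P.below_trans P.forces_eq_mono in blast)+
  also have "\<dots> \<longleftrightarrow> P.forces_mem p e (nest (lift y))"
    unfolding forces_mem_nest_lift by (rule P.densely_cong) blast
  finally show ?thesis .
qed

lemma forces_check_graph_recursion:
  assumes y: "y \<in> P.subnames x"
  shows "p \<tturnstile>\<^sub>P Forall (\<lambda>u. Imp (PairIn y u (check_graph x))
    (Forall (\<lambda>e. Iff (Mem e u) (CheckClause check_Q (check_graph x) y e))))"
  unfolding P.forces_Forall P.forces_Imp P.forces_Iff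
proof (intro allI impI)
  fix u q e r
  assume u: "P.is_name u" "q \<tturnstile>\<^sub>P PairIn y u (check_graph x)" and e: "P.is_name e" and r: "r \<preceq>\<^sub>P q"
  have "P.forces_eq r u (nest (lift y))"
    using P.forces_eq_mono[OF _ r] forces_PairIn_check_graph[OF y u(1)] u(2) by blast
  then have "r \<tturnstile>\<^sub>P Mem e u \<longleftrightarrow> P.forces_mem r e (nest (lift y))"
    using P.forces_mem_cong[OF P.forces_eq_refl] by (simp add: P.forces_Mem[OF e u(1)])
  then show "r \<tturnstile>\<^sub>P Mem e u \<longleftrightarrow> r \<tturnstile>\<^sub>P CheckClause check_Q (check_graph x) y e"
    using forces_CheckClause_check_graph[OF y e] by blast
qed

lemma forces_IsCheck:
  assumes x: "P.is_name x"
  shows "p \<tturnstile>\<^sub>P IsCheck check_Q x (nest (lift x))"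
proof -
  let ?S = "P.subnames x" and ?D = "P.family_name (P.subnames x) (\<lambda>y. y)" and ?f = "check_graph x"
  have S: "small ((\<lambda>y. y) ` ?S)" "\<And>y. y \<in> ?S \<Longrightarrow> P.is_name y"
    using P.small_subnames P.subnames_is_name by simp_all
  have D: "P.is_name ?D" using S by (rule P.is_name_family_name)
  note f = is_name_check_graph[of x]
  have mem_D: "p \<tturnstile>\<^sub>P Mem y ?D" if "y \<in> ?S" for p y
    using P.forces_mem_family_nameI[OF S(1) that] S(2)[OF that] D by (simp add: P.forces_Mem)
  have "p \<tturnstile>\<^sub>P BForall y (\<lambda>z. Mem z ?D)" if y: "y \<in> ?S" for y
    by (subst P.forces_BForall_uniform[OF S(2)[OF y]])
      (use D mem_D P.subnames_step[OF y] in \<open>auto intro!: P.uniformI fm_rel_intros\<close>)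
  then have "p \<tturnstile>\<^sub>P Trans ?D"
    unfolding Trans_def
    by (subst P.forces_BForall_family_name[OF S]) (use D in \<open>auto intro!: P.uniformI fm_rel_intros\<close>)
  moreover have "p \<tturnstile>\<^sub>P Exists (\<lambda>u. Forall (\<lambda>v. Iff (PairIn y v ?f) (Eq v u)))" if y: "y \<in> ?S" for y
    using forces_PairIn_check_graph[OF y] is_name_nest_lift[OF S(2)[OF y]]
    by (intro P.forces_ExistsI[of "nest (lift y)"])
      (auto simp: P.forces_Forall P.forces_Iff P.forces_Eq)
  then have "p \<tturnstile>\<^sub>P BForall ?D (\<lambda>y. Exists (\<lambda>u. Forall (\<lambda>v. Iff (PairIn y v ?f) (Eq v u))))"
    by (subst P.forces_BForall_family_name[OF S]) (use f in \<open>auto intro!: P.uniformI fm_rel_intros\<close>)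
  moreover have "p \<tturnstile>\<^sub>P BForall ?D (\<lambda>y. Forall (\<lambda>u. Imp (PairIn y u ?f)
      (Forall (\<lambda>e. Iff (Mem e u) (CheckClause check_Q ?f y e)))))"
    by (subst P.forces_BForall_family_name[OF S])
      (use f forces_check_graph_recursion in \<open>auto intro!: P.uniformI fm_rel_intros\<close>)
  moreover have "p \<tturnstile>\<^sub>P PairIn x (nest (lift x)) ?f"
    using forces_PairIn_check_graph[OF P.subnames_self[OF x] is_name_nest_lift[OF x]] by simp
  ultimately show ?thesis
    unfolding IsCheck_def CheckClause_def[symmetric] using mem_D[OF P.subnames_self[OF x]]
    by (intro P.forces_ExistsI[OF D] P.forces_ExistsI[OF f]) (simp add: P.forces_Conj)
qed


section \<open>Deciding countably many statements in the ground model\<close>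

lemma ex_descending_sequence:
  fixes A :: "nat \<Rightarrow> 'v \<Rightarrow> 'v \<Rightarrow> bool"
  assumes N: "countable N" "p\<^sub>0 \<in> N \<inter> elts P" "q\<^sub>0 \<in> N \<inter> elts Q"
    and step: "\<And>k p q. p \<in> N \<inter> elts P \<Longrightarrow> q \<in> N \<inter> elts Q \<Longrightarrow>
      \<exists>p'\<in>N. \<exists>q'\<in>N. p' \<preceq>\<^sub>P p \<and> q' \<preceq>\<^sub>Q q \<and> A k p' q'"
  shows "\<exists>s. s 0 = q\<^sub>0 \<and> (\<forall>j. s (Suc j) \<preceq>\<^sub>Q s j) \<and>
    (\<forall>k. \<forall>p\<in>N \<inter> elts P. \<exists>p'\<in>N. p' \<preceq>\<^sub>P p \<and> (\<exists>j. A k p' (s j)))"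
proof -
  define W where "W = (N \<inter> elts P) \<times> (UNIV :: nat set)"
  define e where "e = from_nat_into W"
  have "W \<noteq> {}" "countable W" using N by (auto simp: W_def)
  then have range_e: "range e = W" unfolding e_def by (rule range_from_nat_into)
  have e: "fst (e j) \<in> N \<inter> elts P" for j
    using range_e rangeI[of e j] unfolding W_def by (metis mem_Times_iff)
  have "\<exists>s. \<forall>j. (s j \<in> N \<inter> elts Q \<and> (j = 0 \<longrightarrow> s j = q\<^sub>0)) \<and>
      (s (Suc j) \<preceq>\<^sub>Q s j \<and> (\<exists>p'\<in>N. p' \<preceq>\<^sub>P fst (e j) \<and> A (snd (e j)) p' (s (Suc j))))"
  proof (rule dependent_nat_choice)
    fix q and j :: nat assume "q \<in> N \<inter> elts Q \<and> (j = 0 \<longrightarrow> q = q\<^sub>0)"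
    then obtain p' q' where "p' \<in> N" "q' \<in> N" "p' \<preceq>\<^sub>P fst (e j)" "q' \<preceq>\<^sub>Q q" "A (snd (e j)) p' q'"
      using step[OF e] by blast
    then show "\<exists>q'. (q' \<in> N \<inter> elts Q \<and> (Suc j = 0 \<longrightarrow> q' = q\<^sub>0)) \<and>
        (q' \<preceq>\<^sub>Q q \<and> (\<exists>p'\<in>N. p' \<preceq>\<^sub>P fst (e j) \<and> A (snd (e j)) p' q'))"
      using Q.below_cond(1) by blast
  qed (use N in blast)
  then obtain s where s: "s 0 = q\<^sub>0" "\<And>j. s (Suc j) \<preceq>\<^sub>Q s j"
    "\<And>j. \<exists>p'\<in>N. p' \<preceq>\<^sub>P fst (e j) \<and> A (snd (e j)) p' (s (Suc j))"
    by blast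
  have "\<exists>p'\<in>N. p' \<preceq>\<^sub>P p \<and> (\<exists>j. A k p' (s j))" if "p \<in> N \<inter> elts P" for k p
  proof -
    have "(p, k) \<in> range e" using that unfolding range_e W_def by blast
    then obtain j where "e j = (p, k)" by (metis rangeE)
    then show ?thesis using s(3)[of j] by auto
  qed
  then show ?thesis using s(1,2) by blast
qed

lemma strongly_proper_for_closed_under_extension:
  fixes A :: "nat \<Rightarrow> 'v \<Rightarrow> 'v \<Rightarrow> bool"
  assumes sp: "strongly_proper_on_stationary P leP"
    and dense: "\<And>k p q. p \<in> elts P \<Longrightarrow> q \<in> elts Q \<Longrightarrow> \<exists>p' q'. p' \<preceq>\<^sub>P p \<and> q' \<preceq>\<^sub>Q q \<and> A k p' q'"
    and p\<^sub>0: "p\<^sub>0 \<in> elts P" and q\<^sub>0: "q\<^sub>0 \<in> elts Q"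
  shows "\<exists>N. countable N \<and> strongly_proper_for P leP N \<and> p\<^sub>0 \<in> N \<inter> elts P \<and> q\<^sub>0 \<in> N \<inter> elts Q \<and>
    (\<forall>k. \<forall>p\<in>N \<inter> elts P. \<forall>q\<in>N \<inter> elts Q. \<exists>p'\<in>N. \<exists>q'\<in>N. p' \<preceq>\<^sub>P p \<and> q' \<preceq>\<^sub>Q q \<and> A k p' q')"
proof -
  have "\<forall>k p q. \<exists>p' q'. p \<in> elts P \<longrightarrow> q \<in> elts Q \<longrightarrow> p' \<preceq>\<^sub>P p \<and> q' \<preceq>\<^sub>Q q \<and> A k p' q'"
    using dense by blast
  then obtain g h where gh: "\<And>k p q. p \<in> elts P \<Longrightarrow> q \<in> elts Q \<Longrightarrow>
      g k p q \<preceq>\<^sub>P p \<and> h k p q \<preceq>\<^sub>Q q \<and> A k (g k p q) (h k p q)"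
    by metis
  have gh_mem: "g k p q \<in> elts P" "h k p q \<in> elts Q" if "p \<in> elts P" "q \<in> elts Q" for k p q
    using gh[OF that] P.below_cond(1) Q.below_cond(1) by blast+
  define F where "F xs = (case xs of [] \<Rightarrow> {p\<^sub>0, q\<^sub>0}
    | [p, q] \<Rightarrow> if p \<in> elts P \<and> q \<in> elts Q then (\<Union>k. {g k p q, h k p q}) else {}
    | _ \<Rightarrow> {})" for xs
  have "small (elts P \<union> elts Q)" by (intro small_Un small_elts)
  moreover have "F xs \<subseteq> elts P \<union> elts Q" for xs
    using p\<^sub>0 q\<^sub>0 gh_mem unfolding F_def by (auto split: list.split)
  moreover have "countable (F xs)" for xs unfolding F_def by (auto split: list.split)
  ultimately obtain N where N: "countable N" "strongly_proper_for P leP N"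
    and closed: "\<forall>xs\<in>lists N. F xs \<subseteq> N"
    by (rule strongly_proper_for_closed_set[OF sp])
  have "p\<^sub>0 \<in> N" "q\<^sub>0 \<in> N" using bspec[OF closed, of "[]"] by (simp_all add: F_def)
  moreover have "\<exists>p'\<in>N. \<exists>q'\<in>N. p' \<preceq>\<^sub>P p \<and> q' \<preceq>\<^sub>Q q \<and> A k p' q'"
    if pq: "p \<in> N \<inter> elts P" "q \<in> N \<inter> elts Q" for k p q
  proof -
    have "F [p, q] \<subseteq> N" using bspec[OF closed, of "[p, q]"] pq by simp
    then have "g k p q \<in> N" "h k p q \<in> N" using pq by (auto simp: F_def)
    then show ?thesis using gh pq by blast
  qed
  ultimately show ?thesis using N p\<^sub>0 q\<^sub>0 by blast
qed

lemma strongly_proper_product_dense: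
  fixes A :: "nat \<Rightarrow> 'v \<Rightarrow> 'v \<Rightarrow> bool"
  assumes sp: "strongly_proper_on_stationary P leP" and closed: "omega1_closed Q leQ"
    and mono: "\<And>k p q p' q'. A k p q \<Longrightarrow> p' \<preceq>\<^sub>P p \<Longrightarrow> q' \<preceq>\<^sub>Q q \<Longrightarrow> A k p' q'"
    and dense: "\<And>k p q. p \<in> elts P \<Longrightarrow> q \<in> elts Q \<Longrightarrow> \<exists>p' q'. p' \<preceq>\<^sub>P p \<and> q' \<preceq>\<^sub>Q q \<and> A k p' q'"
    and p\<^sub>0: "p\<^sub>0 \<in> elts P" and q\<^sub>0: "q\<^sub>0 \<in> elts Q"
  shows "\<exists>p q. p \<preceq>\<^sub>P p\<^sub>0 \<and> q \<preceq>\<^sub>Q q\<^sub>0 \<and> (\<forall>k. P.densely p (\<lambda>r. A k r q))"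
proof -
  note ex_closed = strongly_proper_for_closed_under_extension[where A = A, OF sp dense p\<^sub>0 q\<^sub>0]
  obtain N where N: "countable N" "strongly_proper_for P leP N" "p\<^sub>0 \<in> N \<inter> elts P" "q\<^sub>0 \<in> N \<inter> elts Q"
    and extend: "\<And>k p q. p \<in> N \<inter> elts P \<Longrightarrow> q \<in> N \<inter> elts Q \<Longrightarrow>
      \<exists>p'\<in>N. \<exists>q'\<in>N. p' \<preceq>\<^sub>P p \<and> q' \<preceq>\<^sub>Q q \<and> A k p' q'"
    using ex_closed by blast
  from ex_descending_sequence[where A = A, OF N(1,3,4) extend]
  obtain s where s: "s 0 = q\<^sub>0" "\<And>j. s (Suc j) \<preceq>\<^sub>Q s j"
    and dense_N: "\<And>k p. p \<in> N \<inter> elts P \<Longrightarrow> \<exists>p'\<in>N. p' \<preceq>\<^sub>P p \<and> (\<exists>j. A k p' (s j))"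
    by blast
  have "range s \<subseteq> elts Q" using s(2) Q.below_cond(2) by blast
  then obtain q where q: "\<And>j. q \<preceq>\<^sub>Q s j" using closed s(2) unfolding omega1_closed_def by blast
  obtain p where p: "p \<preceq>\<^sub>P p\<^sub>0" "strongly_generic P leP N p"
    using N(2,3) unfolding strongly_proper_for_def by blast
  have "P.densely p (\<lambda>r. A k r q)" for k
  proof (rule P.denselyI)
    fix r assume r: "r \<preceq>\<^sub>P p"
    define B where "B = {d \<in> N \<inter> elts P. \<exists>j. A k d (s j)}"
    have "dense_in leP (N \<inter> elts P) B"
      using dense_N[of _ k] P.below_cond(1) unfolding dense_in_def B_def by blast
    then have "predense_below P leP B p" using p(2) unfolding strongly_generic_def by blast
    then obtain d u where "d \<in> B" "u \<preceq>\<^sub>P d" "u \<preceq>\<^sub>P r"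
      using r P.below_cond unfolding predense_below_def compatible_def by blast
    then show "\<exists>u. u \<preceq>\<^sub>P r \<and> A k u q" using mono q unfolding B_def by blast
  qed
  then show ?thesis using p(1) q[of 0] s(1) by metis
qed

text \<open>A \<open>P\<close>-name for the set of those elements that \<^term>\<open>q\<close> forces to belong to \<^term>\<open>t\<close>, given the
  \<open>P\<close>-generic filter. The named set need not belong to the ground model.\<close>

definition trace_name :: "'v \<Rightarrow> 'v \<Rightarrow> 'v" where
  "trace_name t q = P.set_name (PQ.possible_elements t) (check P)
     (\<lambda>\<alpha> p. PQ.forces_mem \<langle>p, q\<rangle> (check PQ \<alpha>) t)"

lemma small_check_possible_elements: "small (check P ` PQ.possible_elements t)"
  using PQ.small_possible_elements by (rule small_image)

lemma is_name_trace_name: "P.is_name (trace_name t q)"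
  unfolding trace_name_def using small_check_possible_elements by (rule P.is_name_set_name) simp

lemma vpair_mem_lift_trace_name:
  assumes "q \<in> elts Q"
  shows "\<langle>\<pi>, \<langle>p, x\<rangle>\<rangle> \<in> elts (lift (trace_name t q)) \<longleftrightarrow> p \<in> elts P \<and> x \<in> elts Q \<and>
    (\<exists>\<alpha>. \<pi> = check PQ \<alpha> \<and> PQ.forces_mem \<langle>p, q\<rangle> (check PQ \<alpha>) t)"
proof -
  have "\<alpha> \<in> PQ.possible_elements t" if "p \<in> elts P" "PQ.forces_mem \<langle>p, q\<rangle> (check PQ \<alpha>) t" for \<alpha>
    using that assms unfolding PQ.possible_elements_def
    by (intro CollectI bexI[of _ "\<langle>p, q\<rangle>"]) simp_all
  then have mem_trace: "\<langle>z, p\<rangle> \<in> elts (trace_name t q) \<longleftrightarrow> p \<in> elts P \<and>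
      (\<exists>\<alpha>. z = check P \<alpha> \<and> PQ.forces_mem \<langle>p, q\<rangle> (check PQ \<alpha>) t)" for z
    unfolding trace_name_def P.elts_set_name[OF small_check_possible_elements] by auto
  show ?thesis unfolding vpair_mem_lift mem_trace lift_check[symmetric] by blast
qed

lemma forces_eq_lift_trace_name:
  assumes t: "PQ.is_name t"
    and decided: "\<And>c \<pi>. c \<preceq>\<^sub>\<times> \<langle>p, q\<rangle> \<Longrightarrow> PQ.is_name \<pi> \<Longrightarrow> PQ.forces_mem c \<pi> t \<Longrightarrow>
      PQ.densely c (\<lambda>d. \<exists>r x \<alpha>. d = \<langle>r, x\<rangle> \<and> PQ.forces_eq d \<pi> (check PQ \<alpha>) \<and>
        PQ.forces_mem \<langle>r, q\<rangle> (check PQ \<alpha>) t)"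
  shows "PQ.forces_eq \<langle>p, q\<rangle> t (lift (trace_name t q))"
  unfolding PQ.forces_eq_iff
proof (intro conjI allI impI)
  fix \<pi> s c assume \<pi>: "\<langle>\<pi>, s\<rangle> \<in> elts t" and c: "c \<preceq>\<^sub>\<times> \<langle>p, q\<rangle>" "c \<preceq>\<^sub>\<times> s"
  have q: "q \<in> elts Q" using PQ.below_cond(2)[OF c(1)] by simp
  have "PQ.densely c (\<lambda>d. PQ.forces_mem d \<pi> (lift (trace_name t q)))"
    using decided[OF c(1) PQ.is_name_pairD(1)[OF t \<pi>] PQ.forces_mem_elt[OF \<pi> c(2)]]
  proof (elim PQ.densely_mono exE conjE)
    fix d r x \<alpha> assume d: "d \<preceq>\<^sub>\<times> c" "d = \<langle>r, x\<rangle>" and eq: "PQ.forces_eq d \<pi> (check PQ \<alpha>)"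
      and mem: "PQ.forces_mem \<langle>r, q\<rangle> (check PQ \<alpha>) t"
    have "d \<in> elts PQ" using d(1) by (rule PQ.below_cond)
    then have "\<langle>check PQ \<alpha>, d\<rangle> \<in> elts (lift (trace_name t q))" "d \<preceq>\<^sub>\<times> d"
      using mem unfolding d(2) vpair_mem_lift_trace_name[OF q] by auto
    then have "PQ.forces_mem d (check PQ \<alpha>) (lift (trace_name t q))" by (rule PQ.forces_mem_elt)
    then show "PQ.forces_mem d \<pi> (lift (trace_name t q))"
      using PQ.forces_mem_cong_left[OF PQ.forces_eq_sym[OF eq]] by blast
  qed
  then show "PQ.forces_mem c \<pi> (lift (trace_name t q))" by simp
next
  fix \<pi> s c assume \<pi>: "\<langle>\<pi>, s\<rangle> \<in> elts (lift (trace_name t q))" and c: "c \<preceq>\<^sub>\<times> \<langle>p, q\<rangle>" "c \<preceq>\<^sub>\<times> s"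
  have q: "q \<in> elts Q" using PQ.below_cond(2)[OF c(1)] by simp
  obtain r x where s: "s = \<langle>r, x\<rangle>"
    using is_name_lift[OF is_name_trace_name] \<pi> by (rule PQ_name_elt_cases)
  obtain \<alpha> where \<alpha>: "\<pi> = check PQ \<alpha>" "PQ.forces_mem \<langle>r, q\<rangle> (check PQ \<alpha>) t"
    using \<pi> unfolding s vpair_mem_lift_trace_name[OF q] by blast
  obtain p' q' where "c = \<langle>p', q'\<rangle>" "p' \<preceq>\<^sub>P p" "q' \<preceq>\<^sub>Q q" using c(1) by (rule below_PQ_cases)
  then have "c \<preceq>\<^sub>\<times> \<langle>r, q\<rangle>" using c(2) unfolding s by simp
  then show "PQ.forces_mem c \<pi> t" using PQ.forces_mem_mono[OF \<alpha>(2)] \<alpha>(1) by simp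
qed

definition decides :: "('v \<Rightarrow> nat \<Rightarrow> 'v \<Rightarrow> bool) \<Rightarrow> nat \<Rightarrow> 'v \<Rightarrow> 'v \<Rightarrow> bool" where
  "decides G k p q \<longleftrightarrow> (\<exists>\<alpha>. G \<langle>p, q\<rangle> k \<alpha>) \<or> (\<forall>d \<alpha>. d \<preceq>\<^sub>\<times> \<langle>p, q\<rangle> \<longrightarrow> \<not> G d k \<alpha>)"

lemma decides_mono:
  assumes "PQ.enumeration c t G" "decides G k p q" "p' \<preceq>\<^sub>P p" "q' \<preceq>\<^sub>Q q"
  shows "decides G k p' q'"
proof -
  have "\<langle>p', q'\<rangle> \<preceq>\<^sub>\<times> \<langle>p, q\<rangle>" using assms(3,4) by simp
  then show ?thesis
    using assms(2) PQ.enumeration_mono[OF assms(1)] PQ.below_trans unfolding decides_def by blast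
qed

lemma ex_decides:
  assumes "p \<in> elts P" "q \<in> elts Q"
  shows "\<exists>p' q'. p' \<preceq>\<^sub>P p \<and> q' \<preceq>\<^sub>Q q \<and> decides G k p' q'"
proof (cases "decides G k p q")
  case True
  then show ?thesis using P.below_refl[OF assms(1)] Q.below_refl[OF assms(2)] by blast
next
  case False
  then obtain d \<alpha> where "d \<preceq>\<^sub>\<times> \<langle>p, q\<rangle>" "G d k \<alpha>" unfolding decides_def by blast
  then show ?thesis unfolding decides_def by (elim below_PQ_cases) blast
qed

lemma forces_eq_lift_trace_name_of_decides:
  assumes t: "PQ.is_name t" and enum: "PQ.enumeration c t G" and c: "\<langle>p, q\<rangle> \<preceq>\<^sub>\<times> c"
    and decides: "\<And>k. P.densely p (\<lambda>r. decides G k r q)"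
  shows "PQ.forces_eq \<langle>p, q\<rangle> t (lift (trace_name t q))"
proof (rule forces_eq_lift_trace_name[OF t], rule PQ.denselyI)
  fix d \<pi> d' assume d: "d \<preceq>\<^sub>\<times> \<langle>p, q\<rangle>" and \<pi>: "PQ.is_name \<pi>" "PQ.forces_mem d \<pi> t" and d': "d' \<preceq>\<^sub>\<times> d"
  have d_c: "d \<preceq>\<^sub>\<times> c" using d c by (rule PQ.below_trans)
  obtain b k \<alpha> where b: "b \<preceq>\<^sub>\<times> d'" "b \<preceq>\<^sub>\<times> d" "PQ.forces_eq b \<pi> (check PQ \<alpha>)" "G b k \<alpha>"
    by (rule PQ.denselyE[OF PQ.enumeration_total[OF enum d_c \<pi>] d']) blast
  obtain p' q' where b_eq: "b = \<langle>p', q'\<rangle>" "p' \<preceq>\<^sub>P p" "q' \<preceq>\<^sub>Q q"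
    using PQ.below_trans[OF b(2) d] by (rule below_PQ_cases)
  obtain r where r: "r \<preceq>\<^sub>P p'" "r \<preceq>\<^sub>P p" "decides G k r q"
    by (rule P.denselyE[OF decides b_eq(2)])
  have e: "\<langle>r, q'\<rangle> \<preceq>\<^sub>\<times> b" "\<langle>r, q'\<rangle> \<preceq>\<^sub>\<times> \<langle>r, q\<rangle>"
    using r(1) b_eq P.below_cond(1) Q.below_cond(1) by auto
  have e_c: "\<langle>r, q'\<rangle> \<preceq>\<^sub>\<times> c" using e(1) b(2) d_c PQ.below_trans by blast
  have G_e: "G \<langle>r, q'\<rangle> k \<alpha>" using PQ.enumeration_mono[OF enum b(4) e(1)] .
  then obtain \<beta> where \<beta>: "G \<langle>r, q\<rangle> k \<beta>" using r(3) e(2) unfolding decides_def by blast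
  have "\<beta> = \<alpha>" by (rule PQ.enumeration_unique[OF enum e_c PQ.enumeration_mono[OF enum \<beta> e(2)] G_e])
  then have "PQ.forces_mem \<langle>r, q\<rangle> (check PQ \<alpha>) t" using PQ.enumeration_mem[OF enum \<beta>] by simp
  moreover have "PQ.forces_eq \<langle>r, q'\<rangle> \<pi> (check PQ \<alpha>)" using b(3) e(1) by (rule PQ.forces_eq_mono)
  moreover have "\<langle>r, q'\<rangle> \<preceq>\<^sub>\<times> d'" using e(1) b(1) by (rule PQ.below_trans)
  ultimately show "\<exists>d. d \<preceq>\<^sub>\<times> d' \<and> (\<exists>r x \<alpha>. d = \<langle>r, x\<rangle> \<and> PQ.forces_eq d \<pi> (check PQ \<alpha>) \<and>
      PQ.forces_mem \<langle>r, q\<rangle> (check PQ \<alpha>) t)"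
    by blast
qed

lemma ex_forces_eq_lift:
  assumes sp: "strongly_proper_on_stationary P leP" and closed: "omega1_closed Q leQ"
    and t: "PQ.is_name t" "\<langle>p, q\<rangle> \<tturnstile>\<^sub>\<times> CountableSetOfOrdinals t" and pq: "p \<in> elts P" "q \<in> elts Q"
  shows "\<exists>p' q' x. p' \<preceq>\<^sub>P p \<and> q' \<preceq>\<^sub>Q q \<and> P.is_name x \<and> PQ.forces_eq \<langle>p', q'\<rangle> t (lift x)"
proof -
  obtain c G where "c \<preceq>\<^sub>\<times> \<langle>p, q\<rangle>" and enum: "PQ.enumeration c t G"
    using PQ.ex_enumeration[OF t(2,1)] pq by auto
  then obtain p\<^sub>0 q\<^sub>0 where c: "c = \<langle>p\<^sub>0, q\<^sub>0\<rangle>" "p\<^sub>0 \<preceq>\<^sub>P p" "q\<^sub>0 \<preceq>\<^sub>Q q" by (elim below_PQ_cases)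
  have "\<exists>p q. p \<preceq>\<^sub>P p\<^sub>0 \<and> q \<preceq>\<^sub>Q q\<^sub>0 \<and> (\<forall>k. P.densely p (\<lambda>r. decides G k r q))"
    by (rule strongly_proper_product_dense[where A = "decides G", OF sp closed])
      (use decides_mono[OF enum] ex_decides c(2,3) P.below_cond(1) Q.below_cond(1) in blast)+
  then obtain p\<^sub>1 q\<^sub>1 where p\<^sub>1: "p\<^sub>1 \<preceq>\<^sub>P p\<^sub>0" and q\<^sub>1: "q\<^sub>1 \<preceq>\<^sub>Q q\<^sub>0"
    and decides: "\<And>k. P.densely p\<^sub>1 (\<lambda>r. decides G k r q\<^sub>1)"
    by blast
  have "\<langle>p\<^sub>1, q\<^sub>1\<rangle> \<preceq>\<^sub>\<times> c" using p\<^sub>1 q\<^sub>1 by (simp add: c(1))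
  from forces_eq_lift_trace_name_of_decides[OF t(1) enum this decides]
  have "PQ.forces_eq \<langle>p\<^sub>1, q\<^sub>1\<rangle> t (lift (trace_name t q\<^sub>1))" .
  moreover have "p\<^sub>1 \<preceq>\<^sub>P p" "q\<^sub>1 \<preceq>\<^sub>Q q" using P.below_trans[OF p\<^sub>1 c(2)] Q.below_trans[OF q\<^sub>1 c(3)] .
  ultimately show ?thesis using is_name_trace_name by blast
qed

lemma forces_DenseBelow_IsCheck:
  assumes sp: "strongly_proper_on_stationary P leP" and closed: "omega1_closed Q leQ"
    and \<rho>: "P.is_name \<rho>" "P.forces_eq p \<rho> (check P q)" and pq: "p \<in> elts P" "q \<in> elts Q"
    and \<tau>: "P.is_name \<tau>" "p \<tturnstile>\<^sub>P IsName check_Q \<tau>"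
      "p \<tturnstile>\<^sub>P Forces check_Q check_leQ (CountableSetOfOrdinals \<tau>) \<rho>"
  shows "p \<tturnstile>\<^sub>P DenseBelow check_Q check_leQ \<rho> (\<lambda>r. Exists (\<lambda>x. Exists (\<lambda>c.
    Conj (IsCheck check_Q x c) (Forces check_Q check_leQ (Eq \<tau> c) r))))"
proof -
  define F where "F r = Exists (\<lambda>x. Exists (\<lambda>c.
    Conj (IsCheck check_Q x c) (ForcesEq check_Q check_leQ r \<tau> c)))" for r
  obtain t where t: "represents p \<tau> t"
    using forces_IsName_ex_represents[OF \<tau>(1) pq(1) \<tau>(2)] by blast
  have "fm_rel {(t, \<tau>)} (CountableSetOfOrdinals t) (CountableSetOfOrdinals \<tau>)"
    by (rule fm_rel_CountableSetOfOrdinals) simp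
  from forces_Forces_iff[OF this _ pq \<rho>]
  have cso: "\<langle>p, q\<rangle> \<tturnstile>\<^sub>\<times> CountableSetOfOrdinals t" using t \<tau>(3) by blast
  have "PQ.densely \<langle>p, q\<rangle> (\<lambda>c. \<exists>r x. c = \<langle>r, x\<rangle> \<and> r \<tturnstile>\<^sub>P F (check P x))"
    unfolding PQ_densely
  proof (intro allI impI)
    fix p' q' assume below: "p' \<preceq>\<^sub>P p" "q' \<preceq>\<^sub>Q q"
    have "\<langle>p', q'\<rangle> \<tturnstile>\<^sub>\<times> CountableSetOfOrdinals t" by (rule PQ.forces_mono[OF cso]) (use below in simp)
    from ex_forces_eq_lift[OF sp closed representsD(2)[OF t] this
        P.below_cond(1)[OF below(1)] Q.below_cond(1)[OF below(2)]]
    obtain r y x where x: "r \<preceq>\<^sub>P p'" "y \<preceq>\<^sub>Q q'" "P.is_name x" "PQ.forces_eq \<langle>r, y\<rangle> t (lift x)"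
      by blast
    have "r \<tturnstile>\<^sub>P ForcesEq check_Q check_leQ (check P y) \<tau> (nest (lift x))"
      using forces_ForcesEq_iff[OF represents_mono[OF t P.below_trans[OF x(1) below(1)]]
          represents_nest[OF is_name_lift[OF x(3)]] Q.below_cond(1)[OF x(2)]
          P.is_name_check P.forces_eq_refl] x(4) by blast
    then have "r \<tturnstile>\<^sub>P F (check P y)"
      unfolding F_def using forces_IsCheck[OF x(3)] is_name_nest_lift[OF x(3)]
      by (intro P.forces_ExistsI[OF x(3)] P.forces_ExistsI[of "nest (lift x)"])
        (simp_all add: P.forces_Conj)
    then show "\<exists>p'' q''. p'' \<preceq>\<^sub>P p' \<and> q'' \<preceq>\<^sub>Q q' \<and> (\<exists>r x. \<langle>p'', q''\<rangle> = \<langle>r, x\<rangle> \<and> r \<tturnstile>\<^sub>P F (check P x))"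
      using x(1,2) by blast
  qed
  moreover have "P.uniform F" unfolding F_def by (intro P.uniformI fm_rel_intros) (use \<tau>(1) in auto)
  ultimately have "p \<tturnstile>\<^sub>P DenseBelow check_Q check_leQ \<rho> F"
    using forces_DenseBelow_check[OF \<rho>] by blast
  then show ?thesis unfolding F_def by simp
qed

end

theorem theorem2p3:
  fixes P leP Q leQ :: "'v::zfc"
  assumes "forcing_poset P leP"
    and "strongly_proper_on_stationary P leP"
    and "forcing_poset Q leQ"
    and "omega1_closed Q leQ"
  shows "forced P leP (Omega1Distributive (check P Q) (check P leQ))"
proof -
  interpret two_forcing P leP Q leQ
    by unfold_locales (fact assms)+
  show ?thesis
    unfolding P.forced_iff Omega1Distributive_def P.forces_BForall_check_elts P.forces_Forall
      P.forces_Imp P.forces_Conj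
  proof (intro ballI allI impI, elim conjE)
    fix p q r \<rho> \<tau> r'
    assume q: "q \<in> elts Q" and \<rho>: "P.is_name \<rho>" "P.forces_eq r \<rho> (check P q)" and r': "r' \<preceq>\<^sub>P r"
      and \<tau>: "P.is_name \<tau>" "r' \<tturnstile>\<^sub>P IsName check_Q \<tau>"
        "r' \<tturnstile>\<^sub>P Forces check_Q check_leQ (CountableSetOfOrdinals \<tau>) \<rho>"
    show "r' \<tturnstile>\<^sub>P DenseBelow check_Q check_leQ \<rho> (\<lambda>r. Exists (\<lambda>x. Exists (\<lambda>c.
        Conj (IsCheck check_Q x c) (Forces check_Q check_leQ (Eq \<tau> c) r))))"
      by (rule forces_DenseBelow_IsCheck[OF assms(2,4) \<rho>(1) P.forces_eq_mono[OF \<rho>(2) r']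
            P.below_cond(1)[OF r'] q \<tau>])
  qed
qed

end
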